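(* Identify $\mathfrak F/\mathcal G$ with $\mathfrak N$ via the normalization map $\Pi:\mathfrak F\to\mathfrak N$. Then the quotient topology $\tau_Q$ on $\mathfrak F/\mathcal G\simeq\mathfrak N$ (a set $U\subset\mathfrak N$ is open iff $\Pi^{-1}(U)$ is open in $\mathfrak F$) coincides with the topology $\tau_J$ induced on $\mathfrak N$ as a subset of $\mathfrak F$, where $\mathfrak F$ carries the topology induced by the jet space $J_0^3(\mathbb H^2,\mathbb H^3_\varepsilon)$.
   Context: Fix $\varepsilon\in\{+1,-1\}$. Let $\mathbb H^2=\{(z,w)\in\mathbb C^2:\operatorname{Im} w=|z|^2\}$ and $\mathbb H^3_\varepsilon=\{(z_1',z_2',w')\in\mathbb C^3:\operatorname{Im} w'=|z_1'|^2+\varepsilon|z_2'|^2\}$. Class $\mathcal F$: the set of germs at $0\in\mathbb C^2$ of holomorphic maps $H=(f_1,f_2,g)$ into $\mathbb C^3$ such that $H(0)=0$, $H(U\cap\mathbb H^2)\subset\mathbb H^3_\varepsilon$ for some neighborhood $U$ of $0$, $f_{1z}(0)f_{2z^2}(0)-f_{2z}(0)f_{1z^2}(0)\neq 0$ and $g_w(0)>0$. Subscripts denote partial derivatives. Topology: $J_0^3(\mathbb H^2,\mathbb H^3_\varepsilon)$ is the space of $3$-jets at $0$ of germs of holomorphic maps $(\mathbb C^2,0)\to(\mathbb C^3,0)$ sending $\mathbb H^2$ into $\mathbb H^3_\varepsilon$ near $0$; the $3$-jet $j_0^3H$ is the collection of all partial derivatives of $H$ at $0$ of order at most $3$, and the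 jet space carries the topology of the finite-dimensional complex vector space containing it. Elements of $\mathcal F$ are determined by their $3$-jets, and $\mathcal F$ and its subsets carry the topology $\tau_J$ induced by $H\mapsto j_0^3H$. Isotropy group $\mathcal G$: the direct product of the groups (under composition) of germs at $0$ of the following two kinds of maps. With $\gamma=(\lambda,r,u,c)\in\Gamma=\mathbb R^+\times\mathbb R\times\{|u|=1\}\times\mathbb C$, $$\sigma_\gamma(z,w)=\frac{(\lambda u(z+cw),\lambda^2w)}{1-2i\bar c z+(r-i|c|^2)w};$$ with $\gamma'=(\lambda',r',u',a',c')$, $\lambda'\in\mathbb R^+$, $r'\in\mathbb R$, $|u'|=1$, $a'=(a_1',a_2')\in\mathbb C^2$ with $|a_1'|^2+\varepsilon|a_2'|^2=1$, $c'=(c_1',c_2')\in\mathbb C^2$, and $U'=\begin{pmatrix}u'a_1'&-\varepsilon u'a_2'\\ \bar a_2'&\bar a_1'\end{pmatrix}$, $$\sigma'_{\gamma'}(z',w')=\frac{(\lambda'U'\,{}^t(z'+c'w'),{\lambda'}^2w')}{1-2i(\bar c_1'z_1'+\varepsilon\bar c_2'z_2')+(r'-i(|c_1'|^2+\varepsilon|c_2'|^2))w'}.$$ These are isotropies at $0$ of $\mathbb H^2$ and $\mathbb H^3_\varepsilon$ respectively. $\mathcal G$ acts on $\mathcal F$ by $(\phi,\phi')\cdot H=\phi'\circ H\circ\phi^{-1}$. Sets $\mathfrak N$ and $\mathfrak F$: for $s\ge0$ put $$G_{2,s}^{\varepsilon}(z,w)=\frac{\bigl(4z-4\varepsilon sz^2+i(\varepsilon-s^2)zw+sw^2,\;4z^2+s^2w^2,\;w(4-4\varepsilon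 sz-i(\varepsilon+s^2)w)\bigr)}{4-4\varepsilon sz-i(\varepsilon+s^2)w-2iszw-\varepsilon s^2w^2},$$ and $G_{3,s}^\varepsilon=(P_1,P_2,P_3)/Q$ with $P_1=256\varepsilon z+96izw+64\varepsilon sw^2+64z^3+64i\varepsilon sz^2w-3(3\varepsilon-16s^2)zw^2+4isw^3$, $P_2=256\varepsilon z^2-16w^2+256sz^3+16iz^2w-16\varepsilon szw^2-i\varepsilon w^3$, $P_3=w(256\varepsilon-32iw+64z^2-64i\varepsilon szw-(\varepsilon+16s^2)w^2)$, $Q=256\varepsilon-32iw+64z^2-192i\varepsilon szw-(17\varepsilon+144s^2)w^2+32i\varepsilon z^2w+24szw^2+iw^3$. Let $\mathfrak N=\{G_{2,s}^\varepsilon,G_{3,s}^\varepsilon:s>0\}\subset\mathcal F$ and let $\mathfrak F=\{\phi'\circ H\circ\phi^{-1}:H\in\mathfrak N,(\phi,\phi')\in\mathcal G\}\subset\mathcal F$. Each $\mathcal G$-orbit in $\mathfrak F$ contains exactly one element of $\mathfrak N$; $\Pi:\mathfrak F\to\mathfrak N$ sends $H$ to the unique element of $\mathfrak N$ in its orbit. *)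

theory Defs
  imports "HOL-Complex_Analysis.Complex_Analysis"
begin

section \<open>Germs of continuous maps fixing the origin\<close>

quotient_type (overloaded) ('a, 'b) germ =
  "'a::{t2_space, zero} \<Rightarrow> 'b::{t2_space, zero}" / partial:
  "\<lambda>f g. f 0 = 0 \<and> g 0 = 0 \<and> isCont f 0 \<and> isCont g 0 \<and> (\<forall>\<^sub>F x in nhds 0. f x = g x)"
proof (rule part_equivpI)
  show "\<exists>f::'a \<Rightarrow> 'b. f 0 = 0 \<and> f 0 = 0 \<and> isCont f 0 \<and> isCont f 0 \<and> (\<forall>\<^sub>F x in nhds 0. f x = f x)"
    by (rule exI[of _ "\<lambda>_. 0"]) simp
next
  show "symp (\<lambda>f g::'a \<Rightarrow> 'b. f 0 = 0 \<and> g 0 = 0 \<and> isCont f 0 \<and> isCont g 0 \<and> (\<forall>\<^sub>F x in nhds 0. f x = g x))"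
    unfolding symp_def by (metis (mono_tags, lifting) eventually_mono)
next
  have "\<forall>\<^sub>F x in nhds 0. f x = h x"
    if "\<forall>\<^sub>F x in nhds 0. f x = g x" "\<forall>\<^sub>F x in nhds 0. g x = h x" for f g h :: "'a \<Rightarrow> 'b"
    using that by eventually_elim simp
  then show "transp (\<lambda>f g::'a \<Rightarrow> 'b. f 0 = 0 \<and> g 0 = 0 \<and> isCont f 0 \<and> isCont g 0 \<and> (\<forall>\<^sub>F x in nhds 0. f x = g x))"
    unfolding transp_def by blast
qed

text \<open>The germ represented by \<open>f\<close>; only meaningful if \<open>f\<close> is continuous at 0 with \<open>f 0 = 0\<close>.\<close>

definition germ_of :: "('a::{t2_space, zero} \<Rightarrow> 'b::{t2_space, zero}) \<Rightarrow> ('a, 'b) germ" where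
  "germ_of f = abs_germ f"

lemma isCont_0_filterlim:
  assumes "isCont f 0" "f 0 = 0"
  shows "filterlim f (nhds 0) (nhds 0)"
  using assms by (metis continuous_at tendsto_at_iff_tendsto_nhds)

lift_definition germ_id :: "('a::{t2_space, zero}, 'a) germ" is "\<lambda>x. x"
  by simp

lift_definition germ_comp ::
  "('b::{t2_space, zero}, 'c::{t2_space, zero}) germ \<Rightarrow> ('a::{t2_space, zero}, 'b) germ \<Rightarrow> ('a, 'c) germ"
  (infixl "\<circ>\<^sub>g" 55) is "\<lambda>g f. g \<circ> f"
proof -
  fix g1 g2 :: "'b \<Rightarrow> 'c" and f1 f2 :: "'a \<Rightarrow> 'b"
  assume g: "g1 0 = 0 \<and> g2 0 = 0 \<and> isCont g1 0 \<and> isCont g2 0 \<and> (\<forall>\<^sub>F x in nhds 0. g1 x = g2 x)"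
    and f: "f1 0 = 0 \<and> f2 0 = 0 \<and> isCont f1 0 \<and> isCont f2 0 \<and> (\<forall>\<^sub>F x in nhds 0. f1 x = f2 x)"
  have "\<forall>\<^sub>F y in nhds 0. g1 y = g2 y" "filterlim f1 (nhds 0) (nhds 0)"
    using g f by (blast intro: isCont_0_filterlim)+
  then have "\<forall>\<^sub>F x in nhds 0. g1 (f1 x) = g2 (f1 x)"
    by (rule eventually_compose_filterlim)
  moreover have "\<forall>\<^sub>F x in nhds 0. f1 x = f2 x"
    using f by blast
  ultimately have "\<forall>\<^sub>F x in nhds 0. (g1 \<circ> f1) x = (g2 \<circ> f2) x"
    by eventually_elim simp
  then show "(g1 \<circ> f1) 0 = 0 \<and> (g2 \<circ> f2) 0 = 0 \<and> isCont (g1 \<circ> f1) 0 \<and> isCont (g2 \<circ> f2) 0 \<and>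
      (\<forall>\<^sub>F x in nhds 0. (g1 \<circ> f1) x = (g2 \<circ> f2) x)"
    using f g by (auto intro!: continuous_at_compose)
qed

definition germ_inv :: "('a::{t2_space, zero}, 'a) germ \<Rightarrow> ('a, 'a) germ" where
  "germ_inv \<phi> = (THE \<psi>. \<psi> \<circ>\<^sub>g \<phi> = germ_id \<and> \<phi> \<circ>\<^sub>g \<psi> = germ_id)"


section \<open>Germs of maps from \<open>\<complex>\<^sup>2\<close> to \<open>\<complex>\<^sup>3\<close> and their jets\<close>

type_synonym C2 = "complex \<times> complex"
type_synonym C3 = "complex \<times> complex \<times> complex"

text \<open>Complex differentiability, i.e. existence of a complex-linear Frechet derivative.\<close>

definition holo_at :: "(C2 \<Rightarrow> complex) \<Rightarrow> C2 \<Rightarrow> bool" where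
  "holo_at f p \<longleftrightarrow> (\<exists>a b. (f has_derivative (\<lambda>(h, k). a * h + b * k)) (at p))"

lemma holo_at_cong:
  assumes "\<forall>\<^sub>F x in nhds p. f x = g x"
  shows "holo_at f p \<longleftrightarrow> holo_at g p"
proof -
  have "(g has_derivative D) (at p)"
    if "(f has_derivative D) (at p)" "\<forall>\<^sub>F x in nhds p. f x = g x" for f g D
    using that(1)
  proof (rule has_derivative_transform_eventually)
    show "\<forall>\<^sub>F x in at p. f x = g x"
      using that(2) by (simp add: eventually_at_filter eventually_mono)
    show "f p = g p"
      using that(2) by (rule eventually_nhds_x_imp_x)
  qed simp
  moreover have "\<forall>\<^sub>F x in nhds p. g x = f x"
    using assms by (auto elim: eventually_mono)
  ultimately show ?thesis
    unfolding holo_at_def using assms by blast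
qed

lift_definition holomorphic_germ :: "(C2, C3) germ \<Rightarrow> bool" is
  "\<lambda>H. \<forall>\<^sub>F p in nhds 0. holo_at (\<lambda>x. fst (H x)) p \<and> holo_at (\<lambda>x. fst (snd (H x))) p
        \<and> holo_at (\<lambda>x. snd (snd (H x))) p"
proof -
  fix H K :: "C2 \<Rightarrow> C3"
  assume "H 0 = 0 \<and> K 0 = 0 \<and> isCont H 0 \<and> isCont K 0 \<and> (\<forall>\<^sub>F x in nhds 0. H x = K x)"
  then have "\<forall>\<^sub>F p in nhds 0. \<forall>\<^sub>F x in nhds p. H x = K x"
    by (simp add: eventually_eventually)
  then have *: "\<forall>\<^sub>F p in nhds 0. (holo_at (\<lambda>x. l (H x)) p \<longleftrightarrow> holo_at (\<lambda>x. l (K x)) p)" for l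
    by eventually_elim (auto intro!: holo_at_cong elim!: eventually_mono)
  have "\<forall>\<^sub>F p in nhds 0.
      (holo_at (\<lambda>x. fst (H x)) p \<and> holo_at (\<lambda>x. fst (snd (H x))) p \<and> holo_at (\<lambda>x. snd (snd (H x))) p) =
      (holo_at (\<lambda>x. fst (K x)) p \<and> holo_at (\<lambda>x. fst (snd (K x))) p \<and> holo_at (\<lambda>x. snd (snd (K x))) p)"
    using *[of fst] *[of "\<lambda>y. fst (snd y)"] *[of "\<lambda>y. snd (snd y)"]
    by eventually_elim simp
  then show "(\<forall>\<^sub>F p in nhds 0. holo_at (\<lambda>x. fst (H x)) p \<and> holo_at (\<lambda>x. fst (snd (H x))) p
        \<and> holo_at (\<lambda>x. snd (snd (H x))) p) =
      (\<forall>\<^sub>F p in nhds 0. holo_at (\<lambda>x. fst (K x)) p \<and> holo_at (\<lambda>x. fst (snd (K x))) p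
        \<and> holo_at (\<lambda>x. snd (snd (K x))) p)"
    by (rule eventually_subst)
qed

lift_definition maps_into :: "(C2, C3) germ \<Rightarrow> C2 set \<Rightarrow> C3 set \<Rightarrow> bool" is
  "\<lambda>H A B. \<forall>\<^sub>F p in nhds 0. p \<in> A \<longrightarrow> H p \<in> B"
proof (intro ext)
  fix H K :: "C2 \<Rightarrow> C3" and A B
  assume "H 0 = 0 \<and> K 0 = 0 \<and> isCont H 0 \<and> isCont K 0 \<and> (\<forall>\<^sub>F x in nhds 0. H x = K x)"
  then have "\<forall>\<^sub>F x in nhds 0. H x = K x" by blast
  then show "(\<forall>\<^sub>F p in nhds 0. p \<in> A \<longrightarrow> H p \<in> B) = (\<forall>\<^sub>F p in nhds 0. p \<in> A \<longrightarrow> K p \<in> B)"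
    by (intro eventually_subst) (auto elim: eventually_mono)
qed

text \<open>\<open>pd i j f\<close> is the partial derivative of \<open>f\<close> at 0, of order \<open>i\<close> in \<open>z\<close> and \<open>j\<close> in \<open>w\<close>.\<close>

definition pd :: "nat \<Rightarrow> nat \<Rightarrow> (C2 \<Rightarrow> complex) \<Rightarrow> complex" where
  "pd i j f = (deriv ^^ i) (\<lambda>z. (deriv ^^ j) (\<lambda>w. f (z, w)) 0) 0"

lemma pd_cong:
  assumes "\<forall>\<^sub>F x in nhds 0. f x = g x"
  shows "pd i j f = pd i j g"
proof -
  have "\<forall>\<^sub>F x in nhds (0::complex) \<times>\<^sub>F nhds (0::complex). f x = g x"
    using assms by (simp add: nhds_prod zero_prod_def)
  then obtain P Q where P: "eventually P (nhds 0)" and Q: "eventually Q (nhds 0)"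
    and PQ: "\<And>z w. P z \<Longrightarrow> Q w \<Longrightarrow> f (z, w) = g (z, w)"
    unfolding eventually_prod_filter by auto
  have "\<forall>\<^sub>F z in nhds 0. (deriv ^^ j) (\<lambda>w. f (z, w)) 0 = (deriv ^^ j) (\<lambda>w. g (z, w)) 0"
    using P
  proof eventually_elim
    case (elim z)
    show ?case
      using Q by (intro higher_deriv_cong_ev refl) (auto elim!: eventually_mono intro: PQ[OF elim])
  qed
  then show ?thesis
    unfolding pd_def by (intro higher_deriv_cong_ev refl)
qed

lift_definition germ_pd :: "nat \<Rightarrow> nat \<Rightarrow> (C2, C3) germ \<Rightarrow> C3" is
  "\<lambda>i j H. (pd i j (\<lambda>x. fst (H x)), pd i j (\<lambda>x. fst (snd (H x))), pd i j (\<lambda>x. snd (snd (H x))))"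
proof -
  fix i j and H K :: "C2 \<Rightarrow> C3"
  assume "H 0 = 0 \<and> K 0 = 0 \<and> isCont H 0 \<and> isCont K 0 \<and> (\<forall>\<^sub>F x in nhds 0. H x = K x)"
  then have "\<forall>\<^sub>F x in nhds 0. H x = K x" by blast
  then have "pd i j (\<lambda>x. l (H x)) = pd i j (\<lambda>x. l (K x))" for l
    by (intro pd_cong) (auto elim: eventually_mono)
  from this[of fst] this[of "\<lambda>y. fst (snd y)"] this[of "\<lambda>y. snd (snd y)"]
  show "(pd i j (\<lambda>x. fst (H x)), pd i j (\<lambda>x. fst (snd (H x))), pd i j (\<lambda>x. snd (snd (H x)))) =
      (pd i j (\<lambda>x. fst (K x)), pd i j (\<lambda>x. fst (snd (K x))), pd i j (\<lambda>x. snd (snd (K x))))"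
    by simp
qed

definition pd_f1 :: "nat \<Rightarrow> nat \<Rightarrow> (C2, C3) germ \<Rightarrow> complex" where
  "pd_f1 i j H = fst (germ_pd i j H)"

definition pd_f2 :: "nat \<Rightarrow> nat \<Rightarrow> (C2, C3) germ \<Rightarrow> complex" where
  "pd_f2 i j H = fst (snd (germ_pd i j H))"

definition pd_g :: "nat \<Rightarrow> nat \<Rightarrow> (C2, C3) germ \<Rightarrow> complex" where
  "pd_g i j H = snd (snd (germ_pd i j H))"

definition multi_indices3 :: "(nat \<times> nat) set" where
  "multi_indices3 = {(i, j). i + j \<le> 3}"

text \<open>The 3-jet is an element of the finite product of copies of \<open>\<complex>\<^sup>3\<close> over \<^const>\<open>multi_indices3\<close>.\<close>

definition jet3 :: "(C2, C3) germ \<Rightarrow> (nat \<times> nat \<Rightarrow> C3)" where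
  "jet3 H = (\<lambda>(i, j)\<in>multi_indices3. germ_pd i j H)"

definition jet_vector_space :: "(nat \<times> nat \<Rightarrow> C3) topology" where
  "jet_vector_space = product_topology (\<lambda>_. euclidean) multi_indices3"


section \<open>Hyperquadrics, the class \<open>\<F>\<close> and its topology\<close>

definition hyperquadric2 :: "C2 set" where
  "hyperquadric2 = {(z, w). Im w = (cmod z)\<^sup>2}"

definition hyperquadric3 :: "real \<Rightarrow> C3 set" where
  "hyperquadric3 \<epsilon> = {(z1, z2, w). Im w = (cmod z1)\<^sup>2 + \<epsilon> * (cmod z2)\<^sup>2}"

definition jet_space :: "real \<Rightarrow> (nat \<times> nat \<Rightarrow> C3) topology" where
  "jet_space \<epsilon> = subtopology jet_vector_space
     (jet3 ` {H. holomorphic_germ H \<and> maps_into H hyperquadric2 (hyperquadric3 \<epsilon>)})"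

text \<open>\<open>g\<^sub>w(0) > 0\<close> says that the complex number \<open>g\<^sub>w(0)\<close> is real and positive.\<close>

definition class_F :: "real \<Rightarrow> (C2, C3) germ set" where
  "class_F \<epsilon> = {H. holomorphic_germ H \<and> maps_into H hyperquadric2 (hyperquadric3 \<epsilon>)
     \<and> pd_f1 1 0 H * pd_f2 2 0 H - pd_f2 1 0 H * pd_f1 2 0 H \<noteq> 0
     \<and> pd_g 0 1 H \<in> \<real> \<and> Re (pd_g 0 1 H) > 0}"

definition tau_J :: "real \<Rightarrow> (C2, C3) germ topology" where
  "tau_J \<epsilon> = pullback_topology (class_F \<epsilon>) jet3 (jet_space \<epsilon>)"


section \<open>Isotropies and their action\<close>

definition sigma :: "real \<Rightarrow> real \<Rightarrow> complex \<Rightarrow> complex \<Rightarrow> C2 \<Rightarrow> C2" where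
  "sigma l r u c = (\<lambda>(z, w).
     let d = 1 - 2 * \<i> * cnj c * z + (of_real r - \<i> * of_real ((cmod c)\<^sup>2)) * w
     in (of_real l * u * (z + c * w) / d, of_real (l\<^sup>2) * w / d))"

text \<open>The matrix \<open>U'\<close> has rows \<open>(u a1, -\<epsilon> u a2)\<close> and \<open>(cnj a2, cnj a1)\<close>.\<close>

definition sigma' ::
  "real \<Rightarrow> real \<Rightarrow> real \<Rightarrow> complex \<Rightarrow> complex \<Rightarrow> complex \<Rightarrow> complex \<Rightarrow> complex \<Rightarrow> C3 \<Rightarrow> C3" where
  "sigma' \<epsilon> l r u a1 a2 c1 c2 = (\<lambda>(z1, z2, w).
     let d = 1 - 2 * \<i> * (cnj c1 * z1 + of_real \<epsilon> * cnj c2 * z2)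
               + (of_real r - \<i> * of_real ((cmod c1)\<^sup>2 + \<epsilon> * (cmod c2)\<^sup>2)) * w;
         v1 = z1 + c1 * w;
         v2 = z2 + c2 * w
     in (of_real l * (u * a1 * v1 - of_real \<epsilon> * u * a2 * v2) / d,
         of_real l * (cnj a2 * v1 + cnj a1 * v2) / d,
         of_real (l\<^sup>2) * w / d))"

definition isotropies2 :: "(C2, C2) germ set" where
  "isotropies2 = {germ_of (sigma l r u c) | l r u c. l > 0 \<and> cmod u = 1}"

definition isotropies3 :: "real \<Rightarrow> (C3, C3) germ set" where
  "isotropies3 \<epsilon> = {germ_of (sigma' \<epsilon> l r u a1 a2 c1 c2) | l r u a1 a2 c1 c2.
     l > 0 \<and> cmod u = 1 \<and> (cmod a1)\<^sup>2 + \<epsilon> * (cmod a2)\<^sup>2 = 1}"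

definition isotropy_group :: "real \<Rightarrow> ((C2, C2) germ \<times> (C3, C3) germ) set" where
  "isotropy_group \<epsilon> = isotropies2 \<times> isotropies3 \<epsilon>"

definition act :: "(C2, C2) germ \<times> (C3, C3) germ \<Rightarrow> (C2, C3) germ \<Rightarrow> (C2, C3) germ" where
  "act = (\<lambda>(\<phi>, \<phi>') H. \<phi>' \<circ>\<^sub>g H \<circ>\<^sub>g germ_inv \<phi>)"

definition orbit_of :: "real \<Rightarrow> (C2, C3) germ \<Rightarrow> (C2, C3) germ set" where
  "orbit_of \<epsilon> H = (\<lambda>p. act p H) ` isotropy_group \<epsilon>"


section \<open>The families \<open>G\<^sub>2\<close>, \<open>G\<^sub>3\<close> and the quotient topology\<close>

definition G2 :: "real \<Rightarrow> real \<Rightarrow> C2 \<Rightarrow> C3" where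
  "G2 \<epsilon> s = (\<lambda>(z, w).
     let e = complex_of_real \<epsilon>; t = complex_of_real s;
         d = 4 - 4 * e * t * z - \<i> * (e + t^2) * w - 2 * \<i> * t * z * w - e * t^2 * w^2
     in ((4 * z - 4 * e * t * z^2 + \<i> * (e - t^2) * z * w + t * w^2) / d,
         (4 * z^2 + t^2 * w^2) / d,
         w * (4 - 4 * e * t * z - \<i> * (e + t^2) * w) / d))"

definition G3 :: "real \<Rightarrow> real \<Rightarrow> C2 \<Rightarrow> C3" where
  "G3 \<epsilon> s = (\<lambda>(z, w).
     let e = complex_of_real \<epsilon>; t = complex_of_real s;
         P1 = 256 * e * z + 96 * \<i> * z * w + 64 * e * t * w^2 + 64 * z^3 + 64 * \<i> * e * t * z^2 * w
              - 3 * (3 * e - 16 * t^2) * z * w^2 + 4 * \<i> * t * w^3;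
         P2 = 256 * e * z^2 - 16 * w^2 + 256 * t * z^3 + 16 * \<i> * z^2 * w - 16 * e * t * z * w^2
              - \<i> * e * w^3;
         P3 = w * (256 * e - 32 * \<i> * w + 64 * z^2 - 64 * \<i> * e * t * z * w - (e + 16 * t^2) * w^2);
         Q = 256 * e - 32 * \<i> * w + 64 * z^2 - 192 * \<i> * e * t * z * w - (17 * e + 144 * t^2) * w^2
             + 32 * \<i> * e * z^2 * w + 24 * t * z * w^2 + \<i> * w^3
     in (P1 / Q, P2 / Q, P3 / Q))"

definition normal_forms :: "real \<Rightarrow> (C2, C3) germ set" where
  "normal_forms \<epsilon> = {germ_of (G2 \<epsilon> s) | s. s > 0} \<union> {germ_of (G3 \<epsilon> s) | s. s > 0}"

definition frak_F :: "real \<Rightarrow> (C2, C3) germ set" where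
  "frak_F \<epsilon> = {act p H | p H. H \<in> normal_forms \<epsilon> \<and> p \<in> isotropy_group \<epsilon>}"

text \<open>\<open>THE\<close> is meaningful on \<^const>\<open>frak_F\<close> only, where every orbit meets
  \<^const>\<open>normal_forms\<close> in exactly one germ.  For \<open>\<epsilon> = -1\<close> the two families meet at \<open>s = 1/2\<close>,
  so the parametrization of \<^const>\<open>normal_forms\<close> is not injective there.\<close>

definition normalization :: "real \<Rightarrow> (C2, C3) germ \<Rightarrow> (C2, C3) germ" where
  "normalization \<epsilon> H = (THE N. N \<in> normal_forms \<epsilon> \<and> N \<in> orbit_of \<epsilon> H)"

definition tau_J_frak_F :: "real \<Rightarrow> (C2, C3) germ topology" where
  "tau_J_frak_F \<epsilon> = subtopology (tau_J \<epsilon>) (frak_F \<epsilon>)"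

definition tau_J_normal_forms :: "real \<Rightarrow> (C2, C3) germ topology" where
  "tau_J_normal_forms \<epsilon> = subtopology (tau_J_frak_F \<epsilon>) (normal_forms \<epsilon>)"

definition tau_Q :: "real \<Rightarrow> (C2, C3) germ topology" where
  "tau_Q \<epsilon> = topology (\<lambda>U. U \<subseteq> normal_forms \<epsilon> \<and>
     openin (tau_J_frak_F \<epsilon>) {H \<in> frak_F \<epsilon>. normalization \<epsilon> H \<in> U})"

lemma openin_tau_Q:
  "openin (tau_Q \<epsilon>) U \<longleftrightarrow> U \<subseteq> normal_forms \<epsilon> \<and>
     openin (tau_J_frak_F \<epsilon>) {H \<in> frak_F \<epsilon>. normalization \<epsilon> H \<in> U}"
proof -
  let ?pre = "\<lambda>U. {H \<in> frak_F \<epsilon>. normalization \<epsilon> H \<in> U}"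
  have 1: "?pre (S \<inter> T) = ?pre S \<inter> ?pre T" for S T by auto
  have 2: "?pre (\<Union>K) = (\<Union>S\<in>K. ?pre S)" for K by auto
  have "istopology (\<lambda>U. U \<subseteq> normal_forms \<epsilon> \<and> openin (tau_J_frak_F \<epsilon>) (?pre U))"
    unfolding istopology_def 1 2 by blast
  then show ?thesis
    unfolding tau_Q_def by (simp add: topology_inverse')
qed

end

theory Submission
  imports Defs
begin

text \<open>
  Write \<open>\<Pi>\<close> for \<^const>\<open>normalization\<close>.  The two topologies agree as soon as \<open>\<Pi>\<close> fixes every normal
  form and is continuous from \<^term>\<open>frak_F \<epsilon>\<close> to \<^term>\<open>normal_forms \<epsilon>\<close>, the latter with the topology of
  3-jets: if \<open>\<Pi>\<close> is continuous then sets that are open for the jets have open preimages, and if the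
  preimage of \<open>U\<close> is open then so is its trace on the normal forms, which is \<open>U\<close> itself.

  Both properties come from two functions \<open>s\<close> and \<open>b\<close> of the 2-jet that are constant on orbits and
  continuous (\<open>param_s\<close>, \<open>param_b\<close>).  A normal form has the 2-jet
  \<open>f\<^sub>1 = z + (\<i>\<epsilon>/2) z w + (s/4) w\<^sup>2\<close>, \<open>f\<^sub>2 = z\<^sup>2 + b w\<^sup>2\<close>, \<open>g = w\<close>,
  with \<open>b = s\<^sup>2/4\<close> on the family \<open>G\<^sub>2\<close> and \<open>b = -\<epsilon>/16\<close> on the family \<open>G\<^sub>3\<close>.  To recover \<open>s\<close> and \<open>b\<close> from
  an arbitrary map \<open>H\<close> in the orbit, lift \<open>H\<close> to the map \<open>L = (1, f\<^sub>1, f\<^sub>2, g)\<close> in \<open>\<complex>\<^sup>4\<close>.  At the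
  origin \<open>L, L\<^sub>z, L\<^sub>z\<^sub>z, L\<^sub>w\<close> is a basis, and the expansions of \<open>L\<^sub>z\<^sub>w\<close> and \<open>L\<^sub>w\<^sub>w\<close> in this basis are what
  matters.  An isotropy of the target acts on \<open>L\<close> by a constant matrix, which does not change the
  coefficients of these expansions, followed by division by a scalar function, which changes them
  in a controlled way; four combinations of the coefficients do not notice the scalar function.  An
  isotropy of the source with parameters \<open>l, u, c, r\<close> changes these four quantities explicitly, and
  \<open>l\<close>, \<open>u\<close>, \<open>c\<close> can be eliminated.  Thus only the three parameters \<open>l, u, c\<close> of the source enter
  the computation (\<open>invariants_of_orbit_map\<close>).

  The pair \<open>(s, b)\<close> determines the normal form: the curves \<open>b = s\<^sup>2/4\<close> and \<open>b = -\<epsilon>/16\<close> with \<open>s > 0\<close> meet only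
  for \<open>\<epsilon> = -1\<close> at \<open>s = 1/2\<close>, and there the two families give the same germ (\<open>G2_eq_G3\<close>).  Hence an
  orbit contains one normal form only, and \<open>\<Pi>\<close> is the composition of the continuous map \<open>H \<mapsto> (s, b)\<close>
  with the map that sends \<open>(s, b)\<close> to a normal form.  The jets of \<open>G\<^sub>2\<close> and of \<open>G\<^sub>3\<close> depend continuously
  on \<open>s\<close>, because all partial derivatives at the origin of a rational function are rational in its
  coefficients, and the two pieces are glued along closed sets (\<open>continuous_pd_normal_form\<close>).
\<close>

section \<open>Germs and their representatives\<close>

lemma germ_of_eq_iff:
  assumes "f 0 = 0" "isCont f 0" "g 0 = 0" "isCont g 0"
  shows "germ_of f = germ_of g \<longleftrightarrow> (\<forall>\<^sub>F x in nhds 0. f x = g x)"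
  using assms Quotient3_rel[OF Quotient3_germ, of f g] unfolding germ_of_def by auto

lemma germ_of_exhaust:
  obtains f where "f 0 = 0" "isCont f 0" "H = germ_of f"
proof -
  have "H = germ_of (rep_germ H)"
    unfolding germ_of_def using Quotient3_abs_rep[OF Quotient3_germ] by metis
  moreover have "rep_germ H 0 = 0 \<and> isCont (rep_germ H) 0"
    using Quotient3_rep_reflp[OF Quotient3_germ, of H] by auto
  ultimately show thesis using that by blast
qed

lemma germ_comp_germ_of:
  assumes "f 0 = 0" "isCont f 0" "g 0 = 0" "isCont g 0"
  shows "germ_of g \<circ>\<^sub>g germ_of f = germ_of (g \<circ> f)"
  unfolding germ_of_def comp_def by (rule germ_comp.abs_eq) (auto simp: assms)

lemma germ_id_eq: "germ_id = germ_of (\<lambda>x. x)"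
  unfolding germ_of_def germ_id.abs_eq ..

lemma germ_comp_assoc: "(H \<circ>\<^sub>g K) \<circ>\<^sub>g L = H \<circ>\<^sub>g (K \<circ>\<^sub>g L)"
proof -
  obtain f g h where *: "f 0 = 0" "isCont f 0" "H = germ_of f" "g 0 = 0" "isCont g 0" "K = germ_of g"
    "h 0 = 0" "isCont h 0" "L = germ_of h" by (metis germ_of_exhaust)
  then show ?thesis
    by (auto simp: germ_comp_germ_of continuous_at_compose comp_assoc)
qed

lemma germ_comp_id: "H \<circ>\<^sub>g germ_id = H" "germ_id \<circ>\<^sub>g H = H"
proof -
  obtain f where *: "f 0 = 0" "isCont f 0" "H = germ_of f" by (metis germ_of_exhaust)
  then show "H \<circ>\<^sub>g germ_id = H" "germ_id \<circ>\<^sub>g H = H"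
    by (auto simp: germ_comp_germ_of germ_id_eq comp_def)
qed

lemma germ_inv_eqI:
  assumes "\<psi> \<circ>\<^sub>g \<phi> = germ_id" "\<phi> \<circ>\<^sub>g \<psi> = germ_id"
  shows "germ_inv \<phi> = \<psi>"
  unfolding germ_inv_def
proof (rule the_equality)
  fix \<psi>' assume "\<psi>' \<circ>\<^sub>g \<phi> = germ_id \<and> \<phi> \<circ>\<^sub>g \<psi>' = germ_id"
  then show "\<psi>' = \<psi>" using assms by (metis germ_comp_assoc germ_comp_id)
qed (use assms in simp)

lemma germ_pd_germ_of:
  assumes "f 0 = 0" "isCont f 0"
  shows "germ_pd i j (germ_of f) =
    (pd i j (\<lambda>x. fst (f x)), pd i j (\<lambda>x. fst (snd (f x))), pd i j (\<lambda>x. snd (snd (f x))))"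
  unfolding germ_of_def by (rule germ_pd.abs_eq) (auto simp: eq_onp_def assms)

lemma holomorphic_germ_germ_of:
  assumes "f 0 = 0" "isCont f 0"
  shows "holomorphic_germ (germ_of f) \<longleftrightarrow> (\<forall>\<^sub>F p in nhds 0. holo_at (\<lambda>x. fst (f x)) p
    \<and> holo_at (\<lambda>x. fst (snd (f x))) p \<and> holo_at (\<lambda>x. snd (snd (f x))) p)"
  unfolding germ_of_def by (rule holomorphic_germ.abs_eq) (auto simp: eq_onp_def assms)

lemma maps_into_germ_of:
  assumes "f 0 = 0" "isCont f 0"
  shows "maps_into (germ_of f) A B \<longleftrightarrow> (\<forall>\<^sub>F p in nhds 0. p \<in> A \<longrightarrow> f p \<in> B)"
  unfolding germ_of_def by (subst maps_into.abs_eq) (auto simp: eq_onp_def assms)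

section \<open>Functions of two variables with a complex-linear derivative\<close>

lemma holo_at_const: "holo_at (\<lambda>_. c) p"
  unfolding holo_at_def by (rule exI[of _ 0], rule exI[of _ 0]) (auto simp: case_prod_unfold)

lemma holo_at_fst: "holo_at fst p"
  unfolding holo_at_def by (rule exI[of _ 1], rule exI[of _ 0]) (auto simp: case_prod_unfold intro!: derivative_eq_intros)

lemma holo_at_snd: "holo_at snd p"
  unfolding holo_at_def by (rule exI[of _ 0], rule exI[of _ 1]) (auto simp: case_prod_unfold intro!: derivative_eq_intros)

lemma holo_at_add:
  assumes "holo_at f p" "holo_at g p"
  shows "holo_at (\<lambda>x. f x + g x) p"
proof -
  obtain a b c d where "(f has_derivative (\<lambda>(h, k). a * h + b * k)) (at p)"
    "(g has_derivative (\<lambda>(h, k). c * h + d * k)) (at p)" using assms unfolding holo_at_def by blast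
  then have "((\<lambda>x. f x + g x) has_derivative (\<lambda>(h, k). (a + c) * h + (b + d) * k)) (at p)"
    by (auto intro!: derivative_eq_intros simp: case_prod_unfold algebra_simps)
  then show ?thesis unfolding holo_at_def by blast
qed

lemma holo_at_mult:
  assumes "holo_at f p" "holo_at g p"
  shows "holo_at (\<lambda>x. f x * g x) p"
proof -
  obtain a b c d where "(f has_derivative (\<lambda>(h, k). a * h + b * k)) (at p)"
    "(g has_derivative (\<lambda>(h, k). c * h + d * k)) (at p)" using assms unfolding holo_at_def by blast
  then have "((\<lambda>x. f x * g x) has_derivative (\<lambda>(h, k). (f p * c + a * g p) * h + (f p * d + b * g p) * k)) (at p)"
    by (auto intro!: derivative_eq_intros simp: case_prod_unfold algebra_simps)
  then show ?thesis unfolding holo_at_def by blast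
qed

lemma holo_at_inverse:
  assumes "holo_at f p" "f p \<noteq> 0"
  shows "holo_at (\<lambda>x. inverse (f x)) p"
proof -
  obtain a b where "(f has_derivative (\<lambda>(h, k). a * h + b * k)) (at p)"
    using assms unfolding holo_at_def by blast
  with assms have "((\<lambda>x. inverse (f x)) has_derivative
      (\<lambda>(h, k). (- (inverse (f p) * a * inverse (f p))) * h + (- (inverse (f p) * b * inverse (f p))) * k)) (at p)"
    by (auto intro!: derivative_eq_intros simp: case_prod_unfold algebra_simps)
  then show ?thesis unfolding holo_at_def by blast
qed

lemma holo_at_diff:
  assumes "holo_at f p" "holo_at g p"
  shows "holo_at (\<lambda>x. f x - g x) p"
  using holo_at_add[OF assms(1) holo_at_mult[OF holo_at_const[of "-1"] assms(2)]] by simp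

lemma holo_at_divide:
  assumes "holo_at f p" "holo_at g p" "g p \<noteq> 0"
  shows "holo_at (\<lambda>x. f x / g x) p"
  using holo_at_mult[OF assms(1) holo_at_inverse[OF assms(2,3)]] by (simp add: divide_inverse)

lemma holo_at_compose:
  assumes "holo_at f (s p, t p)" "holo_at s p" "holo_at t p"
  shows "holo_at (\<lambda>x. f (s x, t x)) p"
proof -
  obtain a b c d m n where f: "(f has_derivative (\<lambda>(h, k). a * h + b * k)) (at (s p, t p))"
    and st: "(s has_derivative (\<lambda>(h, k). c * h + d * k)) (at p)"
    "(t has_derivative (\<lambda>(h, k). m * h + n * k)) (at p)" using assms unfolding holo_at_def by blast
  have "((\<lambda>x. f (s x, t x)) has_derivative
      (\<lambda>x. (\<lambda>(h, k). a * h + b * k) ((\<lambda>(h, k). c * h + d * k) x, (\<lambda>(h, k). m * h + n * k) x))) (at p)"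
    by (rule has_derivative_compose[OF has_derivative_Pair[OF st] f])
  moreover have "(\<lambda>x. (\<lambda>(h, k). a * h + b * k) ((\<lambda>(h, k). c * h + d * k) x, (\<lambda>(h, k). m * h + n * k) x))
    = (\<lambda>(h, k). (a * c + b * m) * h + (a * d + b * n) * k)"
    by (auto simp: fun_eq_iff algebra_simps)
  ultimately show ?thesis unfolding holo_at_def by auto
qed

lemma holo_at_imp_slices:
  assumes "holo_at f (z, w)"
  shows "(\<lambda>x. f (z, x)) field_differentiable at w" "(\<lambda>x. f (x, w)) field_differentiable at z"
proof -
  obtain a b where f: "(f has_derivative (\<lambda>(h, k). a * h + b * k)) (at (z, w))"
    using assms unfolding holo_at_def by blast
  have "((\<lambda>x. f (z, x)) has_derivative (\<lambda>k. (\<lambda>(h, k). a * h + b * k) (0, k))) (at w)"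
    by (rule has_derivative_compose[OF has_derivative_Pair[OF has_derivative_const has_derivative_ident], of f]) (use f in simp)
  moreover have "((\<lambda>x. f (x, w)) has_derivative (\<lambda>h. (\<lambda>(h, k). a * h + b * k) (h, 0))) (at z)"
    by (rule has_derivative_compose[OF has_derivative_Pair[OF has_derivative_ident has_derivative_const], of f]) (use f in simp)
  ultimately have "((\<lambda>x. f (z, x)) has_derivative (*) b) (at w)" "((\<lambda>x. f (x, w)) has_derivative (*) a) (at z)"
    by simp_all
  then show "(\<lambda>x. f (z, x)) field_differentiable at w" "(\<lambda>x. f (x, w)) field_differentiable at z"
    unfolding field_differentiable_def has_field_derivative_def by blast+
qed

lemma holo_at_imp_isCont: "holo_at f p \<Longrightarrow> isCont f p"
  unfolding holo_at_def by (auto dest: has_derivative_continuous)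

lemma eventually_nonzero_nhds:
  fixes f :: "'a::t2_space \<Rightarrow> complex"
  assumes "isCont f x" "f x \<noteq> 0"
  shows "\<forall>\<^sub>F y in nhds x. f y \<noteq> 0"
proof -
  have "(f \<longlongrightarrow> f x) (nhds x)"
    using assms(1) tendsto_at_iff_tendsto_nhds[of f x] by (simp add: continuous_at)
  then show ?thesis using assms(2) by (rule tendsto_imp_eventually_ne)
qed

section \<open>Second-order expansions at the origin\<close>

text \<open>The expansion \<open>f (z, w) = a + b z + c w + d z\<^sup>2 + e z w + h w\<^sup>2 + O(\<bar>(z, w)\<bar>\<^sup>3)\<close>.  Stated through the
  remainder, it passes to products, quotients and compositions by estimates only; the derivatives
  of a holomorphic function are recovered from it in \<open>pd_of_jet2\<close>.\<close>

definition has_jet2 ::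
  "(C2 \<Rightarrow> complex) \<Rightarrow> complex \<Rightarrow> complex \<Rightarrow> complex \<Rightarrow> complex \<Rightarrow> complex \<Rightarrow> complex \<Rightarrow> bool" where
  "has_jet2 f a b c d e h \<longleftrightarrow>
    (\<lambda>p. f p - (a + b * fst p + c * snd p + d * fst p ^ 2 + e * fst p * snd p + h * snd p ^ 2))
      \<in> O[nhds 0](\<lambda>p. of_real (norm p) ^ 3)"

lemma norm_small: "(\<lambda>p::C2. complex_of_real (norm p)) \<in> O[nhds 0](\<lambda>_. 1)"
proof (rule landau_o.bigI[of 1])
  have "\<forall>\<^sub>F p in nhds (0::C2). norm p < 1"
    using eventually_nhds_ball[of 1 "0::C2"] by (simp add: dist_norm)
  then show "\<forall>\<^sub>F p in nhds 0. norm (complex_of_real (norm (p::C2))) \<le> 1 * norm (1::complex)"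
    by eventually_elim auto
qed simp

lemma norm_power_small:
  assumes "m \<le> n"
  shows "(\<lambda>p::C2. complex_of_real (norm p) ^ n) \<in> O[nhds 0](\<lambda>p. of_real (norm p) ^ m)"
proof -
  have "(\<lambda>p::C2. complex_of_real (norm p) ^ (n - m)) \<in> O[nhds 0](\<lambda>_. 1 ^ (n - m))"
    by (rule landau_o.big_power[OF norm_small])
  from landau_o.big_mult[OF this landau_o.big_refl[of "\<lambda>p::C2. of_real (norm p) ^ m"]]
  show ?thesis using assms by (simp flip: power_add)
qed

lemma coordinates_small:
  "(fst :: C2 \<Rightarrow> complex) \<in> O[nhds 0](\<lambda>p. of_real (norm p))"
  "(snd :: C2 \<Rightarrow> complex) \<in> O[nhds 0](\<lambda>p. of_real (norm p))"
proof -
  have "norm (fst p) \<le> norm p" "norm (snd p) \<le> norm p" for p :: C2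
    using norm_fst_le[of "fst p" "snd p"] norm_snd_le[of "snd p" "fst p"] by simp_all
  then show "(fst :: C2 \<Rightarrow> complex) \<in> O[nhds 0](\<lambda>p. of_real (norm p))"
    "(snd :: C2 \<Rightarrow> complex) \<in> O[nhds 0](\<lambda>p. of_real (norm p))"
    by (intro landau_o.bigI[of 1] always_eventually allI; simp)+
qed

lemma linear_part_small: "(\<lambda>p::C2. b * fst p + c * snd p) \<in> O[nhds 0](\<lambda>p. of_real (norm p))"
proof (rule sum_in_bigo)
  show "(\<lambda>p::C2. b * fst p) \<in> O[nhds 0](\<lambda>p. of_real (norm p))"
    using coordinates_small(1) by simp
  show "(\<lambda>p::C2. c * snd p) \<in> O[nhds 0](\<lambda>p. of_real (norm p))"
    using coordinates_small(2) by simp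
qed

lemma quadratic_part_small:
  "(\<lambda>p::C2. d * fst p ^ 2 + e * fst p * snd p + h * snd p ^ 2) \<in> O[nhds 0](\<lambda>p. of_real (norm p) ^ 2)"
proof (intro sum_in_bigo(1))
  show "(\<lambda>p::C2. d * fst p ^ 2) \<in> O[nhds 0](\<lambda>p. of_real (norm p) ^ 2)"
    using landau_o.big_power[OF coordinates_small(1)] by simp
  show "(\<lambda>p::C2. h * snd p ^ 2) \<in> O[nhds 0](\<lambda>p. of_real (norm p) ^ 2)"
    using landau_o.big_power[OF coordinates_small(2)] by simp
  have "(\<lambda>p::C2. fst p * snd p) \<in> O[nhds 0](\<lambda>p. of_real (norm p) ^ 2)"
    unfolding power2_eq_square by (rule landau_o.big_mult[OF coordinates_small])
  then show "(\<lambda>p::C2. e * fst p * snd p) \<in> O[nhds 0](\<lambda>p. of_real (norm p) ^ 2)"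
    by (simp add: mult.assoc)
qed

lemma has_jet2_eqI:
  assumes "has_jet2 f a b c d e h" "a = a'" "b = b'" "c = c'" "d = d'" "e = e'" "h = h'"
  shows "has_jet2 f a' b' c' d' e' h'"
  using assms by simp

lemma has_jet2_const: "has_jet2 (\<lambda>_. a) a 0 0 0 0 0"
  and has_jet2_fst: "has_jet2 fst 0 1 0 0 0 0"
  and has_jet2_snd: "has_jet2 snd 0 0 1 0 0 0"
  by (simp_all add: has_jet2_def)

lemma has_jet2_add:
  assumes "has_jet2 f a b c d e h" "has_jet2 g a' b' c' d' e' h'"
  shows "has_jet2 (\<lambda>p. f p + g p) (a + a') (b + b') (c + c') (d + d') (e + e') (h + h')"
  using sum_in_bigo(1)[OF assms[unfolded has_jet2_def]] unfolding has_jet2_def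
  by (simp add: algebra_simps)

lemma has_jet2_cmult:
  assumes "has_jet2 f a b c d e h"
  shows "has_jet2 (\<lambda>p. k * f p) (k * a) (k * b) (k * c) (k * d) (k * e) (k * h)"
  using landau_o.big_mult[OF landau_o.big_refl[of "\<lambda>_. k"] assms[unfolded has_jet2_def]]
  unfolding has_jet2_def
  by (cases "k = 0") (simp_all add: algebra_simps)

lemma has_jet2_bounded:
  assumes "has_jet2 f a b c d e h"
  shows "(\<lambda>p. f p - a) \<in> O[nhds 0](\<lambda>p. of_real (norm p))" "f \<in> O[nhds 0](\<lambda>_. 1)"
proof -
  let ?R = "\<lambda>p. f p - (a + b * fst p + c * snd p + d * fst p ^ 2 + e * fst p * snd p + h * snd p ^ 2)"
  have R: "?R \<in> O[nhds 0](\<lambda>p. of_real (norm p))"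
    using landau_o.big_trans[OF assms[unfolded has_jet2_def] norm_power_small[of 1 3]] by simp
  have Q: "(\<lambda>p::C2. d * fst p ^ 2 + e * fst p * snd p + h * snd p ^ 2) \<in> O[nhds 0](\<lambda>p. of_real (norm p))"
    using landau_o.big_trans[OF quadratic_part_small norm_power_small[of 1 2]] by simp
  have "(\<lambda>p. ?R p + (b * fst p + c * snd p) + (d * fst p ^ 2 + e * fst p * snd p + h * snd p ^ 2))
    \<in> O[nhds 0](\<lambda>p. of_real (norm p))"
    by (intro sum_in_bigo R linear_part_small Q)
  then show 1: "(\<lambda>p. f p - a) \<in> O[nhds 0](\<lambda>p. of_real (norm p))"
    by (simp add: algebra_simps)
  have "(\<lambda>p. (f p - a) + a) \<in> O[nhds 0](\<lambda>_. 1)"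
    by (intro sum_in_bigo(1)[OF landau_o.big_trans[OF 1 norm_small]]) simp
  then show "f \<in> O[nhds 0](\<lambda>_. 1)" by simp
qed

lemma has_jet2_tendsto:
  assumes "has_jet2 f a b c d e h"
  shows "(f \<longlongrightarrow> a) (nhds 0)"
proof -
  obtain C where C: "\<forall>\<^sub>F p in nhds 0. norm (f p - a) \<le> C * norm (complex_of_real (norm p))"
    using has_jet2_bounded(1)[OF assms] by (rule landau_o.bigE)
  have "((\<lambda>p::C2. C * norm p) \<longlongrightarrow> C * norm (0::C2)) (nhds 0)"
    by (intro tendsto_intros) (simp add: filterlim_ident)
  then have "((\<lambda>p. f p - a) \<longlongrightarrow> 0) (nhds 0)"
    using Lim_null_comparison[of "\<lambda>p. f p - a" "\<lambda>p. C * norm p"] C by simp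
  then show ?thesis by (simp add: LIM_zero_iff)
qed

lemma has_jet2_mult:
  assumes f: "has_jet2 f a b c d e h" and g: "has_jet2 g a' b' c' d' e' h'"
  shows "has_jet2 (\<lambda>p. f p * g p) (a * a') (a * b' + b * a') (a * c' + c * a')
    (a * d' + b * b' + d * a') (a * e' + b * c' + c * b' + e * a') (a * h' + c * c' + h * a')"
proof -
  define A B where "A = (\<lambda>p::C2. b * fst p + c * snd p)" and "B = (\<lambda>p::C2. b' * fst p + c' * snd p)"
  define A2 B2 where "A2 = (\<lambda>p::C2. d * fst p ^ 2 + e * fst p * snd p + h * snd p ^ 2)"
    and "B2 = (\<lambda>p::C2. d' * fst p ^ 2 + e' * fst p * snd p + h' * snd p ^ 2)"
  let ?n = "\<lambda>p::C2. complex_of_real (norm p)"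
  let ?R = "\<lambda>p. f p - (a + A p + A2 p)" and ?S = "\<lambda>p. g p - (a' + B p + B2 p)"
  have R: "?R \<in> O[nhds 0](\<lambda>p. ?n p ^ 3)" and S: "?S \<in> O[nhds 0](\<lambda>p. ?n p ^ 3)"
    using f g unfolding has_jet2_def A_def A2_def B_def B2_def by (simp_all add: algebra_simps)
  have A: "A \<in> O[nhds 0](?n)" "B \<in> O[nhds 0](?n)"
    unfolding A_def B_def by (rule linear_part_small)+
  have A2: "A2 \<in> O[nhds 0](\<lambda>p. ?n p ^ 2)" "B2 \<in> O[nhds 0](\<lambda>p. ?n p ^ 2)"
    unfolding A2_def B2_def by (rule quadratic_part_small)+
  have "A2 \<in> O[nhds 0](?n)"
    using landau_o.big_trans[OF A2(1) norm_power_small[of 1 2]] by simp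
  then have T: "(\<lambda>p. a + A p + A2 p) \<in> O[nhds 0](\<lambda>_. 1)"
    by (intro sum_in_bigo(1)) (auto intro: landau_o.big_trans[OF _ norm_small] A)
  have 1: "(\<lambda>p. A p * B2 p) \<in> O[nhds 0](\<lambda>p. ?n p ^ 3)"
    using landau_o.big_mult[OF A(1) A2(2)] by (simp add: power3_eq_cube power2_eq_square mult.assoc)
  have 2: "(\<lambda>p. A2 p * B p) \<in> O[nhds 0](\<lambda>p. ?n p ^ 3)"
    using landau_o.big_mult[OF A2(1) A(2)] by (simp add: power3_eq_cube power2_eq_square mult.assoc)
  have 3: "(\<lambda>p. A2 p * B2 p) \<in> O[nhds 0](\<lambda>p. ?n p ^ 3)"
    using landau_o.big_trans[OF landau_o.big_mult[OF A2] ] norm_power_small[of 3 4]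
    by (simp flip: power_add)
  have 4: "(\<lambda>p. (a + A p + A2 p) * ?S p) \<in> O[nhds 0](\<lambda>p. ?n p ^ 3)"
    using landau_o.big_mult[OF T S] by simp
  have 5: "(\<lambda>p. ?R p * g p) \<in> O[nhds 0](\<lambda>p. ?n p ^ 3)"
    using landau_o.big_mult[OF R has_jet2_bounded(2)[OF g]] by simp
  have "(\<lambda>p. A p * B2 p + A2 p * B p + A2 p * B2 p + (a + A p + A2 p) * ?S p + ?R p * g p)
    \<in> O[nhds 0](\<lambda>p. ?n p ^ 3)"
    by (intro sum_in_bigo 1 2 3 4 5)
  moreover have "A p * B2 p + A2 p * B p + A2 p * B2 p + (a + A p + A2 p) * ?S p + ?R p * g p
    = f p * g p - (a * a' + (a * b' + b * a') * fst p + (a * c' + c * a') * snd p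
      + (a * d' + b * b' + d * a') * fst p ^ 2 + (a * e' + b * c' + c * b' + e * a') * fst p * snd p
      + (a * h' + c * c' + h * a') * snd p ^ 2)" for p
  proof -
    have "A p = b * fst p + c * snd p" "B p = b' * fst p + c' * snd p"
      "A2 p = d * fst p ^ 2 + e * fst p * snd p + h * snd p ^ 2"
      "B2 p = d' * fst p ^ 2 + e' * fst p * snd p + h' * snd p ^ 2"
      by (simp_all add: A_def B_def A2_def B2_def)
    then show ?thesis by algebra
  qed
  ultimately show ?thesis unfolding has_jet2_def by simp
qed

text \<open>Power series division, with the quotient series prescribed: the equations say that the product of
  the proposed quotient \<open>A + B z + \<dots>\<close> with the denominator is the numerator up to order 2.\<close>

lemma has_jet2_divide:
  assumes f: "has_jet2 f a b c d e h" and g: "has_jet2 g a' b' c' d' e' h'"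
    and "a' \<noteq> 0" "a = A * a'" "b = A * b' + B * a'" "c = A * c' + C * a'"
    "d = A * d' + B * b' + D * a'" "e = A * e' + B * c' + C * b' + E * a'"
    "h = A * h' + C * c' + H * a'"
  shows "has_jet2 (\<lambda>p. f p / g p) A B C D E H"
proof -
  define T where "T = (\<lambda>p::C2. A + B * fst p + C * snd p + D * fst p ^ 2 + E * fst p * snd p + H * snd p ^ 2)"
  have "has_jet2 T A B C D E H" unfolding has_jet2_def T_def by simp
  from sum_in_bigo(2)[OF f[unfolded has_jet2_def] has_jet2_mult[OF this g, unfolded has_jet2_def]]
  have num: "(\<lambda>p. f p - T p * g p) \<in> O[nhds 0](\<lambda>p. of_real (norm p) ^ 3)"
    by (simp add: assms)
  have "((\<lambda>p. norm (g p)) \<longlongrightarrow> norm a') (nhds 0)"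
    by (intro tendsto_norm has_jet2_tendsto[OF g])
  then have ev: "\<forall>\<^sub>F p in nhds 0. norm a' / 2 < norm (g p)"
    by (rule order_tendstoD) (use \<open>a' \<noteq> 0\<close> in simp)
  have den: "(\<lambda>p. inverse (g p)) \<in> O[nhds 0](\<lambda>_. 1)"
  proof (rule landau_o.bigI[of "2 / norm a'"])
    show "\<forall>\<^sub>F p in nhds 0. norm (inverse (g p)) \<le> 2 / norm a' * norm (1::complex)"
      using ev
    proof eventually_elim
      case (elim p)
      then have "g p \<noteq> 0" using norm_ge_zero[of a'] by (auto simp del: norm_ge_zero)
      with elim show ?case using \<open>a' \<noteq> 0\<close> by (simp add: norm_inverse divide_inverse[symmetric] norm_divide) (simp add: field_simps)
    qed
  qed (use \<open>a' \<noteq> 0\<close> in simp)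
  have "\<forall>\<^sub>F p in nhds 0. (f p - T p * g p) * inverse (g p) = f p / g p - T p"
    using ev
  proof eventually_elim
    case (elim p)
    then have "g p \<noteq> 0" using norm_ge_zero[of a'] by (auto simp del: norm_ge_zero)
    then show ?case by (simp add: field_simps)
  qed
  from landau_o.big.in_cong[OF this] landau_o.big_mult[OF num den]
  have "(\<lambda>p. f p / g p - T p) \<in> O[nhds 0](\<lambda>p. of_real (norm p) ^ 3)" by simp
  then show ?thesis unfolding has_jet2_def T_def .
qed

lemma has_jet2_compose:
  assumes f: "has_jet2 f a b c d e h" and s: "has_jet2 s 0 s1 s2 s3 s4 s5" and t: "has_jet2 t 0 t1 t2 t3 t4 t5"
  shows "has_jet2 (\<lambda>p. f (s p, t p)) a (b * s1 + c * t1) (b * s2 + c * t2)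
    (b * s3 + c * t3 + d * s1 ^ 2 + e * s1 * t1 + h * t1 ^ 2)
    (b * s4 + c * t4 + 2 * d * s1 * s2 + e * (s1 * t2 + s2 * t1) + 2 * h * t1 * t2)
    (b * s5 + c * t5 + d * s2 ^ 2 + e * s2 * t2 + h * t2 ^ 2)"
proof -
  let ?n = "\<lambda>p::C2. complex_of_real (norm p)"
  define T where "T = (\<lambda>p::C2. a + b * fst p + c * snd p + d * fst p ^ 2 + e * fst p * snd p + h * snd p ^ 2)"
  have "filterlim (\<lambda>p. (s p, t p)) (nhds (0, 0)) (nhds 0)"
    by (intro tendsto_Pair has_jet2_tendsto[OF s] has_jet2_tendsto[OF t])
  then have lim: "filterlim (\<lambda>p. (s p, t p)) (nhds 0) (nhds 0)" by (simp add: zero_prod_def)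
  have R: "(\<lambda>p. f (s p, t p) - T (s p, t p)) \<in> O[nhds 0](\<lambda>p. ?n (s p, t p) ^ 3)"
    using landau_o.big.compose[OF f[unfolded has_jet2_def] lim] unfolding T_def by simp
  obtain C1 where C1: "\<forall>\<^sub>F p in nhds 0. norm (s p - 0) \<le> C1 * norm (complex_of_real (norm p))" "C1 > 0"
    using has_jet2_bounded(1)[OF s] by (rule landau_o.bigE)
  obtain C2 where C2: "\<forall>\<^sub>F p in nhds 0. norm (t p - 0) \<le> C2 * norm (complex_of_real (norm p))" "C2 > 0"
    using has_jet2_bounded(1)[OF t] by (rule landau_o.bigE)
  have "(\<lambda>p. ?n (s p, t p)) \<in> O[nhds 0](?n)"
  proof (rule landau_o.bigI[of "C1 + C2"])
    show "\<forall>\<^sub>F p in nhds 0. norm (?n (s p, t p)) \<le> (C1 + C2) * norm (?n p)"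
      using C1(1) C2(1)
    proof eventually_elim
      case (elim p)
      have "norm (s p, t p) \<le> norm (s p) + norm (t p)" by (rule norm_Pair_le)
      then show ?case using elim by (simp add: algebra_simps)
    qed
  qed (use C1 C2 in simp)
  then have small: "(\<lambda>p. f (s p, t p) - T (s p, t p)) \<in> O[nhds 0](\<lambda>p. ?n p ^ 3)"
    by (intro landau_o.big_trans[OF R] landau_o.big_power)
  have "has_jet2 (\<lambda>p. a + b * s p + c * t p + d * (s p * s p) + e * (s p * t p) + h * (t p * t p))
    (a + b * 0 + c * 0 + d * (0 * 0) + e * (0 * 0) + h * (0 * 0)) (b * s1 + c * t1) (b * s2 + c * t2)
    (b * s3 + c * t3 + d * s1 ^ 2 + e * s1 * t1 + h * t1 ^ 2)
    (b * s4 + c * t4 + 2 * d * s1 * s2 + e * (s1 * t2 + s2 * t1) + 2 * h * t1 * t2)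
    (b * s5 + c * t5 + d * s2 ^ 2 + e * s2 * t2 + h * t2 ^ 2)"
    by (rule has_jet2_eqI[OF has_jet2_add[OF has_jet2_add[OF has_jet2_add[OF has_jet2_add[OF has_jet2_add[OF
      has_jet2_const[of a] has_jet2_cmult[OF s, of b]] has_jet2_cmult[OF t, of c]]
      has_jet2_cmult[OF has_jet2_mult[OF s s], of d]] has_jet2_cmult[OF has_jet2_mult[OF s t], of e]]
      has_jet2_cmult[OF has_jet2_mult[OF t t], of h]]]) (algebra+)
  moreover have "(\<lambda>p. a + b * s p + c * t p + d * (s p * s p) + e * (s p * t p) + h * (t p * t p))
      = (\<lambda>p. T (s p, t p))"
    by (simp add: T_def power2_eq_square mult.assoc)
  ultimately have "has_jet2 (\<lambda>p. T (s p, t p)) a (b * s1 + c * t1) (b * s2 + c * t2)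
    (b * s3 + c * t3 + d * s1 ^ 2 + e * s1 * t1 + h * t1 ^ 2)
    (b * s4 + c * t4 + 2 * d * s1 * s2 + e * (s1 * t2 + s2 * t1) + 2 * h * t1 * t2)
    (b * s5 + c * t5 + d * s2 ^ 2 + e * s2 * t2 + h * t2 ^ 2)"
    by simp
  from sum_in_bigo(1)[OF small this[unfolded has_jet2_def]]
  show ?thesis unfolding has_jet2_def by (simp add: add_diff_eq)
qed

lemma has_jet2_cubic:
  "has_jet2 (\<lambda>p. a + b * fst p + c * snd p + d * fst p ^ 2 + e * fst p * snd p + h * snd p ^ 2
     + (k1 * fst p ^ 3 + k2 * fst p ^ 2 * snd p + k3 * fst p * snd p ^ 2 + k4 * snd p ^ 3)) a b c d e h"
proof -
  have "has_jet2 (\<lambda>p. a + b * fst p + c * snd p + d * fst p ^ 2 + e * fst p * snd p + h * snd p ^ 2) a b c d e h"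
    by (simp add: has_jet2_def)
  moreover have "has_jet2 (\<lambda>p. fst p * (0 + 0 * fst p + 0 * snd p + k1 * fst p ^ 2 + k2 * fst p * snd p + k3 * snd p ^ 2)) 0 0 0 0 0 0"
    by (rule has_jet2_eqI[OF has_jet2_mult[OF has_jet2_fst, of _ 0 0 0 k1 k2 k3]]) (simp_all add: has_jet2_def)
  moreover have "has_jet2 (\<lambda>p. snd p * (0 + 0 * fst p + 0 * snd p + 0 * fst p ^ 2 + 0 * fst p * snd p + k4 * snd p ^ 2)) 0 0 0 0 0 0"
    by (rule has_jet2_eqI[OF has_jet2_mult[OF has_jet2_snd, of _ 0 0 0 0 0 k4]]) (simp_all add: has_jet2_def)
  ultimately have "has_jet2 (\<lambda>p. a + b * fst p + c * snd p + d * fst p ^ 2 + e * fst p * snd p + h * snd p ^ 2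
     + (fst p * (0 + 0 * fst p + 0 * snd p + k1 * fst p ^ 2 + k2 * fst p * snd p + k3 * snd p ^ 2)
     + snd p * (0 + 0 * fst p + 0 * snd p + 0 * fst p ^ 2 + 0 * fst p * snd p + k4 * snd p ^ 2))) a b c d e h"
    using has_jet2_add[OF _ has_jet2_add, of _ a b c d e h _ 0 0 0 0 0 0 _ 0 0 0 0 0 0] by simp
  then show ?thesis
    by (simp add: power2_eq_square power3_eq_cube algebra_simps)
qed

lemma has_jet2_normalized_quotient:
  assumes "has_jet2 f 0 b c d e h" "has_jet2 q 1 \<alpha> \<beta> k1 k2 k3"
  shows "has_jet2 (\<lambda>p. f p / q p) 0 b c (d - b * \<alpha>) (e - b * \<beta> - c * \<alpha>) (h - c * \<beta>)"
  by (rule has_jet2_divide[OF assms]) simp_all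

lemma has_jet2_linear_combination:
  assumes "has_jet2 f1 0 b1 c1 d1 e1 h1" "has_jet2 f2 0 b2 c2 d2 e2 h2" "has_jet2 f3 0 b3 c3 d3 e3 h3"
  shows "has_jet2 (\<lambda>p. k0 + (k1 * f1 p + k2 * f2 p + k3 * f3 p)) k0
    (k1 * b1 + k2 * b2 + k3 * b3) (k1 * c1 + k2 * c2 + k3 * c3) (k1 * d1 + k2 * d2 + k3 * d3)
    (k1 * e1 + k2 * e2 + k3 * e3) (k1 * h1 + k2 * h2 + k3 * h3)"
  by (rule has_jet2_eqI[OF has_jet2_add[OF has_jet2_const[of k0] has_jet2_add[OF has_jet2_add[OF
    has_jet2_cmult[OF assms(1), of k1] has_jet2_cmult[OF assms(2), of k2]] has_jet2_cmult[OF assms(3), of k3]]]])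
    simp_all

section \<open>Partial derivatives read off from an expansion\<close>

lemma norm_eq_0_if_le_small:
  fixes x :: complex
  assumes "\<delta> > 0" "\<And>r. 0 < r \<Longrightarrow> r < \<delta> \<Longrightarrow> norm x \<le> M * r"
  shows "x = 0"
proof -
  have "((\<lambda>r. M * r) \<longlongrightarrow> M * 0) (at_right (0::real))"
    by (intro tendsto_intros)
  moreover have "\<forall>\<^sub>F r in at_right 0. norm x \<le> M * r"
    using eventually_at_right_real[OF assms(1)] by eventually_elim (use assms(2) in auto)
  ultimately have "norm x \<le> M * 0"
    by (rule tendsto_lowerbound) simp
  then show ?thesis by simp
qed

text \<open>The remainder is holomorphic and of order \<open>\<bar>x\<bar>\<^sup>3\<close>, so Cauchy's estimate on the circle of radius \<open>r\<close>
  bounds its first two derivatives at 0 by multiples of \<open>r\<^sup>2\<close> and \<open>r\<close>; let \<open>r\<close> tend to 0.\<close>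

lemma derivs_of_one_variable_jet:
  assumes "\<rho> > 0" and hol: "\<phi> holomorphic_on ball 0 \<rho>"
    and R: "\<And>x. norm x < \<rho> \<Longrightarrow> norm (\<phi> x - (a + b * x + c * x\<^sup>2)) \<le> C * norm x ^ 3"
  shows "deriv \<phi> 0 = b" "(deriv ^^ 2) \<phi> 0 = 2 * c"
proof -
  define p where "p = (\<lambda>x::complex. a + b * x + c * x\<^sup>2)"
  have dp: "deriv p = (\<lambda>x. b + 2 * c * x)"
    unfolding p_def by (rule ext, rule DERIV_imp_deriv) (auto intro!: derivative_eq_intros)
  have ddp: "(deriv ^^ 2) p 0 = 2 * c"
  proof -
    have "(deriv ^^ 2) p 0 = deriv (\<lambda>x. b + 2 * c * x) 0" by (simp add: numeral_2_eq_2 dp)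
    also have "\<dots> = 2 * c" by (rule DERIV_imp_deriv) (auto intro!: derivative_eq_intros)
    finally show ?thesis .
  qed
  have Rhol: "(\<lambda>x. \<phi> x - p x) holomorphic_on ball 0 \<rho>" and phol: "p holomorphic_on ball 0 \<rho>"
    unfolding p_def by (intro holomorphic_intros hol)+
  have bound: "norm ((deriv ^^ k) (\<lambda>x. \<phi> x - p x) 0) \<le> fact k * (C * r ^ 3) / r ^ k"
    if "0 < r" "r < \<rho>" for r k
  proof (rule Cauchy_inequality)
    have sub: "cball (0::complex) r \<subseteq> ball 0 \<rho>" using that by auto
    show "(\<lambda>x. \<phi> x - p x) holomorphic_on ball 0 r"
      by (rule holomorphic_on_subset[OF Rhol]) (use that in auto)
    show "continuous_on (cball 0 r) (\<lambda>x. \<phi> x - p x)"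
      using holomorphic_on_imp_continuous_on[OF Rhol] sub by (rule continuous_on_subset)
    show "norm (\<phi> x - p x) \<le> C * r ^ 3" if "norm (0 - x) = r" for x
      using R[of x] that \<open>r < \<rho>\<close> unfolding p_def by auto
  qed fact
  have split: "(deriv ^^ k) \<phi> 0 = (deriv ^^ k) (\<lambda>x. \<phi> x - p x) 0 + (deriv ^^ k) p 0" for k
    using higher_deriv_add[OF Rhol phol open_ball, of 0 k] \<open>\<rho> > 0\<close> by simp
  have "0 \<le> C"
  proof -
    have "0 \<le> C * (\<rho> / 2) ^ 3"
      using order_trans[OF norm_ge_zero R[of "of_real (\<rho> / 2)"]] \<open>\<rho> > 0\<close> by simp
    then show ?thesis using \<open>\<rho> > 0\<close> by (simp add: zero_le_mult_iff)
  qed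
  have "(deriv ^^ 1) (\<lambda>x. \<phi> x - p x) 0 = 0"
  proof (rule norm_eq_0_if_le_small)
    fix r :: real assume r: "0 < r" "r < min \<rho> 1"
    have "C * r ^ 3 / r = C * r * r" using r by (simp add: power3_eq_cube)
    also have "\<dots> \<le> C * r" using r \<open>0 \<le> C\<close> by (simp add: mult_left_le)
    finally show "norm ((deriv ^^ 1) (\<lambda>x. \<phi> x - p x) 0) \<le> C * r"
      using bound[of r 1] r by simp
  qed (use \<open>\<rho> > 0\<close> in simp)
  with split[of 1] dp show "deriv \<phi> 0 = b" by simp
  have "(deriv ^^ 2) (\<lambda>x. \<phi> x - p x) 0 = 0"
  proof (rule norm_eq_0_if_le_small)
    fix r :: real assume r: "0 < r" "r < \<rho>"
    have "fact 2 * (C * r ^ 3) / r ^ 2 = 2 * C * r" using r by (simp add: power3_eq_cube power2_eq_square)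
    then show "norm ((deriv ^^ 2) (\<lambda>x. \<phi> x - p x) 0) \<le> (2 * C) * r"
      using bound[of r 2] r by simp
  qed fact
  with split[of 2] ddp show "(deriv ^^ 2) \<phi> 0 = 2 * c" by simp
qed

text \<open>Pure derivatives are derivatives of slices.  For the mixed one, Cauchy's estimate for the slice
  \<open>w \<mapsto> f (z, w)\<close> on the circle of radius \<open>\<bar>z\<bar>\<close> shows that the \<open>w\<close>-derivative of the remainder at \<open>(z, 0)\<close> is
  of order \<open>\<bar>z\<bar>\<^sup>2\<close>, so that \<open>z \<mapsto> f\<^sub>w (z, 0)\<close> is differentiable at 0 with derivative \<open>e\<close>.\<close>

lemma pd_of_jet2:
  assumes hol: "\<forall>\<^sub>F p in nhds 0. holo_at f p" and jet: "has_jet2 f a b c d e h"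
  shows "pd 1 0 f = b" "pd 0 1 f = c" "pd 2 0 f = 2 * d" "pd 1 1 f = e" "pd 0 2 f = 2 * h"
proof -
  define T where "T = (\<lambda>z w. a + b * z + c * w + d * z ^ 2 + e * z * w + h * w ^ 2)"
  obtain C where "C > 0" and C: "\<forall>\<^sub>F p in nhds 0. norm (f p - T (fst p) (snd p)) \<le> C * norm p ^ 3"
    using jet unfolding has_jet2_def T_def by (elim landau_o.bigE) (simp add: norm_power)
  obtain r where "r > 0" and r: "\<And>p. norm p < r \<Longrightarrow> holo_at f p \<and> norm (f p - T (fst p) (snd p)) \<le> C * norm p ^ 3"
    using eventually_conj[OF hol C] unfolding eventually_nhds_metric by (auto simp: dist_norm)
  define \<rho> where "\<rho> = r / 2"
  have "\<rho> > 0" using \<open>r > 0\<close> by (simp add: \<rho>_def)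
  have H: "holo_at f (z, w)" and R: "norm (f (z, w) - T z w) \<le> C * (norm z + norm w) ^ 3"
    if "norm z < \<rho>" "norm w < \<rho>" for z w
  proof -
    have le: "norm (z, w) \<le> norm z + norm w" by (rule norm_Pair_le)
    also have "\<dots> < r" using that unfolding \<rho>_def by simp
    finally have *: "norm (z, w) < r" .
    show "holo_at f (z, w)" using r[OF *] by simp
    have "norm (f (z, w) - T z w) \<le> C * norm (z, w) ^ 3" using r[OF *] by simp
    also have "\<dots> \<le> C * (norm z + norm w) ^ 3"
      using le \<open>C > 0\<close> by (intro mult_left_mono power_mono) auto
    finally show "norm (f (z, w) - T z w) \<le> C * (norm z + norm w) ^ 3" .
  qed
  have holw: "(\<lambda>w. f (z, w)) holomorphic_on ball 0 \<rho>" if "norm z < \<rho>" for z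
    using holo_at_imp_slices(1)[OF H[OF that]]
    by (auto simp: holomorphic_on_def intro: field_differentiable_at_within)
  have holz: "(\<lambda>z. f (z, 0)) holomorphic_on ball 0 \<rho>"
    using holo_at_imp_slices(2)[OF H] \<open>\<rho> > 0\<close>
    by (auto simp: holomorphic_on_def intro: field_differentiable_at_within)
  show "pd 0 1 f = c" "pd 0 2 f = 2 * h"
    using derivs_of_one_variable_jet[OF \<open>\<rho> > 0\<close> holw[of 0], of a c h C] R[of 0] \<open>\<rho> > 0\<close>
    by (simp_all add: pd_def T_def)
  show "pd 1 0 f = b" "pd 2 0 f = 2 * d"
    using derivs_of_one_variable_jet[OF \<open>\<rho> > 0\<close> holz, of a b d C] R[of _ 0] \<open>\<rho> > 0\<close>
    by (simp_all add: pd_def T_def)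
  define g where "g = (\<lambda>z. deriv (\<lambda>w. f (z, w)) 0)"
  have g0: "g 0 = c" using \<open>pd 0 1 f = c\<close> by (simp add: pd_def g_def)
  have g: "norm (g z - (c + e * z)) \<le> 8 * C * norm z ^ 2" if z: "z \<noteq> 0" "norm z < \<rho>" for z
  proof -
    have hT: "(\<lambda>w. T z w) holomorphic_on ball 0 \<rho>" unfolding T_def by (intro holomorphic_intros)
    have hR: "(\<lambda>w. f (z, w) - T z w) holomorphic_on ball 0 \<rho>"
      by (intro holomorphic_intros holw hT z)
    have dT: "deriv (\<lambda>w. T z w) 0 = c + e * z"
      unfolding T_def by (rule DERIV_imp_deriv) (auto intro!: derivative_eq_intros)
    have "norm ((deriv ^^ 1) (\<lambda>w. f (z, w) - T z w) 0) \<le> fact 1 * (C * (2 * norm z) ^ 3) / norm z ^ 1"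
    proof (rule Cauchy_inequality)
      have sub: "cball (0::complex) (norm z) \<subseteq> ball 0 \<rho>" using z by auto
      show "(\<lambda>w. f (z, w) - T z w) holomorphic_on ball 0 (norm z)"
        by (rule holomorphic_on_subset[OF hR]) (use z in auto)
      show "continuous_on (cball 0 (norm z)) (\<lambda>w. f (z, w) - T z w)"
        using holomorphic_on_imp_continuous_on[OF hR] sub by (rule continuous_on_subset)
      show "norm (f (z, w) - T z w) \<le> C * (2 * norm z) ^ 3" if "norm (0 - w) = norm z" for w
        using R[of z w] that z by simp
    qed (use z in simp)
    moreover have "C * (2 * norm z) ^ 3 / norm z = 8 * C * norm z ^ 2"
      using z by (simp add: power3_eq_cube power2_eq_square)
    moreover have "g z = deriv (\<lambda>w. f (z, w) - T z w) 0 + deriv (\<lambda>w. T z w) 0"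
      using higher_deriv_add[OF hR hT open_ball, of 0 1] \<open>\<rho> > 0\<close> by (simp add: g_def)
    ultimately show ?thesis by (simp add: dT)
  qed
  have "((\<lambda>z. (g z - g 0) / (z - 0) - e) \<longlongrightarrow> 0) (at 0)"
  proof (rule Lim_null_comparison)
    have "\<forall>\<^sub>F z in at (0::complex). norm z < \<rho>" "\<forall>\<^sub>F z in at (0::complex). z \<noteq> 0"
      using eventually_at_ball[OF \<open>\<rho> > 0\<close>, of "0::complex" UNIV] by (auto simp: eventually_at_filter dist_norm)
    then show "\<forall>\<^sub>F z in at 0. norm ((g z - g 0) / (z - 0) - e) \<le> 8 * C * norm z"
    proof eventually_elim
      case (elim z)
      have "(g z - g 0) / (z - 0) - e = (g z - (c + e * z)) / z"
        using elim g0 by (simp add: field_simps)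
      then have "norm ((g z - g 0) / (z - 0) - e) \<le> 8 * C * norm z ^ 2 / norm z"
        using g[of z] elim by (simp add: norm_divide divide_right_mono)
      then show ?case using elim by (simp add: power2_eq_square)
    qed
    show "((\<lambda>z. 8 * C * norm z) \<longlongrightarrow> 0) (at (0::complex))"
      by (auto intro!: tendsto_eq_intros)
  qed
  then have "(g has_field_derivative e) (at 0)"
    unfolding has_field_derivative_iff by (simp add: LIM_zero_iff)
  then show "pd 1 1 f = e"
    by (simp add: pd_def g_def DERIV_imp_deriv)
qed

section \<open>Partial derivatives of rational families\<close>

text \<open>Polynomials in \<open>z\<close> and \<open>w\<close> whose coefficients are continuous functions of a real parameter \<open>s\<close>.\<close>

inductive poly_family :: "(real \<Rightarrow> complex \<Rightarrow> complex \<Rightarrow> complex) \<Rightarrow> bool" where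
  coeff: "continuous_on UNIV c \<Longrightarrow> poly_family (\<lambda>s z w. c s)"
| var_z: "poly_family (\<lambda>s z w. z)"
| var_w: "poly_family (\<lambda>s z w. w)"
| add: "poly_family p \<Longrightarrow> poly_family q \<Longrightarrow> poly_family (\<lambda>s z w. p s z w + q s z w)"
| mult: "poly_family p \<Longrightarrow> poly_family q \<Longrightarrow> poly_family (\<lambda>s z w. p s z w * q s z w)"

lemma poly_family_cmult: "poly_family p \<Longrightarrow> poly_family (\<lambda>s z w. a * p s z w)"
  by (rule poly_family.mult[OF poly_family.coeff[of "\<lambda>_. a"]]) simp_all

lemma poly_family_diff: "poly_family p \<Longrightarrow> poly_family q \<Longrightarrow> poly_family (\<lambda>s z w. p s z w - q s z w)"
  using poly_family.add[OF _ poly_family_cmult[of _ "-1"]] by simp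

lemma poly_family_const: "poly_family (\<lambda>s z w. a)"
  by (rule poly_family.coeff) simp

lemma poly_family_power: "poly_family p \<Longrightarrow> poly_family (\<lambda>s z w. p s z w ^ n)"
  by (induction n) (auto intro: poly_family.mult poly_family_const)

lemma poly_family_of_real: "poly_family (\<lambda>s z w. of_real s)"
  by (rule poly_family.coeff) (intro continuous_intros)

lemmas poly_family_intros = poly_family_const poly_family_of_real poly_family.var_z poly_family.var_w
  poly_family_power poly_family.add poly_family_diff poly_family.mult

lemma poly_family_restrict: "poly_family p \<Longrightarrow> poly_family (\<lambda>s a z. p s z 0)"
  by (induction rule: poly_family.induct) (auto intro: poly_family.intros poly_family_const)

lemma poly_family_continuous: "poly_family p \<Longrightarrow> continuous_on UNIV (\<lambda>s. p s z w)"
  by (induction rule: poly_family.induct) (auto intro!: continuous_intros)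

lemma poly_family_deriv:
  "poly_family p \<Longrightarrow> \<exists>p'. poly_family p' \<and> (\<forall>s z w. ((\<lambda>w. p s z w) has_field_derivative p' s z w) (at w))"
proof (induction rule: poly_family.induct)
  case (coeff c)
  then show ?case by (intro exI[of _ "\<lambda>s z w. 0"]) (auto intro: poly_family_const)
next
  case var_z
  then show ?case by (intro exI[of _ "\<lambda>s z w. 0"]) (auto intro: poly_family_const)
next
  case var_w
  then show ?case by (intro exI[of _ "\<lambda>s z w. 1"]) (auto intro: poly_family_const)
next
  case (add p q)
  then obtain p' q' where "poly_family p'" "poly_family q'"
    "\<And>s z w. ((\<lambda>w. p s z w) has_field_derivative p' s z w) (at w)"
    "\<And>s z w. ((\<lambda>w. q s z w) has_field_derivative q' s z w) (at w)" by blast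
  then show ?case
    by (intro exI[of _ "\<lambda>s z w. p' s z w + q' s z w"]) (auto intro!: poly_family.add derivative_intros)
next
  case (mult p q)
  then obtain p' q' where pq: "poly_family p'" "poly_family q'"
    "\<And>s z w. ((\<lambda>w. p s z w) has_field_derivative p' s z w) (at w)"
    "\<And>s z w. ((\<lambda>w. q s z w) has_field_derivative q' s z w) (at w)" by blast
  show ?case
  proof (intro exI[of _ "\<lambda>s z w. p' s z w * q s z w + q' s z w * p s z w"] conjI allI)
    show "poly_family (\<lambda>s z w. p' s z w * q s z w + q' s z w * p s z w)"
      by (intro poly_family.add poly_family.mult pq mult)
    show "((\<lambda>w. p s z w * q s z w) has_field_derivative p' s z w * q s z w + q' s z w * p s z w) (at w)" for s z w
      by (rule DERIV_mult[OF pq(3,4)])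
  qed
qed

text \<open>By the quotient rule the derivatives of \<open>p / q\<close> stay within fractions with a power of \<open>q\<close> below.\<close>

lemma higher_deriv_rational_family:
  assumes "poly_family p" and q: "poly_family q"
  shows "\<exists>r. poly_family r \<and> (\<forall>s z w. q s z w \<noteq> 0 \<longrightarrow>
    (deriv ^^ j) (\<lambda>w. p s z w / q s z w) w = r s z w / q s z w ^ Suc j)"
proof (induction j)
  case 0
  then show ?case using assms by auto
next
  case (Suc j)
  then obtain r where r: "poly_family r"
    "\<And>s z w. q s z w \<noteq> 0 \<Longrightarrow> (deriv ^^ j) (\<lambda>w. p s z w / q s z w) w = r s z w / q s z w ^ Suc j" by blast
  obtain r' q' where r': "poly_family r'" "\<And>s z w. ((\<lambda>w. r s z w) has_field_derivative r' s z w) (at w)"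
    and q': "poly_family q'" "\<And>s z w. ((\<lambda>w. q s z w) has_field_derivative q' s z w) (at w)"
    using poly_family_deriv[OF r(1)] poly_family_deriv[OF q] by blast
  show ?case
  proof (intro exI[of _ "\<lambda>s z w. r' s z w * q s z w - of_nat (Suc j) * (r s z w * q' s z w)"] conjI allI impI)
    show "poly_family (\<lambda>s z w. r' s z w * q s z w - of_nat (Suc j) * (r s z w * q' s z w))"
      by (intro poly_family_intros r r' q q')
    fix s z w assume nz: "q s z w \<noteq> 0"
    have dq: "((\<lambda>w. q s z w ^ Suc j) has_field_derivative of_nat (Suc j) * q s z w ^ j * q' s z w) (at w)"
      using DERIV_power[OF q'(2)[of s z w], of "Suc j"] by (simp del: power_Suc of_nat_Suc add: mult_ac)
    have "\<forall>\<^sub>F w' in nhds w. q s z w' \<noteq> 0"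
      by (rule eventually_nonzero_nhds[OF DERIV_isCont[OF q'(2)] nz])
    then have "\<forall>\<^sub>F w' in nhds w. (deriv ^^ j) (\<lambda>w. p s z w / q s z w) w' = r s z w' / q s z w' ^ Suc j"
      by eventually_elim (rule r(2))
    then have "(deriv ^^ Suc j) (\<lambda>w. p s z w / q s z w) w = deriv (\<lambda>w. r s z w / q s z w ^ Suc j) w"
      by (simp only: funpow.simps o_apply) (rule deriv_cong_ev, auto)
    also have "\<dots> = (r' s z w * q s z w ^ Suc j - r s z w * (of_nat (Suc j) * q s z w ^ j * q' s z w))
        / (q s z w ^ Suc j * q s z w ^ Suc j)"
      by (intro DERIV_imp_deriv DERIV_divide[OF r'(2) dq]) (use nz in simp)
    also have "r' s z w * q s z w ^ Suc j - r s z w * (of_nat (Suc j) * q s z w ^ j * q' s z w)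
      = q s z w ^ j * (r' s z w * q s z w - of_nat (Suc j) * (r s z w * q' s z w))"
      by (simp add: algebra_simps)
    also have "\<dots> / (q s z w ^ Suc j * q s z w ^ Suc j) =
      (r' s z w * q s z w - of_nat (Suc j) * (r s z w * q' s z w)) / q s z w ^ Suc (Suc j)"
      using nz by (simp add: divide_simps)
    finally show "(deriv ^^ Suc j) (\<lambda>w. p s z w / q s z w) w
      = (r' s z w * q s z w - of_nat (Suc j) * (r s z w * q' s z w)) / q s z w ^ Suc (Suc j)" .
  qed
qed

text \<open>Differentiating in \<open>w\<close>, putting \<open>w = 0\<close> and differentiating in \<open>z\<close> gives a fraction whose denominator at
  the origin is a power of \<open>q s 0 0\<close>; at a fixed point a polynomial family is continuous in \<open>s\<close>.\<close>

lemma continuous_pd_rational_family: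
  assumes p: "poly_family p" and q: "poly_family q" and nz: "\<And>s. q s 0 0 \<noteq> 0"
  shows "continuous_on UNIV (\<lambda>s. pd i j (\<lambda>x. p s (fst x) (snd x) / q s (fst x) (snd x)))"
proof -
  obtain r where r: "poly_family r"
    "\<And>s z w. q s z w \<noteq> 0 \<Longrightarrow> (deriv ^^ j) (\<lambda>w. p s z w / q s z w) w = r s z w / q s z w ^ Suc j"
    using higher_deriv_rational_family[OF p q, of j] by blast
  have r0: "poly_family (\<lambda>s a z. r s z 0)" and q0: "poly_family (\<lambda>s a z. q s z 0 ^ Suc j)"
    by (intro poly_family_power poly_family_restrict r q)+
  obtain t where t: "poly_family t" "\<And>s a z. q s z 0 ^ Suc j \<noteq> 0 \<Longrightarrow>
      (deriv ^^ i) (\<lambda>z. r s z 0 / q s z 0 ^ Suc j) z = t s a z / (q s z 0 ^ Suc j) ^ Suc i"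
    using higher_deriv_rational_family[OF r0 q0, of i] by blast
  have "pd i j (\<lambda>x. p s (fst x) (snd x) / q s (fst x) (snd x)) = t s 0 0 / (q s 0 0 ^ Suc j) ^ Suc i" for s
  proof -
    obtain q' where "\<And>s a z. ((\<lambda>z. q s z 0) has_field_derivative q' s a z) (at z)"
      using poly_family_deriv[OF poly_family_restrict[OF q]] by blast
    then have "\<forall>\<^sub>F z in nhds 0. q s z 0 \<noteq> 0"
      by (intro eventually_nonzero_nhds DERIV_isCont nz)
    then have "\<forall>\<^sub>F z in nhds 0. (deriv ^^ j) (\<lambda>w. p s z w / q s z w) 0 = r s z 0 / q s z 0 ^ Suc j"
      by eventually_elim (rule r(2))
    then have "pd i j (\<lambda>x. p s (fst x) (snd x) / q s (fst x) (snd x))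
        = (deriv ^^ i) (\<lambda>z. r s z 0 / q s z 0 ^ Suc j) 0"
      unfolding pd_def fst_conv snd_conv by (intro higher_deriv_cong_ev refl)
    also have "\<dots> = t s 0 0 / (q s 0 0 ^ Suc j) ^ Suc i"
      using t(2)[of s 0 0] nz[of s] by simp
    finally show ?thesis .
  qed
  moreover have "continuous_on UNIV (\<lambda>s. t s 0 0 / (q s 0 0 ^ Suc j) ^ Suc i)"
    by (intro continuous_on_divide continuous_on_power poly_family_continuous t q) (use nz in simp)
  ultimately show ?thesis by simp
qed

section \<open>The isotropies of the two quadrics\<close>

definition sigma_den :: "real \<Rightarrow> complex \<Rightarrow> C2 \<Rightarrow> complex" where
  "sigma_den r c p = 1 - 2 * \<i> * cnj c * fst p + (of_real r - \<i> * of_real ((cmod c)\<^sup>2)) * snd p"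

lemma sigma_eq:
  "sigma l r u c = (\<lambda>p. (of_real l * u * (fst p + c * snd p) / sigma_den r c p,
    of_real (l\<^sup>2) * snd p / sigma_den r c p))"
  by (auto simp: sigma_def sigma_den_def Let_def fun_eq_iff)

definition sigma'_den :: "real \<Rightarrow> real \<Rightarrow> complex \<Rightarrow> complex \<Rightarrow> C3 \<Rightarrow> complex" where
  "sigma'_den \<epsilon> r c1 c2 v = 1 - 2 * \<i> * (cnj c1 * fst v + of_real \<epsilon> * cnj c2 * fst (snd v))
     + (of_real r - \<i> * of_real ((cmod c1)\<^sup>2 + \<epsilon> * (cmod c2)\<^sup>2)) * snd (snd v)"

lemma sigma'_eq:
  "sigma' \<epsilon> l r u a1 a2 c1 c2 = (\<lambda>v.
     (of_real l * (u * a1 * (fst v + c1 * snd (snd v)) - of_real \<epsilon> * u * a2 * (fst (snd v) + c2 * snd (snd v)))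
        / sigma'_den \<epsilon> r c1 c2 v,
      of_real l * (cnj a2 * (fst v + c1 * snd (snd v)) + cnj a1 * (fst (snd v) + c2 * snd (snd v)))
        / sigma'_den \<epsilon> r c1 c2 v,
      of_real (l\<^sup>2) * snd (snd v) / sigma'_den \<epsilon> r c1 c2 v))"
  by (auto simp: sigma'_def sigma'_den_def Let_def fun_eq_iff)

lemma sigma_den_0: "sigma_den r c 0 = 1" and sigma'_den_0: "sigma'_den \<epsilon> r c1 c2 0 = 1"
  by (simp_all add: sigma_den_def sigma'_den_def)

lemma isCont_sigma_den: "isCont (sigma_den r c) p" and isCont_sigma'_den: "isCont (sigma'_den \<epsilon> r c1 c2) v"
  unfolding sigma_den_def[abs_def] sigma'_den_def[abs_def] by (intro continuous_intros)+

lemma sigma_at_0: "sigma l r u c 0 = 0" "isCont (sigma l r u c) 0"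
proof -
  show "sigma l r u c 0 = 0" by (simp add: sigma_eq zero_prod_def)
  show "isCont (sigma l r u c) 0"
    unfolding sigma_eq by (intro continuous_intros isCont_sigma_den) (simp_all add: sigma_den_0)
qed

lemma sigma'_at_0: "sigma' \<epsilon> l r u a1 a2 c1 c2 0 = 0" "isCont (sigma' \<epsilon> l r u a1 a2 c1 c2) 0"
proof -
  show "sigma' \<epsilon> l r u a1 a2 c1 c2 0 = 0" by (simp add: sigma'_eq zero_prod_def)
  show "isCont (sigma' \<epsilon> l r u a1 a2 c1 c2) 0"
    unfolding sigma'_eq by (intro continuous_intros isCont_sigma'_den) (simp_all add: sigma'_den_0)
qed

lemma sigma_den_eventually: "\<forall>\<^sub>F p in nhds 0. sigma_den r c p \<noteq> 0"
  by (intro eventually_nonzero_nhds isCont_sigma_den) (simp add: sigma_den_0)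

lemma sigma'_den_eventually: "\<forall>\<^sub>F v in nhds 0. sigma'_den \<epsilon> r c1 c2 v \<noteq> 0"
  by (intro eventually_nonzero_nhds isCont_sigma'_den) (simp add: sigma'_den_0)

lemma cnj_mult_unit: "cmod u = 1 \<Longrightarrow> cnj u * u = 1" "cmod u = 1 \<Longrightarrow> u * cnj u = 1"
  using complex_norm_square[of u] by (simp_all add: mult.commute)

text \<open>Up to the common scalar \<open>sigma_den\<close>, an isotropy is linear in \<open>(1, z, w)\<close>, and the inverse matrix has
  again the shape of an isotropy.  In particular the two denominators are reciprocal to each other.\<close>

lemma sigma_cancel:
  assumes "l > 0" "cmod u = 1" "sigma_den r c p \<noteq> 0"
  shows "sigma (1 / l) (- r / l\<^sup>2) (cnj u) (- u * c / of_real l) (sigma l r u c p) = p"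
proof -
  obtain z w where p: "p = (z, w)" by (cases p)
  let ?d = "sigma_den r c p" and ?v = "sigma l r u c p"
  have l: "complex_of_real l \<noteq> 0" using assms by simp
  have u: "u * cnj u = 1" using assms cnj_mult_unit by simp
  have u': "u * (cnj u * x) = x" for x using u by (simp flip: mult.assoc)
  have nc: "cmod (- u * c / of_real l) = cmod c / l"
    using assms by (simp add: norm_mult norm_divide)
  have cc: "complex_of_real ((cmod c)\<^sup>2) = c * cnj c" by (rule complex_norm_square)
  have d': "sigma_den (- r / l\<^sup>2) (- u * c / of_real l) ?v = 1 / ?d"
  proof -
    have "?d * sigma_den (- r / l\<^sup>2) (- u * c / of_real l) ?v
      = ?d + 2 * \<i> * cnj u * cnj c * u * (z + c * w) + (- of_real r - \<i> * (c * cnj c)) * w"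
      unfolding sigma_den_def[of "- r / l\<^sup>2"] nc power_divide of_real_divide cc
      using assms(3) l by (simp add: sigma_eq p field_simps power2_eq_square)
    also have "\<dots> = ?d + 2 * \<i> * cnj c * (z + c * w) + (- of_real r - \<i> * (c * cnj c)) * w"
      using u by algebra
    also have "\<dots> = 1"
      by (simp add: sigma_den_def p cc algebra_simps del: of_real_power)
    finally show ?thesis using assms(3) by (simp add: field_simps)
  qed
  have "sigma (1 / l) (- r / l\<^sup>2) (cnj u) (- u * c / of_real l) ?v
    = (of_real (1 / l) * cnj u * (fst ?v + - u * c / of_real l * snd ?v) * ?d, of_real ((1 / l)\<^sup>2) * snd ?v * ?d)"
    unfolding sigma_eq[of "1 / l"] d' by simp
  also have "fst ?v = of_real l * u * (z + c * w) / ?d" by (simp add: sigma_eq p)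
  also have "snd ?v = of_real l * of_real l * w / ?d" by (simp add: sigma_eq p power2_eq_square)
  finally show ?thesis
    using assms(3) l u' by (simp add: p field_simps power2_eq_square)
qed

lemma norm_form_cancel:
  fixes a1 a2 :: complex
  assumes "(cmod a1)\<^sup>2 + \<epsilon> * (cmod a2)\<^sup>2 = 1"
  shows "a1 * cnj a1 + of_real \<epsilon> * (a2 * cnj a2) = 1"
proof -
  have "complex_of_real ((cmod a1)\<^sup>2 + \<epsilon> * (cmod a2)\<^sup>2) = 1" by (simp only: assms of_real_1)
  then show ?thesis by (simp only: of_real_add of_real_mult complex_norm_square)
qed

text \<open>The analogue for the target: the inverse of \<open>U'\<close> is the matrix of the same shape with parameters
  \<open>cnj u\<close>, \<open>cnj a1\<close>, \<open>- u a2\<close>, and the translation part is moved through \<open>U'\<close>.\<close>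

lemma sigma'_cancel:
  assumes "l > 0" "cmod u = 1" "(cmod a1)\<^sup>2 + \<epsilon> * (cmod a2)\<^sup>2 = 1" "\<epsilon> = 1 \<or> \<epsilon> = -1"
    and "sigma'_den \<epsilon> r c1 c2 v \<noteq> 0"
  shows "sigma' \<epsilon> (1 / l) (- r / l\<^sup>2) (cnj u) (cnj a1) (- u * a2)
     (- (u * a1 * c1 - of_real \<epsilon> * u * a2 * c2) / of_real l) (- (cnj a2 * c1 + cnj a1 * c2) / of_real l)
     (sigma' \<epsilon> l r u a1 a2 c1 c2 v) = v"
proof -
  obtain z1 z2 w where v: "v = (z1, z2, w)" by (cases v)
  define e where "e = complex_of_real \<epsilon>"
  define L where "L = complex_of_real l"
  let ?d = "sigma'_den \<epsilon> r c1 c2 v" and ?v = "sigma' \<epsilon> l r u a1 a2 c1 c2 v"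
  define C1 C2 where "C1 = - (u * a1 * c1 - e * u * a2 * c2) / L" and "C2 = - (cnj a2 * c1 + cnj a1 * c2) / L"
  have ee: "e * e = 1" using assms(4) by (auto simp: e_def)
  have L: "L \<noteq> 0" using assms by (simp add: L_def)
  have u: "u * cnj u = 1" using assms cnj_mult_unit by simp
  have a: "a1 * cnj a1 + e * (a2 * cnj a2) = 1"
    unfolding e_def by (rule norm_form_cancel[OF assms(3)])
  have cL: "cnj L = L" and ce: "cnj e = e" by (simp_all add: L_def e_def)
  have cc: "complex_of_real ((cmod x)\<^sup>2) = x * cnj x" for x by (rule complex_norm_square)
  \<comment> \<open>\<open>U'\<close> preserves the Hermitian form with matrix \<open>diag (1, \<epsilon>)\<close>.\<close>
  have CC: "L * L * (C1 * cnj C1 + e * (C2 * cnj C2)) = c1 * cnj c1 + e * (c2 * cnj c2)"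
  proof -
    have "L * L * (C1 * cnj C1 + e * (C2 * cnj C2)) =
      (u * a1 * c1 - e * u * a2 * c2) * (cnj u * cnj a1 * cnj c1 - e * cnj u * cnj a2 * cnj c2)
      + e * ((cnj a2 * c1 + cnj a1 * c2) * (a2 * cnj c1 + a1 * cnj c2))"
      unfolding C1_def C2_def using L by (simp add: cL ce field_simps)
    also have "\<dots> = c1 * cnj c1 + e * (c2 * cnj c2)"
      using u a ee by algebra
    finally show ?thesis .
  qed
  define R where "R = complex_of_real r"
  have V: "fst ?v = L * (u * a1 * (z1 + c1 * w) - e * u * a2 * (z2 + c2 * w)) / ?d"
    "fst (snd ?v) = L * (cnj a2 * (z1 + c1 * w) + cnj a1 * (z2 + c2 * w)) / ?d"
    "snd (snd ?v) = L * L * w / ?d"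
    by (simp_all add: sigma'_eq v e_def L_def power2_eq_square)
  have dd: "?d = 1 - 2 * \<i> * (cnj c1 * z1 + e * cnj c2 * z2) + (R - \<i> * (c1 * cnj c1 + e * (c2 * cnj c2))) * w"
    by (simp add: sigma'_den_def v cc e_def R_def del: of_real_power)
  have d': "sigma'_den \<epsilon> (- r / l\<^sup>2) C1 C2 ?v = 1 / ?d"
  proof -
    have "sigma'_den \<epsilon> (- r / l\<^sup>2) C1 C2 ?v = 1 - 2 * \<i> * (cnj C1 * fst ?v + e * cnj C2 * fst (snd ?v))
      + (- R / (L * L) - \<i> * (C1 * cnj C1 + e * (C2 * cnj C2))) * snd (snd ?v)"
      by (simp add: sigma'_den_def cc e_def R_def L_def power2_eq_square[of l] del: of_real_power)
    also have "?d * \<dots> = ?d - 2 * \<i> * (L * cnj C1 * (u * a1 * (z1 + c1 * w) - e * u * a2 * (z2 + c2 * w))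
       + e * (L * cnj C2) * (cnj a2 * (z1 + c1 * w) + cnj a1 * (z2 + c2 * w)))
      + (- R - \<i> * (L * L * (C1 * cnj C1 + e * (C2 * cnj C2)))) * w"
      unfolding V using L assms(5) by (simp add: field_simps)
    also have "L * cnj C1 = - (cnj u * cnj a1 * cnj c1 - e * cnj u * cnj a2 * cnj c2)"
      unfolding C1_def using L by (simp add: cL ce)
    also have "L * cnj C2 = - (a2 * cnj c1 + a1 * cnj c2)"
      unfolding C2_def using L by (simp add: cL ce)
    also note CC
    also have "?d - 2 * \<i> * (- (cnj u * cnj a1 * cnj c1 - e * cnj u * cnj a2 * cnj c2) * (u * a1 * (z1 + c1 * w) - e * u * a2 * (z2 + c2 * w))
       + e * (- (a2 * cnj c1 + a1 * cnj c2)) * (cnj a2 * (z1 + c1 * w) + cnj a1 * (z2 + c2 * w)))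
      + (- R - \<i> * (c1 * cnj c1 + e * (c2 * cnj c2))) * w = 1"
      unfolding dd using u a ee by algebra
    finally show ?thesis using assms(5) by (simp add: field_simps)
  qed
  have "sigma' \<epsilon> (1 / l) (- r / l\<^sup>2) (cnj u) (cnj a1) (- u * a2) C1 C2 ?v
    = (1 / L * (cnj u * cnj a1 * (fst ?v + C1 * snd (snd ?v)) - e * cnj u * (- u * a2) * (fst (snd ?v) + C2 * snd (snd ?v))) * ?d,
       1 / L * (cnj (- u * a2) * (fst ?v + C1 * snd (snd ?v)) + a1 * (fst (snd ?v) + C2 * snd (snd ?v))) * ?d,
       1 / (L * L) * snd (snd ?v) * ?d)"
    unfolding sigma'_eq[of _ "1 / l"] d' by (simp add: e_def L_def power2_eq_square)
  also have "(fst ?v + C1 * snd (snd ?v)) = L * (u * a1 * z1 - e * u * a2 * z2) / ?d"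
    unfolding V C1_def using L assms(5) by (simp add: field_simps)
  also have "(fst (snd ?v) + C2 * snd (snd ?v)) = L * (cnj a2 * z1 + cnj a1 * z2) / ?d"
    unfolding V C2_def using L assms(5) by (simp add: field_simps)
  also have "snd (snd ?v) = L * L * w / ?d" by (rule V)
  also have "1 / L * (cnj u * cnj a1 * (L * (u * a1 * z1 - e * u * a2 * z2) / ?d)
      - e * cnj u * (- u * a2) * (L * (cnj a2 * z1 + cnj a1 * z2) / ?d)) * ?d
    = cnj u * cnj a1 * (u * a1 * z1 - e * u * a2 * z2) - e * cnj u * (- u * a2) * (cnj a2 * z1 + cnj a1 * z2)"
    using L assms(5) by (simp add: field_simps)
  also have "\<dots> = z1" using u a by algebra
  also have "1 / L * (cnj (- u * a2) * (L * (u * a1 * z1 - e * u * a2 * z2) / ?d)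
      + a1 * (L * (cnj a2 * z1 + cnj a1 * z2) / ?d)) * ?d
    = - (cnj u * cnj a2) * (u * a1 * z1 - e * u * a2 * z2) + a1 * (cnj a2 * z1 + cnj a1 * z2)"
    using L assms(5) by (simp add: field_simps)
  also have "\<dots> = z2" using u a by algebra
  also have "1 / (L * L) * (L * L * w / ?d) * ?d = w" using L assms(5) by simp
  finally show ?thesis by (simp add: v C1_def C2_def L_def e_def)
qed

text \<open>Clearing denominators in \<open>Im (w / q)\<close> turns the equation of a quadric into an identity between a
  function and its conjugate, to which polynomial algebra applies.\<close>

lemma Im_divide_eq_iff:
  assumes "q \<noteq> 0"
  shows "Im (w / q) = x / (cmod q)\<^sup>2 \<longleftrightarrow> w * cnj q - cnj w * q = 2 * \<i> * of_real x"
proof -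
  define y where "y = Im (w * cnj q)"
  have "w * cnj q - cnj w * q = 2 * \<i> * of_real y"
    using complex_diff_cnj[of "w * cnj q"] by (simp add: mult_ac y_def del: times_complex.sel)
  moreover have "Im (w / q) = y / (cmod q)\<^sup>2"
    unfolding y_def by (subst complex_div_cnj) (simp only: Im_divide_of_real flip: of_real_power)
  moreover have "2 * \<i> * of_real y = 2 * \<i> * of_real x \<longleftrightarrow> y = x"
    by (simp add: complex_eq_iff)
  ultimately show ?thesis using assms by simp
qed

lemma hyperquadric3_quotient:
  assumes "q \<noteq> 0"
  shows "(a / q, b / q, w / q) \<in> hyperquadric3 \<epsilon> \<longleftrightarrow>
    w * cnj q - cnj w * q = 2 * \<i> * (a * cnj a + of_real \<epsilon> * (b * cnj b))"
proof -
  have "of_real ((cmod a)\<^sup>2 + \<epsilon> * (cmod b)\<^sup>2) = a * cnj a + of_real \<epsilon> * (b * cnj b)"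
    by (simp only: of_real_add of_real_mult complex_norm_square)
  moreover have "(cmod (a / q))\<^sup>2 + \<epsilon> * (cmod (b / q))\<^sup>2 = ((cmod a)\<^sup>2 + \<epsilon> * (cmod b)\<^sup>2) / (cmod q)\<^sup>2"
    by (simp add: norm_divide power_divide add_divide_distrib)
  ultimately show ?thesis
    using Im_divide_eq_iff[OF assms, of w "(cmod a)\<^sup>2 + \<epsilon> * (cmod b)\<^sup>2"] by (simp add: hyperquadric3_def)
qed

lemma hyperquadric2_quotient:
  assumes "q \<noteq> 0"
  shows "(a / q, w / q) \<in> hyperquadric2 \<longleftrightarrow> w * cnj q - cnj w * q = 2 * \<i> * (a * cnj a)"
  using hyperquadric3_quotient[OF assms, of a 0 w 0] by (simp add: hyperquadric2_def hyperquadric3_def)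

lemma hyperquadric3_iff:
  "v \<in> hyperquadric3 \<epsilon> \<longleftrightarrow> snd (snd v) - cnj (snd (snd v)) =
    2 * \<i> * (fst v * cnj (fst v) + of_real \<epsilon> * (fst (snd v) * cnj (fst (snd v))))"
  using hyperquadric3_quotient[of 1 "fst v" "fst (snd v)" "snd (snd v)" \<epsilon>] by simp

lemma hyperquadric2_iff:
  "p \<in> hyperquadric2 \<longleftrightarrow> snd p - cnj (snd p) = 2 * \<i> * (fst p * cnj (fst p))"
  using hyperquadric2_quotient[of 1 "fst p" "snd p"] by simp

text \<open>After clearing the denominator both sides are polynomials in \<open>z, w\<close> and their conjugates, and their
  difference is a multiple of the equation of the quadric.\<close>

lemma sigma_preserves_quadric:
  assumes "p \<in> hyperquadric2" "sigma_den r c p \<noteq> 0" "cmod u = 1"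
  shows "sigma l r u c p \<in> hyperquadric2"
proof -
  obtain z w where p: "p = (z, w)" by (cases p)
  have w: "w - cnj w = 2 * \<i> * (z * cnj z)" using assms(1) by (simp add: hyperquadric2_iff p)
  have u: "u * cnj u = 1" using assms cnj_mult_unit by simp
  have cc: "complex_of_real ((cmod c)\<^sup>2) = c * cnj c" by (rule complex_norm_square)
  define R L where "R = complex_of_real r" and "L = complex_of_real l"
  have d: "sigma_den r c p = 1 - 2 * \<i> * cnj c * z + (R - \<i> * (c * cnj c)) * w"
    by (simp add: sigma_den_def p cc R_def del: of_real_power)
  have d': "cnj (sigma_den r c p) = 1 + 2 * \<i> * c * cnj z + (R + \<i> * (c * cnj c)) * cnj w"
    unfolding d by (simp add: R_def algebra_simps)
  have ii: "\<i> * \<i> = -1" by simp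
  show ?thesis
    unfolding sigma_eq
  proof (subst hyperquadric2_quotient[OF assms(2)])
    have "L * L * w * cnj (sigma_den r c p) - L * L * cnj w * sigma_den r c p
      = 2 * \<i> * (L * u * (z + c * w) * (L * cnj u * (cnj z + cnj c * cnj w)))"
      unfolding d' unfolding d using w u ii by algebra
    then show "of_real (l\<^sup>2) * snd p * cnj (sigma_den r c p) - cnj (of_real (l\<^sup>2) * snd p) * sigma_den r c p
      = 2 * \<i> * (of_real l * u * (fst p + c * snd p) * cnj (of_real l * u * (fst p + c * snd p)))"
      by (simp add: L_def p power2_eq_square)
  qed
qed

lemma sigma'_preserves_quadric:
  assumes "v \<in> hyperquadric3 \<epsilon>" "sigma'_den \<epsilon> r c1 c2 v \<noteq> 0" "cmod u = 1"
    "(cmod a1)\<^sup>2 + \<epsilon> * (cmod a2)\<^sup>2 = 1" "\<epsilon> = 1 \<or> \<epsilon> = -1"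
  shows "sigma' \<epsilon> l r u a1 a2 c1 c2 v \<in> hyperquadric3 \<epsilon>"
proof -
  obtain z1 z2 w where v: "v = (z1, z2, w)" by (cases v)
  define e R L where "e = complex_of_real \<epsilon>" and "R = complex_of_real r" and "L = complex_of_real l"
  have w: "w - cnj w = 2 * \<i> * (z1 * cnj z1 + e * (z2 * cnj z2))"
    using assms(1) by (simp add: hyperquadric3_iff v e_def)
  have u: "u * cnj u = 1" using assms cnj_mult_unit by simp
  have ee: "e * e = 1" using assms(5) by (auto simp: e_def)
  have ii: "\<i> * \<i> = -1" by simp
  have a: "a1 * cnj a1 + e * (a2 * cnj a2) = 1"
    unfolding e_def by (rule norm_form_cancel[OF assms(4)])
  have cc: "complex_of_real ((cmod x)\<^sup>2) = x * cnj x" for x by (rule complex_norm_square)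
  have d: "sigma'_den \<epsilon> r c1 c2 v = 1 - 2 * \<i> * (cnj c1 * z1 + e * cnj c2 * z2)
      + (R - \<i> * (c1 * cnj c1 + e * (c2 * cnj c2))) * w"
    by (simp add: sigma'_den_def v cc e_def R_def del: of_real_power)
  have d': "cnj (sigma'_den \<epsilon> r c1 c2 v) = 1 + 2 * \<i> * (c1 * cnj z1 + e * c2 * cnj z2)
      + (R + \<i> * (c1 * cnj c1 + e * (c2 * cnj c2))) * cnj w"
    unfolding d by (simp add: R_def e_def algebra_simps)
  let ?v1 = "z1 + c1 * w" and ?v2 = "z2 + c2 * w"
  let ?w1 = "cnj z1 + cnj c1 * cnj w" and ?w2 = "cnj z2 + cnj c2 * cnj w"
  \<comment> \<open>\<open>U'\<close> preserves the Hermitian form with matrix \<open>diag (1, \<epsilon>)\<close>.\<close>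
  have U: "(u * a1 * ?v1 - e * u * a2 * ?v2) * (cnj u * cnj a1 * ?w1 - e * cnj u * cnj a2 * ?w2)
      + e * ((cnj a2 * ?v1 + cnj a1 * ?v2) * (a2 * ?w1 + a1 * ?w2)) = ?v1 * ?w1 + e * (?v2 * ?w2)"
    using u a ee by algebra
  have "w * cnj (sigma'_den \<epsilon> r c1 c2 v) - cnj w * sigma'_den \<epsilon> r c1 c2 v = 2 * \<i> * (?v1 * ?w1 + e * (?v2 * ?w2))"
    unfolding d' unfolding d using w ii ee by algebra
  then have "L * L * w * cnj (sigma'_den \<epsilon> r c1 c2 v) - L * L * cnj w * sigma'_den \<epsilon> r c1 c2 v
      = 2 * \<i> * (L * (u * a1 * ?v1 - e * u * a2 * ?v2) * (L * (cnj u * cnj a1 * ?w1 - e * cnj u * cnj a2 * ?w2))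
      + e * (L * (cnj a2 * ?v1 + cnj a1 * ?v2) * (L * (a2 * ?w1 + a1 * ?w2))))"
    using U by algebra
  then show ?thesis
    unfolding sigma'_eq by (subst hyperquadric3_quotient[OF assms(2)]) (simp add: L_def e_def v power2_eq_square)
qed

lemma holo_at_sigma:
  assumes "sigma_den r c p \<noteq> 0"
  shows "holo_at (\<lambda>p. fst (sigma l r u c p)) p" "holo_at (\<lambda>p. snd (sigma l r u c p)) p"
  using assms unfolding sigma_eq sigma_den_def[abs_def] fst_conv snd_conv
  by (intro holo_at_divide holo_at_mult holo_at_add holo_at_diff holo_at_const holo_at_fst holo_at_snd; simp)+

lemma holo_at_sigma':
  assumes "holo_at (\<lambda>p. fst (F p)) p" "holo_at (\<lambda>p. fst (snd (F p))) p" "holo_at (\<lambda>p. snd (snd (F p))) p"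
    and "sigma'_den \<epsilon> r c1 c2 (F p) \<noteq> 0"
  shows "holo_at (\<lambda>p. fst (sigma' \<epsilon> l r u a1 a2 c1 c2 (F p))) p"
    "holo_at (\<lambda>p. fst (snd (sigma' \<epsilon> l r u a1 a2 c1 c2 (F p)))) p"
    "holo_at (\<lambda>p. snd (snd (sigma' \<epsilon> l r u a1 a2 c1 c2 (F p)))) p"
  using assms unfolding sigma'_eq sigma'_den_def[abs_def] fst_conv snd_conv
  by (intro holo_at_divide holo_at_mult holo_at_add holo_at_diff holo_at_const; simp)+

lemma sigma_jets:
  fixes l r :: real and u c \<rho> :: complex
  defines "\<rho> \<equiv> complex_of_real r - \<i> * of_real ((cmod c)\<^sup>2)"
  shows "has_jet2 (\<lambda>p. fst (sigma l r u c p)) 0 (l * u) (l * u * c) (2 * \<i> * cnj c * l * u)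
      (- l * u * \<rho> + 2 * \<i> * cnj c * l * u * c) (- l * u * c * \<rho>)"
    "has_jet2 (\<lambda>p. snd (sigma l r u c p)) 0 0 (l\<^sup>2) 0 (2 * \<i> * cnj c * l\<^sup>2) (- l\<^sup>2 * \<rho>)"
proof -
  have d: "has_jet2 (sigma_den r c) 1 (- 2 * \<i> * cnj c) \<rho> 0 0 0"
    unfolding sigma_den_def[abs_def] has_jet2_def \<rho>_def by simp
  have n: "has_jet2 (\<lambda>p. l * u * (fst p + c * snd p)) 0 (l * u) (l * u * c) 0 0 0"
    "has_jet2 (\<lambda>p. of_real (l\<^sup>2) * snd p) 0 0 (l\<^sup>2) 0 0 0"
    unfolding has_jet2_def by (simp_all add: algebra_simps)
  show "has_jet2 (\<lambda>p. fst (sigma l r u c p)) 0 (l * u) (l * u * c) (2 * \<i> * cnj c * l * u)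
      (- l * u * \<rho> + 2 * \<i> * cnj c * l * u * c) (- l * u * c * \<rho>)"
    unfolding sigma_eq fst_conv
    by (rule has_jet2_eqI[OF has_jet2_normalized_quotient[OF n(1) d]]) (simp_all add: algebra_simps)
  show "has_jet2 (\<lambda>p. snd (sigma l r u c p)) 0 0 (l\<^sup>2) 0 (2 * \<i> * cnj c * l\<^sup>2) (- l\<^sup>2 * \<rho>)"
    unfolding sigma_eq snd_conv
    by (rule has_jet2_eqI[OF has_jet2_normalized_quotient[OF n(2) d]]) (simp_all add: algebra_simps)
qed

section \<open>The normal forms\<close>

definition G2_p1 :: "real \<Rightarrow> real \<Rightarrow> complex \<Rightarrow> complex \<Rightarrow> complex" where
  "G2_p1 \<epsilon> s z w = 4 * z - 4 * of_real \<epsilon> * of_real s * z^2 + \<i> * (of_real \<epsilon> - of_real s^2) * z * w + of_real s * w^2"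
definition G2_p2 :: "real \<Rightarrow> real \<Rightarrow> complex \<Rightarrow> complex \<Rightarrow> complex" where
  "G2_p2 \<epsilon> s z w = 4 * z^2 + of_real s^2 * w^2"
definition G2_p3 :: "real \<Rightarrow> real \<Rightarrow> complex \<Rightarrow> complex \<Rightarrow> complex" where
  "G2_p3 \<epsilon> s z w = w * (4 - 4 * of_real \<epsilon> * of_real s * z - \<i> * (of_real \<epsilon> + of_real s^2) * w)"
definition G2_q :: "real \<Rightarrow> real \<Rightarrow> complex \<Rightarrow> complex \<Rightarrow> complex" where
  "G2_q \<epsilon> s z w = 4 - 4 * of_real \<epsilon> * of_real s * z - \<i> * (of_real \<epsilon> + of_real s^2) * w - 2 * \<i> * of_real s * z * w - of_real \<epsilon> * of_real s^2 * w^2"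

definition G3_p1 :: "real \<Rightarrow> real \<Rightarrow> complex \<Rightarrow> complex \<Rightarrow> complex" where
  "G3_p1 \<epsilon> s z w = 256 * of_real \<epsilon> * z + 96 * \<i> * z * w + 64 * of_real \<epsilon> * of_real s * w^2 + 64 * z^3
     + 64 * \<i> * of_real \<epsilon> * of_real s * z^2 * w - 3 * (3 * of_real \<epsilon> - 16 * of_real s^2) * z * w^2 + 4 * \<i> * of_real s * w^3"
definition G3_p2 :: "real \<Rightarrow> real \<Rightarrow> complex \<Rightarrow> complex \<Rightarrow> complex" where
  "G3_p2 \<epsilon> s z w = 256 * of_real \<epsilon> * z^2 - 16 * w^2 + 256 * of_real s * z^3 + 16 * \<i> * z^2 * w
     - 16 * of_real \<epsilon> * of_real s * z * w^2 - \<i> * of_real \<epsilon> * w^3"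
definition G3_p3 :: "real \<Rightarrow> real \<Rightarrow> complex \<Rightarrow> complex \<Rightarrow> complex" where
  "G3_p3 \<epsilon> s z w = w * (256 * of_real \<epsilon> - 32 * \<i> * w + 64 * z^2 - 64 * \<i> * of_real \<epsilon> * of_real s * z * w
     - (of_real \<epsilon> + 16 * of_real s^2) * w^2)"
definition G3_q :: "real \<Rightarrow> real \<Rightarrow> complex \<Rightarrow> complex \<Rightarrow> complex" where
  "G3_q \<epsilon> s z w = 256 * of_real \<epsilon> - 32 * \<i> * w + 64 * z^2 - 192 * \<i> * of_real \<epsilon> * of_real s * z * w
     - (17 * of_real \<epsilon> + 144 * of_real s^2) * w^2 + 32 * \<i> * of_real \<epsilon> * z^2 * w + 24 * of_real s * z * w^2 + \<i> * w^3"

definition rational_map :: "(complex \<Rightarrow> complex \<Rightarrow> complex) \<Rightarrow> (complex \<Rightarrow> complex \<Rightarrow> complex) \<Rightarrow>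
    (complex \<Rightarrow> complex \<Rightarrow> complex) \<Rightarrow> (complex \<Rightarrow> complex \<Rightarrow> complex) \<Rightarrow> C2 \<Rightarrow> C3" where
  "rational_map p1 p2 p3 q = (\<lambda>x. (p1 (fst x) (snd x) / q (fst x) (snd x), p2 (fst x) (snd x) / q (fst x) (snd x),
     p3 (fst x) (snd x) / q (fst x) (snd x)))"

lemma G2_eq: "G2 \<epsilon> s = rational_map (G2_p1 \<epsilon> s) (G2_p2 \<epsilon> s) (G2_p3 \<epsilon> s) (G2_q \<epsilon> s)"
  unfolding G2_def rational_map_def G2_p1_def G2_p2_def G2_p3_def G2_q_def
  by (auto simp: fun_eq_iff Let_def)

lemma G3_eq: "G3 \<epsilon> s = rational_map (G3_p1 \<epsilon> s) (G3_p2 \<epsilon> s) (G3_p3 \<epsilon> s) (G3_q \<epsilon> s)"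
  unfolding G3_def rational_map_def G3_p1_def G3_p2_def G3_p3_def G3_q_def
  by (auto simp: fun_eq_iff Let_def)

lemma poly_family_G:
  "poly_family (G2_p1 \<epsilon>)" "poly_family (G2_p2 \<epsilon>)" "poly_family (G2_p3 \<epsilon>)" "poly_family (G2_q \<epsilon>)"
  "poly_family (G3_p1 \<epsilon>)" "poly_family (G3_p2 \<epsilon>)" "poly_family (G3_p3 \<epsilon>)" "poly_family (G3_q \<epsilon>)"
  unfolding G2_p1_def[abs_def] G2_p2_def[abs_def] G2_p3_def[abs_def] G2_q_def[abs_def]
    G3_p1_def[abs_def] G3_p2_def[abs_def] G3_p3_def[abs_def] G3_q_def[abs_def]
  by (intro poly_family_intros)+

lemma G_at_0:
  "G2_p1 \<epsilon> s 0 0 = 0" "G2_p2 \<epsilon> s 0 0 = 0" "G2_p3 \<epsilon> s 0 0 = 0" "G2_q \<epsilon> s 0 0 = 4"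
  "G3_p1 \<epsilon> s 0 0 = 0" "G3_p2 \<epsilon> s 0 0 = 0" "G3_p3 \<epsilon> s 0 0 = 0" "G3_q \<epsilon> s 0 0 = 256 * of_real \<epsilon>"
  by (simp_all add: G2_p1_def G2_p2_def G2_p3_def G2_q_def G3_p1_def G3_p2_def G3_p3_def G3_q_def)

text \<open>A polynomial identity in \<open>z\<close>, \<open>w\<close>, their conjugates \<open>Z\<close>, \<open>W\<close>, the real parameters \<open>e\<close>, \<open>t\<close> and \<open>I\<close>, modulo the
  relations \<open>w - W = 2 I z Z\<close>, \<open>e\<^sup>2 = 1\<close> and \<open>I\<^sup>2 = -1\<close>.\<close>

lemma G2_quadric_identity:
  assumes "w - cnj w = 2 * \<i> * (z * cnj z)" "\<epsilon> = 1 \<or> \<epsilon> = -1"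
  shows "G2_p3 \<epsilon> s z w * cnj (G2_q \<epsilon> s z w) - cnj (G2_p3 \<epsilon> s z w) * G2_q \<epsilon> s z w =
    2 * \<i> * (G2_p1 \<epsilon> s z w * cnj (G2_p1 \<epsilon> s z w) + of_real \<epsilon> * (G2_p2 \<epsilon> s z w * cnj (G2_p2 \<epsilon> s z w)))"
proof -
  define e t Z W I where "e = complex_of_real \<epsilon>" "t = complex_of_real s" "Z = cnj z" "W = cnj w" "I = \<i>"
  have h: "w - W = 2 * I * (z * Z)" "e * e = 1" "I * I = -1"
    using assms by (auto simp: e_t_Z_W_I_def)
  have "w * (4 - 4 * e * t * z - I * (e + t^2) * w) * (4 - 4 * e * t * Z + I * (e + t^2) * W + 2 * I * t * Z * W - e * t^2 * W^2)
    - W * (4 - 4 * e * t * Z + I * (e + t^2) * W) * (4 - 4 * e * t * z - I * (e + t^2) * w - 2 * I * t * z * w - e * t^2 * w^2)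
    = 2 * I * ((4 * z - 4 * e * t * z^2 + I * (e - t^2) * z * w + t * w^2) * (4 * Z - 4 * e * t * Z^2 - I * (e - t^2) * Z * W + t * W^2)
      + e * ((4 * z^2 + t^2 * w^2) * (4 * Z^2 + t^2 * W^2)))"
    using h by algebra
  then show ?thesis
    unfolding G2_p1_def G2_p2_def G2_p3_def G2_q_def
    by (simp add: e_t_Z_W_I_def)
qed

lemma G3_quadric_identity:
  assumes "w - cnj w = 2 * \<i> * (z * cnj z)" "\<epsilon> = 1 \<or> \<epsilon> = -1"
  shows "G3_p3 \<epsilon> s z w * cnj (G3_q \<epsilon> s z w) - cnj (G3_p3 \<epsilon> s z w) * G3_q \<epsilon> s z w =
    2 * \<i> * (G3_p1 \<epsilon> s z w * cnj (G3_p1 \<epsilon> s z w) + of_real \<epsilon> * (G3_p2 \<epsilon> s z w * cnj (G3_p2 \<epsilon> s z w)))"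
proof -
  define e t Z W I where "e = complex_of_real \<epsilon>" "t = complex_of_real s" "Z = cnj z" "W = cnj w" "I = \<i>"
  have h: "w = W + 2 * I * (z * Z)" "e * e = 1" "I * I = -1"
    using assms by (auto simp: e_t_Z_W_I_def algebra_simps)
  have "w * (256 * e - 32 * I * w + 64 * z^2 - 64 * I * e * t * z * w - (e + 16 * t^2) * w^2)
    * (256 * e + 32 * I * W + 64 * Z^2 + 192 * I * e * t * Z * W - (17 * e + 144 * t^2) * W^2 - 32 * I * e * Z^2 * W + 24 * t * Z * W^2 - I * W^3)
    - W * (256 * e + 32 * I * W + 64 * Z^2 + 64 * I * e * t * Z * W - (e + 16 * t^2) * W^2)
    * (256 * e - 32 * I * w + 64 * z^2 - 192 * I * e * t * z * w - (17 * e + 144 * t^2) * w^2 + 32 * I * e * z^2 * w + 24 * t * z * w^2 + I * w^3)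
    = 2 * I * ((256 * e * z + 96 * I * z * w + 64 * e * t * w^2 + 64 * z^3 + 64 * I * e * t * z^2 * w - 3 * (3 * e - 16 * t^2) * z * w^2 + 4 * I * t * w^3)
      * (256 * e * Z - 96 * I * Z * W + 64 * e * t * W^2 + 64 * Z^3 - 64 * I * e * t * Z^2 * W - 3 * (3 * e - 16 * t^2) * Z * W^2 - 4 * I * t * W^3)
      + e * ((256 * e * z^2 - 16 * w^2 + 256 * t * z^3 + 16 * I * z^2 * w - 16 * e * t * z * w^2 - I * e * w^3)
       * (256 * e * Z^2 - 16 * W^2 + 256 * t * Z^3 - 16 * I * Z^2 * W - 16 * e * t * Z * W^2 + I * e * W^3)))"
    using h by algebra
  then show ?thesis
    unfolding G3_p1_def G3_p2_def G3_p3_def G3_q_def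
    by (simp add: e_t_Z_W_I_def)
qed

text \<open>The properties of the representatives of normal forms on which all statements about orbits rest.  The
  numbers \<open>a\<close> and \<open>b\<close> are the only free coefficients of the 2-jet.\<close>

definition normal_map :: "real \<Rightarrow> complex \<Rightarrow> complex \<Rightarrow> (C2 \<Rightarrow> C3) \<Rightarrow> bool" where
  "normal_map \<epsilon> a b F \<longleftrightarrow> F 0 = 0 \<and> isCont F 0
     \<and> (\<forall>\<^sub>F p in nhds 0. holo_at (\<lambda>x. fst (F x)) p \<and> holo_at (\<lambda>x. fst (snd (F x))) p \<and> holo_at (\<lambda>x. snd (snd (F x))) p)
     \<and> (\<forall>\<^sub>F p in nhds 0. p \<in> hyperquadric2 \<longrightarrow> F p \<in> hyperquadric3 \<epsilon>)
     \<and> has_jet2 (\<lambda>p. fst (F p)) 0 1 0 0 (\<i> * of_real \<epsilon> / 2) a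
     \<and> has_jet2 (\<lambda>p. fst (snd (F p))) 0 0 0 1 0 b
     \<and> has_jet2 (\<lambda>p. snd (snd (F p))) 0 0 1 0 0 0"

lemma holo_at_poly_family: "poly_family p \<Longrightarrow> holo_at (\<lambda>x. p s (fst x) (snd x)) v"
  by (induction rule: poly_family.induct)
    (auto intro: holo_at_const holo_at_fst holo_at_snd holo_at_add holo_at_mult)

lemma rational_map_regular:
  assumes "poly_family p1" "poly_family p2" "poly_family p3" "poly_family q" "q s 0 0 \<noteq> 0"
    and "p1 s 0 0 = 0" "p2 s 0 0 = 0" "p3 s 0 0 = 0"
  shows "rational_map (p1 s) (p2 s) (p3 s) (q s) 0 = 0" "isCont (rational_map (p1 s) (p2 s) (p3 s) (q s)) 0"
    "\<forall>\<^sub>F x in nhds 0. q s (fst x) (snd x) \<noteq> 0"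
    "\<forall>\<^sub>F x in nhds 0. holo_at (\<lambda>x. fst (rational_map (p1 s) (p2 s) (p3 s) (q s) x)) x
       \<and> holo_at (\<lambda>x. fst (snd (rational_map (p1 s) (p2 s) (p3 s) (q s) x))) x
       \<and> holo_at (\<lambda>x. snd (snd (rational_map (p1 s) (p2 s) (p3 s) (q s) x))) x"
proof -
  note h = holo_at_poly_family[OF assms(1), of s] holo_at_poly_family[OF assms(2), of s]
    holo_at_poly_family[OF assms(3), of s] holo_at_poly_family[OF assms(4), of s]
  show "rational_map (p1 s) (p2 s) (p3 s) (q s) 0 = 0"
    by (simp add: rational_map_def assms zero_prod_def)
  show "isCont (rational_map (p1 s) (p2 s) (p3 s) (q s)) 0"
    unfolding rational_map_def by (intro continuous_intros holo_at_imp_isCont h) (simp_all add: assms)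
  show ev: "\<forall>\<^sub>F x in nhds 0. q s (fst x) (snd x) \<noteq> 0"
    by (rule eventually_nonzero_nhds[OF holo_at_imp_isCont[OF h(4)]]) (simp add: assms)
  show "\<forall>\<^sub>F x in nhds 0. holo_at (\<lambda>x. fst (rational_map (p1 s) (p2 s) (p3 s) (q s) x)) x
       \<and> holo_at (\<lambda>x. fst (snd (rational_map (p1 s) (p2 s) (p3 s) (q s) x))) x
       \<and> holo_at (\<lambda>x. snd (snd (rational_map (p1 s) (p2 s) (p3 s) (q s) x))) x"
    using ev by eventually_elim (auto simp: rational_map_def intro!: holo_at_divide h)
qed

lemma G2_jets:
  "has_jet2 (\<lambda>x. G2_p1 \<epsilon> s (fst x) (snd x)) 0 4 0 (- 4 * of_real \<epsilon> * of_real s) (\<i> * (of_real \<epsilon> - of_real s^2)) (of_real s)"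
  "has_jet2 (\<lambda>x. G2_p2 \<epsilon> s (fst x) (snd x)) 0 0 0 4 0 (of_real s^2)"
  "has_jet2 (\<lambda>x. G2_p3 \<epsilon> s (fst x) (snd x)) 0 0 4 0 (- 4 * of_real \<epsilon> * of_real s) (- \<i> * (of_real \<epsilon> + of_real s^2))"
  "has_jet2 (\<lambda>x. G2_q \<epsilon> s (fst x) (snd x)) 4 (- 4 * of_real \<epsilon> * of_real s) (- \<i> * (of_real \<epsilon> + of_real s^2)) 0
     (- 2 * \<i> * of_real s) (- of_real \<epsilon> * of_real s^2)"
  unfolding has_jet2_def G2_p1_def G2_p2_def G2_p3_def G2_q_def
  by (simp_all add: algebra_simps power2_eq_square)

lemma G3_jets:
  "has_jet2 (\<lambda>x. G3_p1 \<epsilon> s (fst x) (snd x)) 0 (256 * of_real \<epsilon>) 0 0 (96 * \<i>) (64 * of_real \<epsilon> * of_real s)"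
  "has_jet2 (\<lambda>x. G3_p2 \<epsilon> s (fst x) (snd x)) 0 0 0 (256 * of_real \<epsilon>) 0 (- 16)"
  "has_jet2 (\<lambda>x. G3_p3 \<epsilon> s (fst x) (snd x)) 0 0 (256 * of_real \<epsilon>) 0 0 (- 32 * \<i>)"
  "has_jet2 (\<lambda>x. G3_q \<epsilon> s (fst x) (snd x)) (256 * of_real \<epsilon>) 0 (- 32 * \<i>) 64
     (- 192 * \<i> * of_real \<epsilon> * of_real s) (- (17 * of_real \<epsilon> + 144 * of_real s^2))"
proof -
  define e t where "e = complex_of_real \<epsilon>" "t = complex_of_real s"
  have "G3_p1 \<epsilon> s z w = 0 + 256 * e * z + 0 * w + 0 * z^2 + 96 * \<i> * z * w + 64 * e * t * w^2
      + (64 * z^3 + 64 * \<i> * e * t * z^2 * w + (- 3 * (3 * e - 16 * t^2)) * z * w^2 + 4 * \<i> * t * w^3)" for z w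
    unfolding G3_p1_def e_t_def by algebra
  then show "has_jet2 (\<lambda>x. G3_p1 \<epsilon> s (fst x) (snd x)) 0 (256 * of_real \<epsilon>) 0 0 (96 * \<i>) (64 * of_real \<epsilon> * of_real s)"
    unfolding e_t_def by (simp only: has_jet2_cubic)
  have "G3_p2 \<epsilon> s z w = 0 + 0 * z + 0 * w + 256 * e * z^2 + 0 * z * w + (-16) * w^2
      + (256 * t * z^3 + 16 * \<i> * z^2 * w + (- 16 * e * t) * z * w^2 + (- \<i> * e) * w^3)" for z w
    unfolding G3_p2_def e_t_def by algebra
  then show "has_jet2 (\<lambda>x. G3_p2 \<epsilon> s (fst x) (snd x)) 0 0 0 (256 * of_real \<epsilon>) 0 (- 16)"
    unfolding e_t_def by (simp only: has_jet2_cubic)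
  have "G3_p3 \<epsilon> s z w = 0 + 0 * z + (256 * e) * w + 0 * z^2 + 0 * z * w + (- 32 * \<i>) * w^2
      + (0 * z^3 + 64 * z^2 * w + (- 64 * \<i> * e * t) * z * w^2 + (- (e + 16 * t^2)) * w^3)" for z w
    unfolding G3_p3_def e_t_def by algebra
  then show "has_jet2 (\<lambda>x. G3_p3 \<epsilon> s (fst x) (snd x)) 0 0 (256 * of_real \<epsilon>) 0 0 (- 32 * \<i>)"
    unfolding e_t_def by (simp only: has_jet2_cubic)
  have "G3_q \<epsilon> s z w = 256 * e + 0 * z + (- 32 * \<i>) * w + 64 * z^2 + (- 192 * \<i> * e * t) * z * w + (- (17 * e + 144 * t^2)) * w^2
      + (0 * z^3 + 32 * \<i> * e * z^2 * w + 24 * t * z * w^2 + \<i> * w^3)" for z w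
    unfolding G3_q_def e_t_def by algebra
  then show "has_jet2 (\<lambda>x. G3_q \<epsilon> s (fst x) (snd x)) (256 * of_real \<epsilon>) 0 (- 32 * \<i>) 64
     (- 192 * \<i> * of_real \<epsilon> * of_real s) (- (17 * of_real \<epsilon> + 144 * of_real s^2))"
    unfolding e_t_def by (simp only: has_jet2_cubic)
qed

lemma normal_map_G2:
  assumes "\<epsilon> = 1 \<or> \<epsilon> = -1"
  shows "normal_map \<epsilon> (of_real s / 4) (of_real (s\<^sup>2 / 4)) (G2 \<epsilon> s)"
  unfolding normal_map_def
proof (intro conjI)
  have nz: "G2_q \<epsilon> s 0 0 \<noteq> 0" by (simp add: G_at_0)
  note reg = rational_map_regular[OF poly_family_G(1-4)[of \<epsilon>] nz G_at_0(1-3), folded G2_eq]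
  show "G2 \<epsilon> s 0 = 0" "isCont (G2 \<epsilon> s) 0"
    "\<forall>\<^sub>F p in nhds 0. holo_at (\<lambda>x. fst (G2 \<epsilon> s x)) p \<and> holo_at (\<lambda>x. fst (snd (G2 \<epsilon> s x))) p \<and> holo_at (\<lambda>x. snd (snd (G2 \<epsilon> s x))) p"
    by (rule reg)+
  show "\<forall>\<^sub>F p in nhds 0. p \<in> hyperquadric2 \<longrightarrow> G2 \<epsilon> s p \<in> hyperquadric3 \<epsilon>"
    using reg(3) by eventually_elim
      (auto simp: G2_eq rational_map_def hyperquadric3_quotient hyperquadric2_iff intro!: G2_quadric_identity assms)
  show "has_jet2 (\<lambda>p. fst (G2 \<epsilon> s p)) 0 1 0 0 (\<i> * of_real \<epsilon> / 2) (of_real s / 4)"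
    unfolding G2_eq rational_map_def fst_conv
    by (rule has_jet2_divide[OF G2_jets(1) G2_jets(4)]) (simp_all add: algebra_simps)
  show "has_jet2 (\<lambda>p. fst (snd (G2 \<epsilon> s p))) 0 0 0 1 0 (of_real (s\<^sup>2 / 4))"
    unfolding G2_eq rational_map_def fst_conv snd_conv
    by (rule has_jet2_divide[OF G2_jets(2) G2_jets(4)]) (simp_all add: algebra_simps)
  show "has_jet2 (\<lambda>p. snd (snd (G2 \<epsilon> s p))) 0 0 1 0 0 0"
    unfolding G2_eq rational_map_def snd_conv
    by (rule has_jet2_divide[OF G2_jets(3) G2_jets(4)]) (simp_all add: algebra_simps)
qed

lemma normal_map_G3:
  assumes "\<epsilon> = 1 \<or> \<epsilon> = -1"
  shows "normal_map \<epsilon> (of_real s / 4) (of_real (- \<epsilon> / 16)) (G3 \<epsilon> s)"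
  unfolding normal_map_def
proof (intro conjI)
  have nz: "G3_q \<epsilon> s 0 0 \<noteq> 0" using assms by (auto simp: G_at_0)
  have nz': "256 * complex_of_real \<epsilon> \<noteq> 0" using assms by auto
  note reg = rational_map_regular[OF poly_family_G(5-8)[of \<epsilon>] nz G_at_0(5-7), folded G3_eq]
  show "G3 \<epsilon> s 0 = 0" "isCont (G3 \<epsilon> s) 0"
    "\<forall>\<^sub>F p in nhds 0. holo_at (\<lambda>x. fst (G3 \<epsilon> s x)) p \<and> holo_at (\<lambda>x. fst (snd (G3 \<epsilon> s x))) p \<and> holo_at (\<lambda>x. snd (snd (G3 \<epsilon> s x))) p"
    by (rule reg)+
  show "\<forall>\<^sub>F p in nhds 0. p \<in> hyperquadric2 \<longrightarrow> G3 \<epsilon> s p \<in> hyperquadric3 \<epsilon>"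
    using reg(3) by eventually_elim
      (auto simp: G3_eq rational_map_def hyperquadric3_quotient hyperquadric2_iff intro!: G3_quadric_identity assms)
  show "has_jet2 (\<lambda>p. fst (G3 \<epsilon> s p)) 0 1 0 0 (\<i> * of_real \<epsilon> / 2) (of_real s / 4)"
    unfolding G3_eq rational_map_def fst_conv
    by (rule has_jet2_divide[OF G3_jets(1) G3_jets(4) nz']) (use assms in auto)
  show "has_jet2 (\<lambda>p. fst (snd (G3 \<epsilon> s p))) 0 0 0 1 0 (of_real (- \<epsilon> / 16))"
    unfolding G3_eq rational_map_def fst_conv snd_conv
    by (rule has_jet2_divide[OF G3_jets(2) G3_jets(4) nz']) (use assms in auto)
  show "has_jet2 (\<lambda>p. snd (snd (G3 \<epsilon> s p))) 0 0 1 0 0 0"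
    unfolding G3_eq rational_map_def snd_conv
    by (rule has_jet2_divide[OF G3_jets(3) G3_jets(4) nz']) (use assms in auto)
qed

text \<open>At this parameter the numerators and the denominator of \<open>G3\<close> acquire a common factor.\<close>

lemma G2_eq_G3: "germ_of (G2 (- 1) (1/2)) = germ_of (G3 (- 1) (1/2))"
proof (subst germ_of_eq_iff)
  have e: "(- 1 :: real) = 1 \<or> (- 1 :: real) = - 1" by simp
  show "G2 (- 1) (1/2) 0 = 0" "isCont (G2 (- 1) (1/2)) 0" "G3 (- 1) (1/2) 0 = 0" "isCont (G3 (- 1) (1/2)) 0"
    using normal_map_G2[OF e, of "1/2"] normal_map_G3[OF e, of "1/2"] unfolding normal_map_def by blast+
  have n2: "G2_q (- 1) (1/2) 0 0 \<noteq> 0" and n3: "G3_q (- 1) (1/2) 0 0 \<noteq> 0" by (simp_all add: G_at_0)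
  note ev = rational_map_regular(3)[OF poly_family_G(1-4)[of "-1"] n2 G_at_0(1-3)]
    rational_map_regular(3)[OF poly_family_G(5-8)[of "-1"] n3 G_at_0(5-7)]
  have "G2_p1 (- 1) (1/2) z w * G3_q (- 1) (1/2) z w = G3_p1 (- 1) (1/2) z w * G2_q (- 1) (1/2) z w"
    "G2_p2 (- 1) (1/2) z w * G3_q (- 1) (1/2) z w = G3_p2 (- 1) (1/2) z w * G2_q (- 1) (1/2) z w"
    "G2_p3 (- 1) (1/2) z w * G3_q (- 1) (1/2) z w = G3_p3 (- 1) (1/2) z w * G2_q (- 1) (1/2) z w" for z w
    unfolding G2_p1_def G2_p2_def G2_p3_def G2_q_def G3_p1_def G3_p2_def G3_p3_def G3_q_def
    by (simp_all add: field_simps power2_eq_square power3_eq_cube)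
  then show "\<forall>\<^sub>F x in nhds 0. G2 (- 1) (1/2) x = G3 (- 1) (1/2) x"
    using eventually_conj[OF ev]
    by (elim eventually_mono) (simp add: G2_eq G3_eq rational_map_def frac_eq_eq)
qed

section \<open>Orbit invariants in the 2-jet\<close>

text \<open>For maps with \<open>g\<^sub>z = g\<^sub>z\<^sub>z = 0\<close> and \<open>g\<^sub>w \<noteq> 0\<close> at the origin this is, up to the factor \<open>g\<^sub>w\<close>, the determinant
  of the frame \<open>H\<^sub>z, H\<^sub>z\<^sub>z, H\<^sub>w\<close>.  The next three functions are the coordinates in this frame of the
  derivative of order \<open>(i, j)\<close>.\<close>

definition frame_det :: "(C2, C3) germ \<Rightarrow> complex" where
  "frame_det H = pd_f1 1 0 H * pd_f2 2 0 H - pd_f2 1 0 H * pd_f1 2 0 H"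

definition coord_w :: "nat \<Rightarrow> nat \<Rightarrow> (C2, C3) germ \<Rightarrow> complex" where
  "coord_w i j H = pd_g i j H / pd_g 0 1 H"

definition coord_z :: "nat \<Rightarrow> nat \<Rightarrow> (C2, C3) germ \<Rightarrow> complex" where
  "coord_z i j H = ((pd_f1 i j H - coord_w i j H * pd_f1 0 1 H) * pd_f2 2 0 H
     - (pd_f2 i j H - coord_w i j H * pd_f2 0 1 H) * pd_f1 2 0 H) / frame_det H"

definition coord_zz :: "nat \<Rightarrow> nat \<Rightarrow> (C2, C3) germ \<Rightarrow> complex" where
  "coord_zz i j H = (pd_f1 1 0 H * (pd_f2 i j H - coord_w i j H * pd_f2 0 1 H)
     - pd_f2 1 0 H * (pd_f1 i j H - coord_w i j H * pd_f1 0 1 H)) / frame_det H"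

text \<open>The three quantities below are built from combinations of frame coordinates that do not change when
  the lift \<open>(1, f\<^sub>1, f\<^sub>2, g)\<close> is multiplied by a scalar function.  If \<open>l, u, c, r\<close> are the parameters of the
  source isotropy and \<open>a, b\<close> the coefficients of the normal form, these combinations are
  \<open>coord_zz 1 1 = c\<close>, \<open>coord_zz 0 2 = b l\<^sup>2 (cnj u)\<^sup>2 + c\<^sup>2\<close> and the sums in the definitions of \<open>inv_L\<close> and \<open>inv_Q\<close>.
  Eliminating \<open>c\<close> leaves \<open>inv_L = l\<^sup>2\<close>, \<open>inv_P = b l\<^sup>2 (cnj u)\<^sup>2\<close> and \<open>inv_Q = 2 a l\<^sup>3 cnj u\<close>.  The factor
  \<open>- 2 \<i> \<epsilon>\<close> is \<open>2 / (\<i> \<epsilon>)\<close>, as \<open>\<epsilon>\<^sup>2 = 1\<close>.\<close>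

definition inv_L :: "real \<Rightarrow> (C2, C3) germ \<Rightarrow> complex" where
  "inv_L \<epsilon> H = - 2 * \<i> * of_real \<epsilon> * (coord_z 1 1 H - coord_w 0 2 H / 2 + 2 * coord_w 1 1 H * coord_zz 1 1 H)"

definition inv_P :: "(C2, C3) germ \<Rightarrow> complex" where
  "inv_P H = coord_zz 0 2 H - (coord_zz 1 1 H)\<^sup>2"

definition inv_Q :: "real \<Rightarrow> (C2, C3) germ \<Rightarrow> complex" where
  "inv_Q \<epsilon> H = coord_z 0 2 H + 2 * coord_w 1 1 H * coord_zz 0 2 H - \<i> * of_real \<epsilon> * inv_L \<epsilon> H * coord_zz 1 1 H"

text \<open>Cramer's rule.\<close>

lemma frame_coordinates:
  assumes "pd_f1 i j H = x * pd_f1 1 0 H + y * pd_f1 2 0 H + q * pd_f1 0 1 H"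
    "pd_f2 i j H = x * pd_f2 1 0 H + y * pd_f2 2 0 H + q * pd_f2 0 1 H"
    "pd_g i j H = q * pd_g 0 1 H" "frame_det H \<noteq> 0" "pd_g 0 1 H \<noteq> 0"
  shows "coord_z i j H = x" "coord_zz i j H = y" "coord_w i j H = q"
proof -
  show q: "coord_w i j H = q" using assms(3,5) by (simp add: coord_w_def)
  have "coord_z i j H = x * frame_det H / frame_det H"
    unfolding coord_z_def q assms(1,2) by (simp add: frame_det_def algebra_simps)
  then show "coord_z i j H = x" using assms(4) by simp
  have "coord_zz i j H = y * frame_det H / frame_det H"
    unfolding coord_zz_def q assms(1,2) by (simp add: frame_det_def algebra_simps)
  then show "coord_zz i j H = y" using assms(4) by simp
qed

lemma regular_orbit_map:
  fixes l r l' r' :: real and c c1 c2 :: complex and F K :: "C2 \<Rightarrow> C3"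
  assumes F: "normal_map \<epsilon> a b F" and \<epsilon>: "\<epsilon> = 1 \<or> \<epsilon> = -1" and u: "cmod u = 1" and u': "cmod u' = 1"
    and a': "(cmod a1)\<^sup>2 + \<epsilon> * (cmod a2)\<^sup>2 = 1"
  defines "K \<equiv> sigma' \<epsilon> l' r' u' a1 a2 c1 c2 \<circ> F \<circ> sigma l r u c"
  shows "K 0 = 0" "isCont K 0" "holomorphic_germ (germ_of K)"
    "maps_into (germ_of K) hyperquadric2 (hyperquadric3 \<epsilon>)"
    "\<forall>\<^sub>F p in nhds 0. holo_at (\<lambda>x. fst (K x)) p \<and> holo_at (\<lambda>x. fst (snd (K x))) p \<and> holo_at (\<lambda>x. snd (snd (K x))) p"
proof -
  have F0: "F 0 = 0" "isCont F 0" and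
    hF: "\<forall>\<^sub>F p in nhds 0. holo_at (\<lambda>x. fst (F x)) p \<and> holo_at (\<lambda>x. fst (snd (F x))) p \<and> holo_at (\<lambda>x. snd (snd (F x))) p"
    and qF: "\<forall>\<^sub>F p in nhds 0. p \<in> hyperquadric2 \<longrightarrow> F p \<in> hyperquadric3 \<epsilon>"
    using F unfolding normal_map_def by blast+
  let ?s = "sigma l r u c" and ?s' = "sigma' \<epsilon> l' r' u' a1 a2 c1 c2"
  have Fs: "(F \<circ> ?s) 0 = 0" "isCont (F \<circ> ?s) 0"
    using F0 sigma_at_0[of l r u c] by (auto intro!: continuous_at_compose)
  show K0: "K 0 = 0" unfolding K_def using Fs(1) by (simp add: sigma'_at_0)
  have "isCont (?s' \<circ> (F \<circ> ?s)) 0"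
    by (rule continuous_at_compose[OF Fs(2)]) (use Fs(1) sigma'_at_0 in simp)
  then show Kc: "isCont K 0" unfolding K_def by (simp add: comp_assoc)
  have lim_s: "filterlim ?s (nhds 0) (nhds 0)" by (rule isCont_0_filterlim[OF sigma_at_0(2,1)])
  have lim_Fs: "filterlim (F \<circ> ?s) (nhds 0) (nhds 0)" by (rule isCont_0_filterlim[OF Fs(2,1)])
  note ev = sigma_den_eventually[of r c] eventually_compose_filterlim[OF hF lim_s]
    eventually_compose_filterlim[OF qF lim_s]
    eventually_compose_filterlim[OF sigma'_den_eventually[of \<epsilon> r' c1 c2] lim_Fs]
  show hK: "\<forall>\<^sub>F p in nhds 0. holo_at (\<lambda>x. fst (K x)) p \<and> holo_at (\<lambda>x. fst (snd (K x))) p \<and> holo_at (\<lambda>x. snd (snd (K x))) p"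
    using ev(1,2,4)
  proof eventually_elim
    case (elim p)
    have s: "?s x = (fst (?s x), snd (?s x))" for x by simp
    have c: "holo_at (\<lambda>x. f (F (?s x))) p" if "holo_at (\<lambda>x. f (F x)) (?s p)" for f :: "C3 \<Rightarrow> complex"
      using holo_at_compose[of "\<lambda>x. f (F x)" "\<lambda>x. fst (?s x)" p "\<lambda>x. snd (?s x)"] that
        holo_at_sigma[OF elim(1), of l u] by simp
    show ?case
      unfolding K_def o_apply using elim by (intro conjI holo_at_sigma' c) auto
  qed
  have "\<forall>\<^sub>F p in nhds 0. p \<in> hyperquadric2 \<longrightarrow> K p \<in> hyperquadric3 \<epsilon>"
    using ev(1,3,4)
  proof eventually_elim
    case (elim p)
    then show ?case
      unfolding K_def o_apply using sigma_preserves_quadric[of p r c u l] u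
      by (auto intro!: sigma'_preserves_quadric[OF _ _ u' a' \<epsilon>])
  qed
  with hK show "holomorphic_germ (germ_of K)" "maps_into (germ_of K) hyperquadric2 (hyperquadric3 \<epsilon>)"
    using K0 Kc by (simp_all add: holomorphic_germ_germ_of maps_into_germ_of)
qed

text \<open>Dividing a component with coefficients \<open>x1, \<dots>, x5\<close> (of \<open>z, w, z\<^sup>2, z w, w\<^sup>2\<close>) by \<open>1 + \<alpha> z + \<beta> w + \<dots>\<close> transforms
  its coordinates in the frame by a rule that is the same for all components and involves only \<open>\<alpha>\<close> and \<open>\<beta>\<close>.\<close>

lemma projective_frame_relation:
  fixes x1 x2 x3 x4 x5 X1 X2 Y1 Y2 q1 q2 :: complex
  assumes "x4 = X1 * x1 + Y1 * (2 * x3) + q1 * x2" "2 * x5 = X2 * x1 + Y2 * (2 * x3) + q2 * x2"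
  shows "x4 - x1 * \<beta> - x2 * \<alpha> = (X1 - \<beta> + 2 * \<alpha> * Y1) * x1 + Y1 * (2 * (x3 - x1 * \<alpha>)) + (q1 - \<alpha>) * x2"
    "2 * (x5 - x2 * \<beta>) = (X2 + 2 * \<alpha> * Y2) * x1 + Y2 * (2 * (x3 - x1 * \<alpha>)) + (q2 - 2 * \<beta>) * x2"
proof -
  show "x4 - x1 * \<beta> - x2 * \<alpha> = (X1 - \<beta> + 2 * \<alpha> * Y1) * x1 + Y1 * (2 * (x3 - x1 * \<alpha>)) + (q1 - \<alpha>) * x2"
    using assms(1) by algebra
  show "2 * (x5 - x2 * \<beta>) = (X2 + 2 * \<alpha> * Y2) * x1 + Y2 * (2 * (x3 - x1 * \<alpha>)) + (q2 - 2 * \<beta>) * x2"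
    using assms(2) by algebra
qed

text \<open>The relations that express \<open>H\<^sub>z\<^sub>w\<close> and \<open>H\<^sub>w\<^sub>w\<close> in the frame hold for the components of \<open>F \<circ> sigma\<close>, hence for all
  linear combinations of them, and by \<open>projective_frame_relation\<close> they survive the division by the
  denominator of the target isotropy.  So only the frame coordinates of \<open>F \<circ> sigma\<close> have to be computed.\<close>

lemma invariants_of_orbit_map:
  fixes l r l' r' :: real and c c1 c2 :: complex and F :: "C2 \<Rightarrow> C3" and H :: "(C2, C3) germ"
  assumes F: "normal_map \<epsilon> a b F" and \<epsilon>: "\<epsilon> = 1 \<or> \<epsilon> = -1" and u: "cmod u = 1" and u': "cmod u' = 1"
    and a': "(cmod a1)\<^sup>2 + \<epsilon> * (cmod a2)\<^sup>2 = 1" and l: "l > 0" and l': "l' > 0"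
  defines "H \<equiv> germ_of (sigma' \<epsilon> l' r' u' a1 a2 c1 c2 \<circ> F \<circ> sigma l r u c)"
  shows "H \<in> class_F \<epsilon>" "frame_det H \<noteq> 0" "pd_g 0 1 H \<noteq> 0" "inv_L \<epsilon> H = of_real (l\<^sup>2)"
    "inv_P H = b * of_real (l\<^sup>2) * (cnj u)\<^sup>2" "inv_Q \<epsilon> H = 2 * a * of_real (l ^ 3) * cnj u"
proof -
  define K where "K = sigma' \<epsilon> l' r' u' a1 a2 c1 c2 \<circ> F \<circ> sigma l r u c"
  note reg = regular_orbit_map[OF F \<epsilon> u u' a', of l' r' c1 c2 l r c, folded K_def]
  have H: "H = germ_of K" by (simp add: H_def K_def)
  define e L L' where "e = complex_of_real \<epsilon>" "L = complex_of_real l" "L' = complex_of_real l'"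
  define \<rho> where "\<rho> = of_real r - \<i> * of_real ((cmod c)\<^sup>2)"
  have ee: "e * e = 1" using \<epsilon> by (auto simp: e_L_L'_def)
  have uu: "u * cnj u = 1" using u cnj_mult_unit by simp
  have L: "L \<noteq> 0" "L' \<noteq> 0" using l l' by (auto simp: e_L_L'_def)
  have aa: "a1 * cnj a1 + e * (a2 * cnj a2) = 1"
    unfolding e_L_L'_def by (rule norm_form_cancel[OF a'])
  have jF: "has_jet2 (\<lambda>p. fst (F p)) 0 1 0 0 (\<i> * e / 2) a"
    "has_jet2 (\<lambda>p. fst (snd (F p))) 0 0 0 1 0 b" "has_jet2 (\<lambda>p. snd (snd (F p))) 0 0 1 0 0 0"
    using F unfolding normal_map_def e_L_L'_def by blast+
  have js: "has_jet2 (\<lambda>p. fst (sigma l r u c p)) 0 (L * u) (L * u * c) (2 * \<i> * cnj c * L * u)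
      (- L * u * \<rho> + 2 * \<i> * cnj c * L * u * c) (- L * u * c * \<rho>)"
    "has_jet2 (\<lambda>p. snd (sigma l r u c p)) 0 0 (L\<^sup>2) 0 (2 * \<i> * cnj c * L\<^sup>2) (- L\<^sup>2 * \<rho>)"
    using sigma_jets[of l r u c] unfolding e_L_L'_def \<rho>_def by simp_all
  \<comment> \<open>Coefficients of \<open>z, w, z\<^sup>2, z w, w\<^sup>2\<close> in the components of \<open>F \<circ> sigma\<close>; the missing ones vanish.\<close>
  define x1 x2 x3 x4 x5 where "x1 = L * u" "x2 = L * u * c" "x3 = 2 * \<i> * cnj c * L * u"
    "x4 = - L * u * \<rho> + 2 * \<i> * cnj c * L * u * c + \<i> * e * L ^ 3 * u / 2"
    "x5 = - L * u * c * \<rho> + \<i> * e * L ^ 3 * u * c / 2 + a * L ^ 4"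
  define y3 y4 y5 where "y3 = L\<^sup>2 * u\<^sup>2" "y4 = 2 * L\<^sup>2 * u\<^sup>2 * c" "y5 = L\<^sup>2 * u\<^sup>2 * c\<^sup>2 + b * L ^ 4"
  define g2 g4 g5 where "g2 = L\<^sup>2" "g4 = 2 * \<i> * cnj c * L\<^sup>2" "g5 = - L\<^sup>2 * \<rho>"
  define f1 f2 g where "f1 = (\<lambda>p. fst (F (fst (sigma l r u c p), snd (sigma l r u c p))))"
    "f2 = (\<lambda>p. fst (snd (F (fst (sigma l r u c p), snd (sigma l r u c p)))))"
    "g = (\<lambda>p. snd (snd (F (fst (sigma l r u c p), snd (sigma l r u c p)))))"
  have j1: "has_jet2 f1 0 x1 x2 x3 x4 x5"
    unfolding f1_f2_g_def x1_x2_x3_x4_x5_def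
    by (rule has_jet2_eqI[OF has_jet2_compose[OF jF(1) js]]) (simp_all add: field_simps power2_eq_square power3_eq_cube power4_eq_xxxx)
  have j2: "has_jet2 f2 0 0 0 y3 y4 y5"
    unfolding f1_f2_g_def y3_y4_y5_def
    by (rule has_jet2_eqI[OF has_jet2_compose[OF jF(2) js]]) (simp_all add: field_simps power2_eq_square power3_eq_cube power4_eq_xxxx)
  have j3: "has_jet2 g 0 0 g2 0 g4 g5"
    unfolding f1_f2_g_def g2_g4_g5_def
    by (rule has_jet2_eqI[OF has_jet2_compose[OF jF(3) js]]) (simp_all add: field_simps power2_eq_square power3_eq_cube power4_eq_xxxx)
  define m3 where "m3 = of_real r' - \<i> * of_real ((cmod c1)\<^sup>2 + \<epsilon> * (cmod c2)\<^sup>2)"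
  \<comment> \<open>The denominator of the target isotropy.  Its linear coefficients \<open>\<alpha>\<close>, \<open>\<beta>\<close> cancel in the end.\<close>
  define q where "q = (\<lambda>p. 1 + (- 2 * \<i> * cnj c1 * f1 p + - 2 * \<i> * e * cnj c2 * f2 p + m3 * g p))"
  obtain \<alpha> \<beta> q3 q4 q5 where jq: "has_jet2 q 1 \<alpha> \<beta> q3 q4 q5"
    using has_jet2_linear_combination[OF j1 j2 j3, of 1 "- 2 * \<i> * cnj c1" "- 2 * \<i> * e * cnj c2" m3]
    unfolding q_def by blast
  \<comment> \<open>Coefficients of the linear forms in the numerators of the target isotropy.\<close>
  define k1 k2 k3 where "k1 = L' * u' * a1" "k2 = - L' * e * u' * a2" "k3 = L' * u' * a1 * c1 - L' * e * u' * a2 * c2"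
  define n1 n2 n3 where "n1 = L' * cnj a2" "n2 = L' * cnj a1" "n3 = L' * cnj a2 * c1 + L' * cnj a1 * c2"
  have q': "sigma'_den \<epsilon> r' c1 c2 (F (sigma l r u c p)) = q p" for p
    unfolding sigma'_den_def q_def m3_def f1_f2_g_def e_L_L'_def by (simp add: algebra_simps)
  have K1: "(\<lambda>p. fst (K p)) = (\<lambda>p. (0 + (k1 * f1 p + k2 * f2 p + k3 * g p)) / q p)"
    unfolding K_def o_apply sigma'_eq q' fst_conv k1_k2_k3_def f1_f2_g_def e_L_L'_def by (simp add: algebra_simps)
  have K2: "(\<lambda>p. fst (snd (K p))) = (\<lambda>p. (0 + (n1 * f1 p + n2 * f2 p + n3 * g p)) / q p)"
    unfolding K_def o_apply sigma'_eq q' fst_conv snd_conv n1_n2_n3_def f1_f2_g_def e_L_L'_def by (simp add: algebra_simps)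
  have K3: "(\<lambda>p. snd (snd (K p))) = (\<lambda>p. (0 + (0 * f1 p + 0 * f2 p + L'\<^sup>2 * g p)) / q p)"
    unfolding K_def o_apply sigma'_eq q' snd_conv f1_f2_g_def e_L_L'_def by (simp add: algebra_simps)
  define M1 where "M1 = (\<lambda>x y g. k1 * x + k2 * y + k3 * (g::complex))"
  define M2 where "M2 = (\<lambda>x y g. n1 * x + n2 * y + n3 * (g::complex))"
  define M3 where "M3 = (\<lambda>x y g. 0 * x + 0 * y + L'\<^sup>2 * (g::complex))"
  note jets = has_jet2_normalized_quotient[OF has_jet2_linear_combination[OF j1 j2 j3, of 0] jq]
  have h1: "\<forall>\<^sub>F p in nhds 0. holo_at (\<lambda>x. fst (K x)) p"
    and h2: "\<forall>\<^sub>F p in nhds 0. holo_at (\<lambda>x. fst (snd (K x))) p"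
    and h3: "\<forall>\<^sub>F p in nhds 0. holo_at (\<lambda>x. snd (snd (K x))) p"
    using reg(5) by (auto elim: eventually_mono)
  note pds = germ_pd_germ_of[OF reg(1,2)]
  have A: "pd_f1 1 0 H = M1 x1 0 0" "pd_f1 0 1 H = M1 x2 0 g2" "pd_f1 2 0 H = 2 * (M1 x3 y3 0 - M1 x1 0 0 * \<alpha>)"
    "pd_f1 1 1 H = M1 x4 y4 g4 - M1 x1 0 0 * \<beta> - M1 x2 0 g2 * \<alpha>" "pd_f1 0 2 H = 2 * (M1 x5 y5 g5 - M1 x2 0 g2 * \<beta>)"
    unfolding pd_f1_def H pds fst_conv M1_def by (rule pd_of_jet2[OF h1 jets[of k1 k2 k3, folded K1]])+
  have B: "pd_f2 1 0 H = M2 x1 0 0" "pd_f2 0 1 H = M2 x2 0 g2" "pd_f2 2 0 H = 2 * (M2 x3 y3 0 - M2 x1 0 0 * \<alpha>)"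
    "pd_f2 1 1 H = M2 x4 y4 g4 - M2 x1 0 0 * \<beta> - M2 x2 0 g2 * \<alpha>" "pd_f2 0 2 H = 2 * (M2 x5 y5 g5 - M2 x2 0 g2 * \<beta>)"
    unfolding pd_f2_def H pds fst_conv snd_conv M2_def by (rule pd_of_jet2[OF h2 jets[of n1 n2 n3, folded K2]])+
  have C: "pd_g 1 0 H = M3 x1 0 0" "pd_g 0 1 H = M3 x2 0 g2" "pd_g 2 0 H = 2 * (M3 x3 y3 0 - M3 x1 0 0 * \<alpha>)"
    "pd_g 1 1 H = M3 x4 y4 g4 - M3 x1 0 0 * \<beta> - M3 x2 0 g2 * \<alpha>" "pd_g 0 2 H = 2 * (M3 x5 y5 g5 - M3 x2 0 g2 * \<beta>)"
    unfolding pd_g_def H pds snd_conv M3_def by (rule pd_of_jet2[OF h3 jets[of 0 0 "L'\<^sup>2", folded K3]])+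
  have det: "frame_det H = L'\<^sup>2 * u' * (2 * (L ^ 3 * u ^ 3))"
  proof -
    have "k1 * n2 - k2 * n1 = L'\<^sup>2 * u'"
      unfolding k1_k2_k3_def n1_n2_n3_def using aa by algebra
    moreover have "frame_det H = (k1 * n2 - k2 * n1) * (2 * (x1 * y3))"
      unfolding frame_det_def A B M1_def M2_def by algebra
    moreover have "x1 * y3 = L ^ 3 * u ^ 3"
      unfolding x1_x2_x3_x4_x5_def y3_y4_y5_def by algebra
    ultimately show ?thesis by simp
  qed
  have "u \<noteq> 0" "u' \<noteq> 0" using u u' by auto
  then show D: "frame_det H \<noteq> 0" using det L by simp
  have gw: "pd_g 0 1 H = of_real (l'\<^sup>2 * l\<^sup>2)"
    unfolding C M3_def g2_g4_g5_def e_L_L'_def by simp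
  then show G: "pd_g 0 1 H \<noteq> 0" using l l' by simp
  show "H \<in> class_F \<epsilon>"
    using reg(3,4) D gw l l' unfolding class_F_def frame_det_def H by simp
  \<comment> \<open>Coordinates of \<open>L\<^sub>z\<^sub>w\<close> and \<open>L\<^sub>w\<^sub>w\<close> in the frame \<open>L\<^sub>z, L\<^sub>z\<^sub>z, L\<^sub>w\<close>, modulo \<open>L\<close>, for the lift of \<open>F \<circ> sigma\<close>.\<close>
  define X1 Y1 r1 where "X1 = \<i> * e * L\<^sup>2 / 2 - \<rho> - 4 * \<i> * c * cnj c" "Y1 = c" "r1 = 2 * \<i> * cnj c"
  define Y2 where "Y2 = b * L\<^sup>2 * (cnj u)\<^sup>2 + c\<^sup>2"
  define X2 r2 where "X2 = 2 * a * L ^ 3 * cnj u + \<i> * e * L\<^sup>2 * c - 4 * \<i> * cnj c * Y2" "r2 = - 2 * \<rho>"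
  have rx: "x4 = X1 * x1 + Y1 * (2 * x3) + r1 * x2"
    unfolding x1_x2_x3_x4_x5_def X1_Y1_r1_def by (simp add: field_simps power2_eq_square power3_eq_cube)
  have "L ^ 4 = L * (L * (L * (L * (u * cnj u))))"
    using uu by algebra
  then have rx': "2 * x5 = X2 * x1 + Y2 * (2 * x3) + r2 * x2"
    unfolding x1_x2_x3_x4_x5_def X2_r2_def by (simp add: field_simps power2_eq_square power3_eq_cube)
  have ry: "y4 = Y1 * (2 * y3)"
    unfolding y3_y4_y5_def X1_Y1_r1_def by algebra
  have ry': "2 * y5 = Y2 * (2 * y3)"
    unfolding y3_y4_y5_def Y2_def using uu by algebra
  have rg: "g4 = r1 * g2" "2 * g5 = r2 * g2"
    unfolding g2_g4_g5_def X1_Y1_r1_def X2_r2_def by simp_all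
  have rM: "M x4 y4 g4 = X1 * M x1 0 0 + Y1 * (2 * M x3 y3 0) + r1 * M x2 0 g2"
    if "\<And>x y g. M x y g = k * x + n * y + m * g" for M and k n m :: complex
    unfolding that using rx ry rg(1) by algebra
  have rM': "2 * M x5 y5 g5 = X2 * M x1 0 0 + Y2 * (2 * M x3 y3 0) + r2 * M x2 0 g2"
    if "\<And>x y g. M x y g = k * x + n * y + m * g" for M and k n m :: complex
    unfolding that using rx' ry' rg(2) by algebra
  have M1: "M1 x y g = k1 * x + k2 * y + k3 * g" and M2: "M2 x y g = n1 * x + n2 * y + n3 * g" for x y g
    by (simp_all add: M1_def M2_def)
  note rK1 = projective_frame_relation[OF rM[OF M1] rM'[OF M1], of \<beta> \<alpha>]
  note rK2 = projective_frame_relation[OF rM[OF M2] rM'[OF M2], of \<beta> \<alpha>]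
  have gg: "pd_g 1 1 H = (r1 - \<alpha>) * pd_g 0 1 H" "pd_g 0 2 H = (r2 - 2 * \<beta>) * pd_g 0 1 H"
    unfolding C M3_def using rg by (simp_all add: algebra_simps)
  have c11: "coord_z 1 1 H = X1 - \<beta> + 2 * \<alpha> * Y1" "coord_zz 1 1 H = Y1" "coord_w 1 1 H = r1 - \<alpha>"
    by (rule frame_coordinates[OF _ _ gg(1) D G]; use rK1(1) rK2(1) in \<open>simp only: A B\<close>)+
  have c02: "coord_z 0 2 H = X2 + 2 * \<alpha> * Y2" "coord_zz 0 2 H = Y2" "coord_w 0 2 H = r2 - 2 * \<beta>"
    by (rule frame_coordinates[OF _ _ gg(2) D G]; use rK1(2) rK2(2) in \<open>simp only: A B\<close>)+
  have L2: "inv_L \<epsilon> H = L\<^sup>2"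
  proof -
    have "inv_L \<epsilon> H = - 2 * \<i> * e * (\<i> * e * L\<^sup>2 / 2)"
      unfolding inv_L_def c11 c02 X1_Y1_r1_def X2_r2_def e_L_L'_def by (simp add: field_simps)
    also have "\<dots> = (- (\<i> * \<i>)) * (e * e) * L\<^sup>2" by (simp add: field_simps)
    finally show ?thesis by (simp add: ee)
  qed
  then show "inv_L \<epsilon> H = of_real (l\<^sup>2)" by (simp add: e_L_L'_def)
  show "inv_P H = b * of_real (l\<^sup>2) * (cnj u)\<^sup>2"
    unfolding inv_P_def c11 c02 Y2_def X1_Y1_r1_def e_L_L'_def by simp
  show "inv_Q \<epsilon> H = 2 * a * of_real (l ^ 3) * cnj u"
    unfolding inv_Q_def c11 c02 L2 X1_Y1_r1_def X2_r2_def e_L_L'_def by (simp add: algebra_simps)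
qed

section \<open>Inverses in the isotropy group\<close>

lemma germ_of_left_inverse:
  assumes "f 0 = 0" "isCont f 0" "g 0 = 0" "isCont g 0" "\<forall>\<^sub>F x in nhds 0. g (f x) = x"
  shows "germ_of g \<circ>\<^sub>g germ_of f = germ_id"
proof -
  have "isCont (g \<circ> f) 0" using assms by (intro continuous_at_compose) simp_all
  then have "germ_of (g \<circ> f) = germ_of (\<lambda>x. x)"
    using assms by (subst germ_of_eq_iff) simp_all
  then show ?thesis using assms by (simp add: germ_comp_germ_of germ_id_eq)
qed

lemma germ_sigma_left_inverse:
  assumes "l > 0" "cmod u = 1"
  shows "germ_of (sigma (1 / l) (- r / l\<^sup>2) (cnj u) (- u * c / of_real l)) \<circ>\<^sub>g germ_of (sigma l r u c) = germ_id"
  using sigma_den_eventually[of r c]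
  by (intro germ_of_left_inverse sigma_at_0) (elim eventually_mono, rule sigma_cancel[OF assms])

lemma germ_inv_sigma:
  assumes "l > 0" "cmod u = 1"
  shows "germ_inv (germ_of (sigma l r u c)) = germ_of (sigma (1 / l) (- r / l\<^sup>2) (cnj u) (- u * c / of_real l))"
proof (rule germ_inv_eqI[OF germ_sigma_left_inverse[OF assms]])
  have u: "cnj u * (u * x) = x" for x
    using cnj_mult_unit(1)[OF assms(2)] by (simp flip: mult.assoc)
  have inverse_inverse: "1 / (1 / l) = l" "- (- r / l\<^sup>2) / (1 / l)\<^sup>2 = r" "cnj (cnj u) = u"
    "- cnj u * (- u * c / of_real l) / of_real (1 / l) = c"
    using assms u by (simp_all add: field_simps)
  have "1 / l > 0" "cmod (cnj u) = 1" using assms by simp_all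
  from germ_sigma_left_inverse[OF this, of "- r / l\<^sup>2" "- u * c / of_real l", unfolded inverse_inverse]
  show "germ_of (sigma l r u c) \<circ>\<^sub>g germ_of (sigma (1 / l) (- r / l\<^sup>2) (cnj u) (- u * c / of_real l)) = germ_id" .
qed

lemma isotropies2_inverse:
  assumes "\<phi> \<in> isotropies2"
  shows "germ_inv \<phi> \<in> isotropies2" "germ_inv \<phi> \<circ>\<^sub>g \<phi> = germ_id"
proof -
  obtain l r u c where \<phi>: "\<phi> = germ_of (sigma l r u c)" "l > 0" "cmod u = 1"
    using assms unfolding isotropies2_def by blast
  have "1 / l > 0" "cmod (cnj u) = 1" using \<phi> by simp_all
  then show "germ_inv \<phi> \<in> isotropies2"
    unfolding \<phi>(1) germ_inv_sigma[OF \<phi>(2,3)] isotropies2_def by blast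
  show "germ_inv \<phi> \<circ>\<^sub>g \<phi> = germ_id"
    unfolding \<phi>(1) germ_inv_sigma[OF \<phi>(2,3)] by (rule germ_sigma_left_inverse[OF \<phi>(2,3)])
qed

lemma germ_inv_germ_inv:
  assumes "\<phi> \<in> isotropies2"
  shows "germ_inv (germ_inv \<phi>) = \<phi>"
proof (rule germ_inv_eqI)
  note i = isotropies2_inverse[OF assms]
  show "germ_inv \<phi> \<circ>\<^sub>g \<phi> = germ_id" by (rule i)
  have "germ_inv (germ_inv \<phi>) = germ_inv (germ_inv \<phi>) \<circ>\<^sub>g (germ_inv \<phi> \<circ>\<^sub>g \<phi>)"
    by (simp add: i germ_comp_id)
  also have "\<dots> = \<phi>"
    by (simp add: isotropies2_inverse(2)[OF i(1)] germ_comp_id flip: germ_comp_assoc)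
  finally show "\<phi> \<circ>\<^sub>g germ_inv \<phi> = germ_id"
    using isotropies2_inverse(2)[OF i(1)] by simp
qed

lemma isotropies3_left_inverse:
  assumes "\<phi> \<in> isotropies3 \<epsilon>" "\<epsilon> = 1 \<or> \<epsilon> = -1"
  shows "\<exists>\<psi> \<in> isotropies3 \<epsilon>. \<psi> \<circ>\<^sub>g \<phi> = germ_id"
proof -
  obtain l r u a1 a2 c1 c2 where \<phi>: "\<phi> = germ_of (sigma' \<epsilon> l r u a1 a2 c1 c2)" and
    p: "l > 0" "cmod u = 1" "(cmod a1)\<^sup>2 + \<epsilon> * (cmod a2)\<^sup>2 = 1"
    using assms(1) unfolding isotropies3_def by blast
  let ?\<psi> = "germ_of (sigma' \<epsilon> (1 / l) (- r / l\<^sup>2) (cnj u) (cnj a1) (- u * a2)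
     (- (u * a1 * c1 - of_real \<epsilon> * u * a2 * c2) / of_real l) (- (cnj a2 * c1 + cnj a1 * c2) / of_real l))"
  have "1 / l > 0" "cmod (cnj u) = 1" "(cmod (cnj a1))\<^sup>2 + \<epsilon> * (cmod (- u * a2))\<^sup>2 = 1"
    using p by (simp_all add: norm_mult)
  then have "?\<psi> \<in> isotropies3 \<epsilon>" unfolding isotropies3_def by blast
  moreover have "?\<psi> \<circ>\<^sub>g \<phi> = germ_id"
    unfolding \<phi> using sigma'_den_eventually[of \<epsilon> r c1 c2]
    by (intro germ_of_left_inverse sigma'_at_0) (elim eventually_mono, rule sigma'_cancel[OF p assms(2)])
  ultimately show ?thesis by blast
qed

text \<open>The isotropies of either quadric are closed under inversion.  Therefore orbits are symmetric:
  if \<open>K\<close> lies in the orbit of \<open>H\<close> then \<open>H\<close> lies in the orbit of \<open>K\<close>.\<close>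

lemma act_left_inverse:
  assumes "p \<in> isotropy_group \<epsilon>" "\<epsilon> = 1 \<or> \<epsilon> = -1"
  shows "\<exists>q \<in> isotropy_group \<epsilon>. \<forall>H. act q (act p H) = H"
proof -
  obtain \<phi> \<phi>' where p: "p = (\<phi>, \<phi>')" "\<phi> \<in> isotropies2" "\<phi>' \<in> isotropies3 \<epsilon>"
    using assms(1) unfolding isotropy_group_def by blast
  obtain \<psi> where \<psi>: "\<psi> \<in> isotropies3 \<epsilon>" "\<psi> \<circ>\<^sub>g \<phi>' = germ_id"
    using isotropies3_left_inverse[OF p(3) assms(2)] by blast
  note i = isotropies2_inverse[OF p(2)]
  have "act (germ_inv \<phi>, \<psi>) (act p H) = H" for H
  proof -
    have "act (germ_inv \<phi>, \<psi>) (act p H) = (\<psi> \<circ>\<^sub>g \<phi>') \<circ>\<^sub>g H \<circ>\<^sub>g (germ_inv \<phi> \<circ>\<^sub>g \<phi>)"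
      by (simp add: act_def p(1) germ_inv_germ_inv[OF p(2)] germ_comp_assoc)
    then show ?thesis by (simp add: \<psi>(2) i(2) germ_comp_id)
  qed
  moreover have "(germ_inv \<phi>, \<psi>) \<in> isotropy_group \<epsilon>"
    using i(1) \<psi>(1) by (simp add: isotropy_group_def)
  ultimately show ?thesis by blast
qed

lemma identity_in_isotropy_group: "(germ_id, germ_id) \<in> isotropy_group \<epsilon>" "act (germ_id, germ_id) H = H"
proof -
  have "germ_id = germ_of (sigma 1 0 1 0)"
    unfolding germ_id_eq by (rule arg_cong[of _ _ germ_of]) (simp add: sigma_eq sigma_den_def)
  then have 2: "germ_id \<in> isotropies2" unfolding isotropies2_def
    by (intro CollectI exI[of _ "1::real"] exI[of _ "0::real"] exI[of _ "1::complex"] exI[of _ "0::complex"]) simp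
  have "germ_id = germ_of (sigma' \<epsilon> 1 0 1 1 0 0 0)"
    unfolding germ_id_eq by (rule arg_cong[of _ _ germ_of]) (simp add: sigma'_eq sigma'_den_def)
  then have 3: "germ_id \<in> isotropies3 \<epsilon>" unfolding isotropies3_def
    by (intro CollectI exI[of _ "1::real"] exI[of _ "0::real"] exI[of _ "1::complex"] exI[of _ "0::complex"]) simp
  show "(germ_id, germ_id) \<in> isotropy_group \<epsilon>" using 2 3 by (simp add: isotropy_group_def)
  have "germ_inv (germ_id :: (C2, C2) germ) = germ_id" by (rule germ_inv_eqI) (simp_all add: germ_comp_id)
  then show "act (germ_id, germ_id) H = H" by (simp add: act_def germ_comp_id)
qed

section \<open>The invariants determine the normal form\<close>

text \<open>As \<open>inv_L = l\<^sup>2\<close> and \<open>inv_Q = 2 a l\<^sup>3 cnj u\<close> with \<open>a = s / 4\<close>, the absolute values give \<open>s\<close>, and the phase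
  of \<open>inv_Q\<close> removes the factor \<open>(cnj u)\<^sup>2\<close> from \<open>inv_P = b l\<^sup>2 (cnj u)\<^sup>2\<close>.\<close>

definition param_s :: "real \<Rightarrow> (C2, C3) germ \<Rightarrow> real" where
  "param_s \<epsilon> H = 2 * cmod (inv_Q \<epsilon> H) / sqrt (cmod (inv_L \<epsilon> H)) ^ 3"

definition param_b :: "real \<Rightarrow> (C2, C3) germ \<Rightarrow> real" where
  "param_b \<epsilon> H = Re (inv_P H * (cnj (inv_Q \<epsilon> H))\<^sup>2 / (of_real (cmod (inv_Q \<epsilon> H)))\<^sup>2 / inv_L \<epsilon> H)"

text \<open>The second component \<open>b\<close> only serves to tell the two families apart.\<close>

definition normal_form :: "real \<Rightarrow> real \<times> real \<Rightarrow> (C2, C3) germ" where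
  "normal_form \<epsilon> = (\<lambda>(s, b). if b = s\<^sup>2 / 4 then germ_of (G2 \<epsilon> s) else germ_of (G3 \<epsilon> s))"

text \<open>For a member of the family \<open>G3\<close> with \<open>b = s\<^sup>2 / 4\<close> the equation \<open>4 s\<^sup>2 = - \<epsilon>\<close> forces \<open>\<epsilon> = -1\<close> and \<open>s = 1/2\<close>,
  where the families coincide.\<close>

lemma normal_formsE:
  assumes "N \<in> normal_forms \<epsilon>" "\<epsilon> = 1 \<or> \<epsilon> = -1"
  obtains s b F where "s > 0" "N = germ_of F" "normal_map \<epsilon> (of_real s / 4) (of_real b) F"
    "N = normal_form \<epsilon> (s, b)" "b = s\<^sup>2 / 4 \<or> b = - \<epsilon> / 16"
proof -
  consider s where "s > 0" "N = germ_of (G2 \<epsilon> s)" | s where "s > 0" "N = germ_of (G3 \<epsilon> s)"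
    using assms(1) unfolding normal_forms_def by blast
  then show thesis
  proof cases
    case 1
    then show thesis
      using that[OF 1 normal_map_G2[OF assms(2)]] by (simp add: normal_form_def)
  next
    case 2
    have "N = normal_form \<epsilon> (s, - \<epsilon> / 16)"
    proof (cases "- \<epsilon> / 16 = s\<^sup>2 / 4")
      case True
      then have "4 * s\<^sup>2 = - \<epsilon>" by simp
      moreover have "s\<^sup>2 \<ge> 0" by simp
      ultimately have e: "\<epsilon> = -1" using assms(2) by linarith
      with \<open>4 * s\<^sup>2 = - \<epsilon>\<close> have "s\<^sup>2 = (1/2)\<^sup>2" by (simp add: power2_eq_square)
      then have s: "s = 1/2" using 2(1) by (simp add: power2_eq_iff_nonneg)
      have "N = germ_of (G2 \<epsilon> s)" unfolding 2(2) s e by (rule G2_eq_G3[symmetric])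
      then show ?thesis using True by (simp add: normal_form_def)
    next
      case False
      then show ?thesis using 2(2) by (simp add: normal_form_def)
    qed
    then show thesis
      using that[OF 2 normal_map_G3[OF assms(2)]] by simp
  qed
qed

lemma invariants_of_orbit:
  assumes "p \<in> isotropy_group \<epsilon>" "\<epsilon> = 1 \<or> \<epsilon> = -1" "s > 0"
    "normal_map \<epsilon> (of_real s / 4) (of_real b) F"
  defines "H \<equiv> act p (germ_of F)"
  shows "H \<in> class_F \<epsilon>" "frame_det H \<noteq> 0" "pd_g 0 1 H \<noteq> 0" "inv_L \<epsilon> H \<noteq> 0" "inv_Q \<epsilon> H \<noteq> 0"
    "param_s \<epsilon> H = s" "param_b \<epsilon> H = b"
proof -
  obtain l r u c l' r' u' a1 a2 c1 c2 where
    p: "p = (germ_of (sigma l r u c), germ_of (sigma' \<epsilon> l' r' u' a1 a2 c1 c2))"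
    "l > 0" "cmod u = 1" "l' > 0" "cmod u' = 1" "(cmod a1)\<^sup>2 + \<epsilon> * (cmod a2)\<^sup>2 = 1"
    using assms(1) unfolding isotropy_group_def isotropies2_def isotropies3_def by blast
  \<comment> \<open>\<open>act\<close> precomposes with the inverse of the source isotropy, whose parameters are \<open>1 / l\<close> and \<open>cnj u\<close>.\<close>
  define m where "m = 1 / l"
  define v where "v = cnj u"
  have m: "m > 0" "cmod v = 1" using p by (simp_all add: m_def v_def)
  have F0: "F 0 = 0" "isCont F 0" using assms(4) unfolding normal_map_def by blast+
  have H: "H = germ_of (sigma' \<epsilon> l' r' u' a1 a2 c1 c2 \<circ> F \<circ> sigma m (- r / l\<^sup>2) v (- u * c / of_real l))"
    unfolding H_def act_def p(1) prod.case germ_inv_sigma[OF p(2,3)] m_def v_def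
    using F0 by (simp add: germ_comp_germ_of sigma_at_0 sigma'_at_0 continuous_at_compose)
  note inv = invariants_of_orbit_map[OF assms(4,2) m(2) p(5,6) m(1) p(4),
      of r' c1 c2 "- r / l\<^sup>2" "- u * c / of_real l", folded H]
  show "H \<in> class_F \<epsilon>" "frame_det H \<noteq> 0" "pd_g 0 1 H \<noteq> 0" by (rule inv)+
  show "inv_L \<epsilon> H \<noteq> 0" using inv(4) m by simp
  have Q: "inv_Q \<epsilon> H = of_real (s / 2 * m ^ 3) * cnj v" using inv(6) by simp
  have nQ: "cmod (inv_Q \<epsilon> H) = s / 2 * m ^ 3"
    unfolding Q using m assms(3) by (simp add: norm_mult norm_power)
  then show "inv_Q \<epsilon> H \<noteq> 0" using m assms(3) by auto
  have sq: "sqrt (cmod (inv_L \<epsilon> H)) = m" using inv(4) m by (simp add: norm_power real_sqrt_abs)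
  show "param_s \<epsilon> H = s" unfolding param_s_def sq nQ using m by simp
  have vv: "v * cnj v = 1" using m cnj_mult_unit by simp
  have vv2: "(cnj v)\<^sup>2 * v\<^sup>2 = 1"
    using vv by (simp add: power_mult_distrib[symmetric] mult.commute)
  have "inv_P H * (cnj (inv_Q \<epsilon> H))\<^sup>2 / (of_real (cmod (inv_Q \<epsilon> H)))\<^sup>2 / inv_L \<epsilon> H
     = of_real b * ((cnj v)\<^sup>2 * v\<^sup>2)"
    unfolding nQ unfolding inv(4,5) Q using m assms(3) by (simp add: field_simps)
  then show "param_b \<epsilon> H = b" unfolding param_b_def vv2 by simp
qed

text \<open>If two normal forms lie in the orbit of \<open>act p N\<close>, then \<open>act p N\<close> lies in the orbit of each of them;
  the invariants of \<open>act p N\<close> are then those of both, and they determine a normal form.\<close>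

lemma normalization_act:
  assumes "N \<in> normal_forms \<epsilon>" "p \<in> isotropy_group \<epsilon>" "\<epsilon> = 1 \<or> \<epsilon> = -1"
  shows "normalization \<epsilon> (act p N) = N"
  unfolding normalization_def
proof (rule the_equality)
  let ?H = "act p N"
  obtain q where q: "q \<in> isotropy_group \<epsilon>" "act q ?H = N"
    using act_left_inverse[OF assms(2,3)] by blast
  then show "N \<in> normal_forms \<epsilon> \<and> N \<in> orbit_of \<epsilon> ?H"
    using assms(1) unfolding orbit_of_def by (auto intro!: image_eqI[of _ _ q])
  fix N' assume N': "N' \<in> normal_forms \<epsilon> \<and> N' \<in> orbit_of \<epsilon> ?H"
  then obtain p' where p': "p' \<in> isotropy_group \<epsilon>" "N' = act p' ?H"
    unfolding orbit_of_def by blast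
  obtain q' where q': "q' \<in> isotropy_group \<epsilon>" "act q' N' = ?H"
    using act_left_inverse[OF p'(1) assms(3)] p'(2) by blast
  obtain s b F where F: "s > 0" "N = germ_of F" "normal_map \<epsilon> (of_real s / 4) (of_real b) F"
    "N = normal_form \<epsilon> (s, b)" using normal_formsE[OF assms(1,3)] by metis
  obtain s' b' F' where F': "s' > 0" "N' = germ_of F'" "normal_map \<epsilon> (of_real s' / 4) (of_real b') F'"
    "N' = normal_form \<epsilon> (s', b')" using normal_formsE[OF conjunct1[OF N'] assms(3)] by metis
  have "param_s \<epsilon> ?H = s" "param_b \<epsilon> ?H = b"
    using invariants_of_orbit(6,7)[OF assms(2,3) F(1,3)] F(2) by simp_all
  moreover have "param_s \<epsilon> ?H = s'" "param_b \<epsilon> ?H = b'"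
    using invariants_of_orbit(6,7)[OF q'(1) assms(3) F'(1,3)] F'(2) q'(2) by simp_all
  ultimately show "N' = N" using F(4) F'(4) by simp
qed

text \<open>Two closed curves that contain all pairs \<open>(s, b)\<close> of normal forms.  With the
  restriction \<open>s \<ge> 0\<close> they have at most one common point, the one at which \<open>G2_eq_G3\<close> applies.\<close>

definition parameter_region :: "real \<Rightarrow> (real \<times> real) set" where
  "parameter_region \<epsilon> = {(s, b). s \<ge> 0 \<and> b = s\<^sup>2 / 4} \<union> {(s, b). s \<ge> 0 \<and> b = - \<epsilon> / 16}"

lemma frak_F_properties:
  assumes "H \<in> frak_F \<epsilon>" "\<epsilon> = 1 \<or> \<epsilon> = -1"
  shows "H \<in> class_F \<epsilon>" "frame_det H \<noteq> 0" "pd_g 0 1 H \<noteq> 0" "inv_L \<epsilon> H \<noteq> 0" "inv_Q \<epsilon> H \<noteq> 0"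
    "(param_s \<epsilon> H, param_b \<epsilon> H) \<in> parameter_region \<epsilon>"
    "normalization \<epsilon> H = normal_form \<epsilon> (param_s \<epsilon> H, param_b \<epsilon> H)"
    "normalization \<epsilon> H \<in> normal_forms \<epsilon>"
proof -
  obtain p N where H: "H = act p N" and N: "N \<in> normal_forms \<epsilon>" and p: "p \<in> isotropy_group \<epsilon>"
    using assms(1) unfolding frak_F_def by blast
  obtain s b F where F: "s > 0" "N = germ_of F" "normal_map \<epsilon> (of_real s / 4) (of_real b) F"
    "N = normal_form \<epsilon> (s, b)" "b = s\<^sup>2 / 4 \<or> b = - \<epsilon> / 16"
    using normal_formsE[OF N assms(2)] by metis
  note inv = invariants_of_orbit[OF p assms(2) F(1,3), folded F(2), folded H]
  show "H \<in> class_F \<epsilon>" "frame_det H \<noteq> 0" "pd_g 0 1 H \<noteq> 0" "inv_L \<epsilon> H \<noteq> 0" "inv_Q \<epsilon> H \<noteq> 0"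
    by (rule inv)+
  show "(param_s \<epsilon> H, param_b \<epsilon> H) \<in> parameter_region \<epsilon>"
    unfolding inv parameter_region_def using F(1,5) by auto
  have "normalization \<epsilon> H = N" unfolding H by (rule normalization_act[OF N p assms(2)])
  then show "normalization \<epsilon> H = normal_form \<epsilon> (param_s \<epsilon> H, param_b \<epsilon> H)"
    "normalization \<epsilon> H \<in> normal_forms \<epsilon>"
    using F(4) N by (simp_all add: inv)
qed

lemma normal_forms_in_frak_F:
  assumes "N \<in> normal_forms \<epsilon>" "\<epsilon> = 1 \<or> \<epsilon> = -1"
  shows "N \<in> frak_F \<epsilon>" "normalization \<epsilon> N = N"
proof -
  note id = identity_in_isotropy_group
  show "N \<in> frak_F \<epsilon>" unfolding frak_F_def
    using assms(1) id(1) id(2)[of N] by (intro CollectI exI[of _ "(germ_id, germ_id)"] exI[of _ N]) simp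
  show "normalization \<epsilon> N = N" using normalization_act[OF assms(1) id(1) assms(2)] id(2)[of N] by simp
qed

text \<open>On each of the two closed curves the jets depend continuously on \<open>s\<close>, and at a common point of the
  curves they agree, so the pasting lemma applies.\<close>

lemma continuous_pd_normal_form:
  assumes "\<epsilon> = 1 \<or> \<epsilon> = -1"
  shows "continuous_on (parameter_region \<epsilon>) (\<lambda>x. germ_pd i j (normal_form \<epsilon> x))"
proof -
  have G2: "germ_pd i j (germ_of (G2 \<epsilon> s)) =
     (pd i j (\<lambda>x. G2_p1 \<epsilon> s (fst x) (snd x) / G2_q \<epsilon> s (fst x) (snd x)),
      pd i j (\<lambda>x. G2_p2 \<epsilon> s (fst x) (snd x) / G2_q \<epsilon> s (fst x) (snd x)),
      pd i j (\<lambda>x. G2_p3 \<epsilon> s (fst x) (snd x) / G2_q \<epsilon> s (fst x) (snd x)))" for s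
    using normal_map_G2[OF assms, of s] unfolding normal_map_def
    by (subst germ_pd_germ_of) (simp_all add: G2_eq rational_map_def)
  have G3: "germ_pd i j (germ_of (G3 \<epsilon> s)) =
     (pd i j (\<lambda>x. G3_p1 \<epsilon> s (fst x) (snd x) / G3_q \<epsilon> s (fst x) (snd x)),
      pd i j (\<lambda>x. G3_p2 \<epsilon> s (fst x) (snd x) / G3_q \<epsilon> s (fst x) (snd x)),
      pd i j (\<lambda>x. G3_p3 \<epsilon> s (fst x) (snd x) / G3_q \<epsilon> s (fst x) (snd x)))" for s
    using normal_map_G3[OF assms, of s] unfolding normal_map_def
    by (subst germ_pd_germ_of) (simp_all add: G3_eq rational_map_def)
  have nz: "G2_q \<epsilon> s 0 0 \<noteq> 0" "G3_q \<epsilon> s 0 0 \<noteq> 0" for s using assms by (auto simp: G_at_0)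
  have c2: "continuous_on UNIV (\<lambda>s. germ_pd i j (germ_of (G2 \<epsilon> s)))"
    unfolding G2 by (intro continuous_on_Pair continuous_pd_rational_family poly_family_G nz)
  have c3: "continuous_on UNIV (\<lambda>s. germ_pd i j (germ_of (G3 \<epsilon> s)))"
    unfolding G3 by (intro continuous_on_Pair continuous_pd_rational_family poly_family_G nz)
  let ?S = "{(s, b). (s::real) \<ge> 0 \<and> b = s\<^sup>2 / 4}" and ?T = "{(s, b). (s::real) \<ge> 0 \<and> b = - \<epsilon> / 16}"
  have cl: "closed ?S" "closed ?T"
  proof -
    show "closed ?S" unfolding case_prod_unfold
      by (intro closed_Collect_conj closed_Collect_le closed_Collect_eq continuous_intros) simp
    show "closed ?T" unfolding case_prod_unfold
      by (intro closed_Collect_conj closed_Collect_le closed_Collect_eq continuous_intros)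
  qed
  have c2': "continuous_on ?S (\<lambda>x. germ_pd i j (germ_of (G2 \<epsilon> (fst x))))"
    and c3': "continuous_on ?T (\<lambda>x. germ_pd i j (germ_of (G3 \<epsilon> (fst x))))"
    by (intro continuous_on_compose2[OF c2] continuous_on_compose2[OF c3] continuous_intros; simp)+
  have agree: "germ_pd i j (germ_of (G2 \<epsilon> (fst x))) = germ_pd i j (germ_of (G3 \<epsilon> (fst x)))"
    if "x \<in> ?T" "snd x = (fst x)\<^sup>2 / 4" for x
  proof -
    have s: "fst x \<ge> 0" "4 * (fst x)\<^sup>2 = - \<epsilon>" using that by auto
    moreover have "(fst x)\<^sup>2 \<ge> 0" by simp
    ultimately have e: "\<epsilon> = -1" using assms by linarith
    with s have "(fst x)\<^sup>2 = (1/2)\<^sup>2" by (simp add: power2_eq_square)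
    then have x: "fst x = 1/2" using s(1) by (simp add: power2_eq_iff_nonneg)
    show ?thesis unfolding x e G2_eq_G3 ..
  qed
  have "continuous_on (?S \<union> ?T) (\<lambda>x. if snd x = (fst x)\<^sup>2 / 4 then germ_pd i j (germ_of (G2 \<epsilon> (fst x)))
      else germ_pd i j (germ_of (G3 \<epsilon> (fst x))))"
    using agree by (intro continuous_on_cases[OF cl c2' c3']) auto
  moreover have "(\<lambda>x. germ_pd i j (normal_form \<epsilon> x)) = (\<lambda>x. if snd x = (fst x)\<^sup>2 / 4 then germ_pd i j (germ_of (G2 \<epsilon> (fst x)))
      else germ_pd i j (germ_of (G3 \<epsilon> (fst x))))"
    by (auto simp: normal_form_def fun_eq_iff)
  ultimately show ?thesis unfolding parameter_region_def by (simp only:)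
qed

section \<open>Continuity of the normalization\<close>

lemma topspace_tau_J: "topspace (tau_J \<epsilon>) = class_F \<epsilon>"
proof -
  have "jet3 H \<in> topspace jet_vector_space" for H
    by (auto simp: jet_vector_space_def jet3_def)
  then show ?thesis
    unfolding tau_J_def topspace_pullback_topology jet_space_def topspace_subtopology
    by (auto simp: class_F_def)
qed

lemma topspace_tau_J_frak_F:
  assumes "\<epsilon> = 1 \<or> \<epsilon> = -1"
  shows "topspace (tau_J_frak_F \<epsilon>) = frak_F \<epsilon>"
  unfolding tau_J_frak_F_def topspace_subtopology topspace_tau_J using frak_F_properties(1)[OF _ assms] by blast

lemma continuous_map_jet3: "continuous_map (tau_J_frak_F \<epsilon>) jet_vector_space jet3"
proof -
  have "continuous_map (jet_space \<epsilon>) jet_vector_space id"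
    unfolding jet_space_def by (intro continuous_map_from_subtopology continuous_map_id)
  from continuous_map_pullback[OF this] have "continuous_map (tau_J \<epsilon>) jet_vector_space jet3"
    unfolding tau_J_def by simp
  then show ?thesis unfolding tau_J_frak_F_def by (rule continuous_map_from_subtopology)
qed

lemma continuous_map_germ_pd:
  assumes "i + j \<le> 3"
  shows "continuous_map (tau_J_frak_F \<epsilon>) euclidean (germ_pd i j)"
proof -
  have ij: "(i, j) \<in> multi_indices3" using assms by (simp add: multi_indices3_def)
  have "continuous_map jet_vector_space euclidean (\<lambda>x. x (i, j))"
    unfolding jet_vector_space_def using continuous_map_product_projection[OF ij] .
  from continuous_map_compose[OF continuous_map_jet3 this]
  have "continuous_map (tau_J_frak_F \<epsilon>) euclidean (\<lambda>H. jet3 H (i, j))" by (simp add: comp_def)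
  then show ?thesis using ij by (simp add: jet3_def)
qed

text \<open>The invariants arise from the 2-jet by field operations, conjugation, absolute values and a square root, and on
  \<^const>\<open>frak_F\<close> none of the denominators vanishes.\<close>

lemma tendsto_invariants:
  assumes "H \<in> frak_F \<epsilon>" "\<epsilon> = 1 \<or> \<epsilon> = -1"
  defines "X \<equiv> atin (tau_J_frak_F \<epsilon>) H"
  shows "((\<lambda>K. (param_s \<epsilon> K, param_b \<epsilon> K)) \<longlongrightarrow> (param_s \<epsilon> H, param_b \<epsilon> H)) X"
proof -
  note H = frak_F_properties(1-5)[OF assms(1,2)]
  have pd: "(germ_pd i j \<longlongrightarrow> germ_pd i j H) X" if "i + j \<le> 3" for i j
    using continuous_map_germ_pd[OF that, of \<epsilon>] assms(1) topspace_tau_J_frak_F[OF assms(2)]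
    unfolding continuous_map_atin X_def by simp
  have f1: "(pd_f1 i j \<longlongrightarrow> pd_f1 i j H) X" and f2: "(pd_f2 i j \<longlongrightarrow> pd_f2 i j H) X"
    and g: "(pd_g i j \<longlongrightarrow> pd_g i j H) X" if "i + j \<le> 3" for i j
    unfolding pd_f1_def[abs_def] pd_f2_def[abs_def] pd_g_def[abs_def]
    by (intro tendsto_fst tendsto_snd pd that)+
  have D: "(frame_det \<longlongrightarrow> frame_det H) X"
    unfolding frame_det_def[abs_def] by (intro tendsto_intros f1 f2) simp_all
  have w: "(coord_w i j \<longlongrightarrow> coord_w i j H) X" if "i + j \<le> 3" for i j
    unfolding coord_w_def[abs_def] by (intro tendsto_intros g that H) simp
  have z: "(coord_z i j \<longlongrightarrow> coord_z i j H) X" if "i + j \<le> 3" for i j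
    unfolding coord_z_def[abs_def] by (intro tendsto_intros f1 f2 w D that H) simp_all
  have zz: "(coord_zz i j \<longlongrightarrow> coord_zz i j H) X" if "i + j \<le> 3" for i j
    unfolding coord_zz_def[abs_def] by (intro tendsto_intros f1 f2 w D that H) simp_all
  have L: "(inv_L \<epsilon> \<longlongrightarrow> inv_L \<epsilon> H) X"
    unfolding inv_L_def[abs_def] by (intro tendsto_intros w z zz) simp_all
  have P: "(inv_P \<longlongrightarrow> inv_P H) X"
    unfolding inv_P_def[abs_def] by (intro tendsto_intros zz) simp_all
  have Q: "(inv_Q \<epsilon> \<longlongrightarrow> inv_Q \<epsilon> H) X"
    unfolding inv_Q_def[abs_def] by (intro tendsto_intros w z zz L) simp_all
  have s: "(param_s \<epsilon> \<longlongrightarrow> param_s \<epsilon> H) X"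
    unfolding param_s_def[abs_def] by (intro tendsto_intros L Q) (use H in simp)
  have b: "(param_b \<epsilon> \<longlongrightarrow> param_b \<epsilon> H) X"
    unfolding param_b_def[abs_def] by (intro tendsto_intros L P Q) (use H in simp_all)
  show ?thesis by (intro tendsto_Pair s b)
qed

lemma continuous_map_normalization:
  assumes "\<epsilon> = 1 \<or> \<epsilon> = -1"
  shows "continuous_map (tau_J_frak_F \<epsilon>) (tau_J_normal_forms \<epsilon>) (normalization \<epsilon>)"
proof -
  let ?X = "tau_J_frak_F \<epsilon>"
  have top: "topspace ?X = frak_F \<epsilon>" by (rule topspace_tau_J_frak_F[OF assms])
  have comp: "continuous_map ?X euclidean (\<lambda>H. germ_pd i j (normalization \<epsilon> H))" for i j
    unfolding continuous_map_atin limitin_canonical_iff top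
  proof
    fix H assume H: "H \<in> frak_F \<epsilon>"
    have ev: "\<forall>\<^sub>F K in atin ?X H. K \<in> frak_F \<epsilon>"
      unfolding eventually_atin using openin_topspace[of ?X] H by (auto simp: top intro!: exI[of _ "frak_F \<epsilon>"])
    have "((\<lambda>K. germ_pd i j (normal_form \<epsilon> (param_s \<epsilon> K, param_b \<epsilon> K)))
        \<longlongrightarrow> germ_pd i j (normal_form \<epsilon> (param_s \<epsilon> H, param_b \<epsilon> H))) (atin ?X H)"
      by (rule continuous_on_tendsto_compose[OF continuous_pd_normal_form[OF assms] tendsto_invariants[OF H assms]])
        (use frak_F_properties(6)[OF _ assms] H ev in \<open>auto elim: eventually_mono\<close>)
    moreover have "\<forall>\<^sub>F K in atin ?X H. germ_pd i j (normal_form \<epsilon> (param_s \<epsilon> K, param_b \<epsilon> K)) = germ_pd i j (normalization \<epsilon> K)"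
      using ev by eventually_elim (simp add: frak_F_properties(7)[OF _ assms])
    ultimately show "((\<lambda>K. germ_pd i j (normalization \<epsilon> K)) \<longlongrightarrow> germ_pd i j (normalization \<epsilon> H)) (atin ?X H)"
      unfolding frak_F_properties(7)[OF H assms] by (rule Lim_transform_eventually)
  qed
  have nf: "normalization \<epsilon> H \<in> normal_forms \<epsilon>" if "H \<in> frak_F \<epsilon>" for H
    by (rule frak_F_properties(8)[OF that assms])
  have cF: "normalization \<epsilon> H \<in> class_F \<epsilon>" if "H \<in> frak_F \<epsilon>" for H
    using frak_F_properties(1)[OF normal_forms_in_frak_F(1)[OF nf[OF that] assms] assms] .
  have "continuous_map ?X jet_vector_space (\<lambda>H. jet3 (normalization \<epsilon> H))"
    unfolding jet_vector_space_def continuous_map_componentwise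
  proof (intro conjI ballI)
    show "(\<lambda>H. jet3 (normalization \<epsilon> H)) ` topspace ?X \<subseteq> extensional multi_indices3"
      by (auto simp: jet3_def)
    fix k assume "k \<in> multi_indices3"
    then show "continuous_map ?X euclidean (\<lambda>H. jet3 (normalization \<epsilon> H) k)"
      using comp[of "fst k" "snd k"] by (simp add: jet3_def case_prod_unfold)
  qed
  then have "continuous_map ?X (jet_space \<epsilon>) (jet3 \<circ> normalization \<epsilon>)"
    unfolding jet_space_def continuous_map_in_subtopology top using cF by (auto simp: comp_def class_F_def)
  then have "continuous_map ?X (tau_J \<epsilon>) (normalization \<epsilon>)"
    unfolding tau_J_def by (rule continuous_map_pullback') (use cF top in auto)
  then have "continuous_map ?X ?X (normalization \<epsilon>)"
    using nf normal_forms_in_frak_F(1)[OF _ assms] top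
    by (subst (2) tau_J_frak_F_def) (auto simp: continuous_map_in_subtopology)
  then show ?thesis
    unfolding tau_J_normal_forms_def using nf top by (auto simp: continuous_map_in_subtopology)
qed

theorem theorem1p5:
  fixes \<epsilon> :: real
  assumes "\<epsilon> = 1 \<or> \<epsilon> = -1"
  shows "tau_Q \<epsilon> = tau_J_normal_forms \<epsilon>"
  unfolding topology_eq
proof (intro allI iffI)
  fix U
  have top: "topspace (tau_J_frak_F \<epsilon>) = frak_F \<epsilon>" by (rule topspace_tau_J_frak_F[OF assms])
  note nf = normal_forms_in_frak_F[OF _ assms]
  show "openin (tau_J_normal_forms \<epsilon>) U" if "openin (tau_Q \<epsilon>) U"
  proof -
    have U: "U \<subseteq> normal_forms \<epsilon>" "openin (tau_J_frak_F \<epsilon>) {H \<in> frak_F \<epsilon>. normalization \<epsilon> H \<in> U}"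
      using that by (simp_all add: openin_tau_Q)
    \<comment> \<open>Normal forms are fixed by the normalization, so the preimage of \<open>U\<close> meets them exactly in \<open>U\<close>.\<close>
    have "U = {H \<in> frak_F \<epsilon>. normalization \<epsilon> H \<in> U} \<inter> normal_forms \<epsilon>"
      using U(1) nf by auto
    then show ?thesis using U(2) unfolding tau_J_normal_forms_def openin_subtopology by blast
  qed
  show "openin (tau_Q \<epsilon>) U" if U: "openin (tau_J_normal_forms \<epsilon>) U"
    unfolding openin_tau_Q
  proof
    show "U \<subseteq> normal_forms \<epsilon>" using U unfolding tau_J_normal_forms_def openin_subtopology by blast
    show "openin (tau_J_frak_F \<epsilon>) {H \<in> frak_F \<epsilon>. normalization \<epsilon> H \<in> U}"
      using openin_continuous_map_preimage[OF continuous_map_normalization[OF assms] U] top by simp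
  qed
qed

end
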